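(* Let $M$ be an integral $P_l(\mathcal{O}_K)$-module of type $(r_1, \ldots, r_l)$. For $1 \leq i \leq l$ let $R_i$ be a free $\mathcal{O}_K$-submodule of finite index $h_i$ in $Q_i(M)$. Define $$\pi_i = \frac{(h_i \cdots h_l)^{r_i + \cdots + r_l}}{h_i^{r_i}}.$$ There are exactly $\pi_1 \cdots \pi_l$ standard submodules associated with $(R_1, \ldots, R_l)$ in $M$.
   Context: Let $K$ be an algebraic number field with maximal order $\mathcal{O}_K$, let $l \in \mathbb{N}$ be positive, and let $P_l(\mathcal{O}_K) = \mathcal{O}_K[y]/(y^l)$. Modules are written with the action on the right. A $P_l(\mathcal{O}_K)$-module $M$ is integral if $M \cong \mathbb{Z}^n$ as abelian group for some $n \in \mathbb{N}$. For a $P_l(\mathcal{O}_K)$-module $M$ define $K_i(M) = \{ m \in M \mid m y^i = 0\}$ for $0 \leq i \leq l+1$, $L_i(M) = K_{i+1}(M)y + K_{i-1}(M)$ and $Q_i(M) = K_i(M)/L_i(M)$ for $1 \leq i \leq l$. The type of an integral module $M$ is the sequence $(r_1,\ldots,r_l)$ with $r_i = \mathrm{rank}(Q_i(M))/\mathrm{rank}(\mathcal{O}_K)$, where $\mathrm{rank}$ is the torsion free rank of an abelian group. The module $M$ is standard if it is integral and $Q_i(M)$ is free as $\mathcal{O}_K$-module for $1 \leq i \leq l$. A standard submodule of $M$ is a $P_l(\mathcal{O}_K)$-submodule that is standard as a $P_l(\mathcal{O}_K)$-module. A standard submodule $S$ of finite index in $M$ is associated with $(R_1,\ldots,R_l)$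 if, for each $1 \le i \le l$, $R_i$ is the image of the map $Q_i(S) \to Q_i(M): a + L_i(S) \mapsto a + L_i(M)$. *)

theory Defs
  imports "HOL-Computational_Algebra.Polynomial" "HOL-Algebra.Algebra"
begin

hide_const (open) Polynomial.monom
no_notation Sum_Type.Plus (infixr \<open><+>\<close> 65)

section \<open>Number fields and the rings \<open>P\<^sub>l(\<O>\<^sub>K) = \<O>\<^sub>K[y]/(y\<^sup>l)\<close>\<close>

text \<open>An algebraic number field is a field of characteristic 0 that is a
  finite-dimensional vector space over the rationals.\<close>

class number_field = field_char_0 +
  assumes finite_dimensional_over_rat:
    "\<exists>B :: 'a set. finite B \<and> (\<forall>x. \<exists>q :: 'a \<Rightarrow> rat. x = (\<Sum>b\<in>B. of_rat (q b) * b))"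

definition max_order :: "'k::number_field ring" where
  "max_order = \<lparr>carrier = {x. algebraic_int x}, mult = (*), one = 1, ring.zero = 0, add = (+)\<rparr>"

definition y_ideal :: "nat \<Rightarrow> (nat \<Rightarrow> 'k::number_field) set" where
  "y_ideal l = PIdl\<^bsub>UP max_order\<^esub> (monom (UP max_order) 1 l)"

definition P_ring :: "nat \<Rightarrow> (nat \<Rightarrow> 'k::number_field) set ring" where
  "P_ring l = UP max_order Quot y_ideal l"

definition P_y :: "nat \<Rightarrow> (nat \<Rightarrow> 'k::number_field) set" where
  "P_y l = y_ideal l +>\<^bsub>UP max_order\<^esub> monom (UP max_order) 1 1"

definition P_const :: "nat \<Rightarrow> 'k::number_field \<Rightarrow> (nat \<Rightarrow> 'k) set" where
  "P_const l a = y_ideal l +>\<^bsub>UP max_order\<^esub> monom (UP max_order) a 0"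


section \<open>General notions for modules and abelian groups\<close>

definition free_module :: "('a, 'c) ring_scheme \<Rightarrow> ('a, 'b, 'd) module_scheme \<Rightarrow> bool" where
  "free_module R M \<longleftrightarrow> (\<exists>B \<subseteq> carrier M.
     (\<forall>A c. finite A \<longrightarrow> A \<subseteq> B \<longrightarrow> c \<in> A \<rightarrow> carrier R \<longrightarrow>
        (\<Oplus>\<^bsub>M\<^esub>b\<in>A. c b \<odot>\<^bsub>M\<^esub> b) = \<zero>\<^bsub>M\<^esub> \<longrightarrow> (\<forall>b\<in>A. c b = \<zero>\<^bsub>R\<^esub>)) \<and>
     (\<forall>x\<in>carrier M. \<exists>A c. finite A \<and> A \<subseteq> B \<and> c \<in> A \<rightarrow> carrier R \<and>
        x = (\<Oplus>\<^bsub>M\<^esub>b\<in>A. c b \<odot>\<^bsub>M\<^esub> b)))"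

text \<open>The torsion free rank of an additive abelian group: the maximal number of
  elements that are linearly independent over the integers. This convention is meant
  for groups of finite rank only, since \<^const>\<open>Greatest\<close> has no specified
  value otherwise.\<close>

definition int_independent :: "('a, 'b) ring_scheme \<Rightarrow> 'a set \<Rightarrow> bool" where
  "int_independent G B \<longleftrightarrow>
     (\<forall>c :: 'a \<Rightarrow> int. (\<Oplus>\<^bsub>G\<^esub>b\<in>B. [c b] \<cdot>\<^bsub>G\<^esub> b) = \<zero>\<^bsub>G\<^esub> \<longrightarrow> (\<forall>b\<in>B. c b = 0))"

definition torsion_free_rank :: "('a, 'b) ring_scheme \<Rightarrow> nat" where
  "torsion_free_rank G =
     (GREATEST n. \<exists>B. B \<subseteq> carrier G \<and> finite B \<and> card B = n \<and> int_independent G B)"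

text \<open>The quotient module \<open>N / H\<close> for a submodule \<open>H\<close>, with the action of \<open>R\<close> on \<open>N\<close> pulled
  back along a map \<open>\<phi>\<close> into \<open>R\<close>. The ring fields \<^const>\<open>mult\<close> and \<^const>\<open>one\<close> of
  a module record carry no meaning.\<close>

definition quot_module ::
  "('s \<Rightarrow> 'a) \<Rightarrow> ('a, 'm, 'd) module_scheme \<Rightarrow> 'm set \<Rightarrow> ('s, 'm set) module" where
  "quot_module \<phi> N H =
     \<lparr>carrier = a_rcosets\<^bsub>N\<^esub> H, mult = undefined, one = undefined, ring.zero = H, add = set_add N,
      smult = (\<lambda>a C. \<Union>m\<in>C. H +>\<^bsub>N\<^esub> (\<phi> a \<odot>\<^bsub>N\<^esub> m))\<rparr>"


section \<open>The modules \<open>K\<^sub>i(M)\<close>, \<open>L\<^sub>i(M)\<close>, \<open>Q\<^sub>i(M)\<close>\<close>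

text \<open>All rings are commutative, so right modules are written as left modules.
  A submodule \<open>S\<close> of \<open>M\<close>, viewed as a module, is \<open>M\<lparr>carrier := S\<rparr>\<close>.\<close>

type_synonym ('k, 'm) P_module = "((nat \<Rightarrow> 'k) set, 'm) module"

definition K_sub :: "nat \<Rightarrow> ('k::number_field, 'm) P_module \<Rightarrow> nat \<Rightarrow> 'm set" where
  "K_sub l M i = {m \<in> carrier M. (P_y l [^]\<^bsub>P_ring l\<^esub> i) \<odot>\<^bsub>M\<^esub> m = \<zero>\<^bsub>M\<^esub>}"

definition L_sub :: "nat \<Rightarrow> ('k::number_field, 'm) P_module \<Rightarrow> nat \<Rightarrow> 'm set" where
  "L_sub l M i = (\<lambda>m. P_y l \<odot>\<^bsub>M\<^esub> m) ` K_sub l M (i + 1) <+>\<^bsub>M\<^esub> K_sub l M (i - 1)"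

definition Q_mod :: "nat \<Rightarrow> ('k::number_field, 'm) P_module \<Rightarrow> nat \<Rightarrow> ('k, 'm set) module" where
  "Q_mod l M i = quot_module (P_const l) (M\<lparr>carrier := K_sub l M i\<rparr>) (L_sub l M i)"


section \<open>Integral and standard modules\<close>

definition integral_module :: "('k::number_field, 'm) P_module \<Rightarrow> bool" where
  "integral_module M \<longleftrightarrow>
     (\<exists>n::nat. add_monoid M \<cong> product_group {..<n} (\<lambda>_. integer_group))"

definition module_type :: "nat \<Rightarrow> ('k::number_field, 'm) P_module \<Rightarrow> nat \<Rightarrow> real" where
  "module_type l M i =
     real (torsion_free_rank (Q_mod l M i)) / real (torsion_free_rank (max_order :: 'k ring))"

definition standard_module :: "nat \<Rightarrow> ('k::number_field, 'm) P_module \<Rightarrow> bool" where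
  "standard_module l M \<longleftrightarrow>
     integral_module M \<and> (\<forall>i\<in>{1..l}. free_module max_order (Q_mod l M i))"

definition standard_submodule ::
  "nat \<Rightarrow> 'm set \<Rightarrow> ('k::number_field, 'm) P_module \<Rightarrow> bool" where
  "standard_submodule l S M \<longleftrightarrow>
     submodule S (P_ring l) M \<and> standard_module l (M\<lparr>carrier := S\<rparr>)"

text \<open>The natural map from \<open>Q\<^sub>i(S)\<close> to \<open>Q\<^sub>i(M)\<close> on cosets; by the lemma below it sends
  \<open>L\<^sub>i(S) + a\<close> to \<open>L\<^sub>i(M) + a\<close>.\<close>

definition Q_map ::
  "nat \<Rightarrow> ('k::number_field, 'm) P_module \<Rightarrow> nat \<Rightarrow> 'm set \<Rightarrow> 'm set" where
  "Q_map l M i C = (\<Union>a\<in>C. L_sub l M i +>\<^bsub>M\<^esub> a)"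

definition associated ::
  "nat \<Rightarrow> ('k::number_field, 'm) P_module \<Rightarrow> (nat \<Rightarrow> 'm set set) \<Rightarrow> 'm set \<Rightarrow> bool" where
  "associated l M R S \<longleftrightarrow>
     standard_submodule l S M \<and> finite (a_rcosets\<^bsub>M\<^esub> S) \<and>
     (\<forall>i\<in>{1..l}. R i = Q_map l M i ` carrier (Q_mod l (M\<lparr>carrier := S\<rparr>) i))"

lemma P_y_closed: "(P_y l :: (nat \<Rightarrow> 'k::number_field) set) \<in> carrier (P_ring l)"
proof -
  have "(monom (UP max_order) 1 1 :: nat \<Rightarrow> 'k) \<in> carrier (UP max_order)"
    by (auto simp: UP_def up_def max_order_def bound_def intro!: exI[of _ 1])
  then show ?thesis
    by (auto simp: P_y_def P_ring_def FactRing_def A_RCOSETS_def')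
qed

lemma submodule_K_sub:
  fixes M :: "('k::number_field, 'm) P_module"
  assumes M: "module (P_ring l) M"
  shows "submodule (K_sub l M i) (P_ring l) M"
proof -
  interpret module "P_ring l :: (nat \<Rightarrow> 'k) set ring" M by (rule M)
  have p: "(P_y l :: (nat \<Rightarrow> 'k) set) [^]\<^bsub>P_ring l\<^esub> i \<in> carrier (P_ring l)"
    by (rule R.nat_pow_closed[OF P_y_closed])
  show ?thesis
  proof (rule submoduleI)
    fix a x assume a: "a \<in> carrier (P_ring l :: (nat \<Rightarrow> 'k) set ring)" and x: "x \<in> K_sub l M i"
    have "(P_y l [^]\<^bsub>P_ring l\<^esub> i) \<odot>\<^bsub>M\<^esub> (a \<odot>\<^bsub>M\<^esub> x) =
        a \<odot>\<^bsub>M\<^esub> ((P_y l [^]\<^bsub>P_ring l\<^esub> i) \<odot>\<^bsub>M\<^esub> x)"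
      using smult_assoc1[OF p a] smult_assoc1[OF a p] R.m_comm[OF a p] x
      by (simp add: K_sub_def)
    then show "a \<odot>\<^bsub>M\<^esub> x \<in> K_sub l M i" using a x by (simp add: K_sub_def)
  qed (use p in \<open>auto simp: K_sub_def smult_r_distr smult_r_minus\<close>)
qed

lemma additive_subgroup_L_sub:
  fixes M :: "('k::number_field, 'm) P_module"
  assumes M: "module (P_ring l) M"
  shows "additive_subgroup (L_sub l M i) M"
proof -
  interpret module "P_ring l :: (nat \<Rightarrow> 'k) set ring" M by (rule M)
  let ?y = "\<lambda>m. P_y l \<odot>\<^bsub>M\<^esub> m"
  have y: "(P_y l :: (nat \<Rightarrow> 'k) set) \<in> carrier (P_ring l)" by (rule P_y_closed)
  note K = submoduleE[OF submodule_K_sub[OF M, of "i + 1"]]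
  have "subgroup (?y ` K_sub l M (i + 1)) (add_monoid M)"
  proof (rule add.subgroupI)
    show "?y ` K_sub l M (i + 1) \<subseteq> carrier M" using K(1) y by auto
    show "?y ` K_sub l M (i + 1) \<noteq> {}" using K(2) by auto
    show "\<ominus>\<^bsub>M\<^esub> u \<in> ?y ` K_sub l M (i + 1)"
      if "u \<in> ?y ` K_sub l M (i + 1)" for u
      using that K(1,3) y
      by (auto simp: smult_r_minus[symmetric] subset_iff)
    show "u \<oplus>\<^bsub>M\<^esub> v \<in> ?y ` K_sub l M (i + 1)"
      if "u \<in> ?y ` K_sub l M (i + 1)" "v \<in> ?y ` K_sub l M (i + 1)" for u v
      using that K(1,5) y
      by (auto simp: smult_r_distr[symmetric] subset_iff)
  qed
  moreover have "subgroup (K_sub l M (i - 1)) (add_monoid M)"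
    using submodule_K_sub[OF M] by (rule submodule.axioms)
  ultimately show ?thesis
    unfolding L_sub_def by (intro M.add_additive_subgroups additive_subgroup.intro)
qed

lemma Q_map_coset:
  fixes M :: "('k::number_field, 'm) P_module"
  assumes M: "module (P_ring l) M" and S: "submodule S (P_ring l) M"
    and a: "a \<in> K_sub l (M\<lparr>carrier := S\<rparr>) i"
  shows "Q_map l M i (L_sub l (M\<lparr>carrier := S\<rparr>) i +>\<^bsub>M\<lparr>carrier := S\<rparr>\<^esub> a) = L_sub l M i +>\<^bsub>M\<^esub> a"
proof -
  interpret module "P_ring l :: (nat \<Rightarrow> 'k) set ring" M by (rule M)
  let ?N = "M\<lparr>carrier := S\<rparr>"
  have N: "module (P_ring l) ?N" by (rule submodule.submodule_is_module[OF S M])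
  interpret LN: additive_subgroup "L_sub l ?N i" ?N by (rule additive_subgroup_L_sub[OF N])
  interpret LM: additive_subgroup "L_sub l M i" M by (rule additive_subgroup_L_sub[OF M])
  have SM: "S \<subseteq> carrier M" by (rule submoduleE(1)[OF S])
  have "K_sub l ?N j \<subseteq> K_sub l M j" for j using SM by (auto simp: K_sub_def)
  then have LL: "L_sub l ?N i \<subseteq> L_sub l M i"
    by (fastforce simp: L_sub_def set_add_def set_mult_def)
  have aM: "a \<in> carrier M" using a SM by (auto simp: K_sub_def)
  have coset: "L_sub l M i +>\<^bsub>M\<^esub> (b \<oplus>\<^bsub>M\<^esub> a) = L_sub l M i +>\<^bsub>M\<^esub> a"
    if "b \<in> L_sub l ?N i" for b
  proof -
    have b: "b \<in> L_sub l M i" using that LL by blast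
    have "L_sub l M i +>\<^bsub>M\<^esub> (b \<oplus>\<^bsub>M\<^esub> a) = L_sub l M i +>\<^bsub>M\<^esub> b +>\<^bsub>M\<^esub> a"
      using M.a_coset_add_assoc[OF LM.a_subset _ aM] b LM.a_Hcarr by simp
    also have "L_sub l M i +>\<^bsub>M\<^esub> b = L_sub l M i"
      using M.a_coset_join2[OF LM.a_Hcarr[OF b] LM.a_subgroup b] .
    finally show ?thesis .
  qed
  have "\<zero>\<^bsub>M\<^esub> \<in> L_sub l ?N i" using LN.zero_closed by simp
  then show ?thesis using coset by (auto simp: Q_map_def a_r_coset_def')
qed

end

theory Submission
  imports Defs "Jordan_Normal_Form.Char_Poly"
begin

text \<open>
  Let \<open>y\<close> also denote the action of the class of \<open>y\<close>, so that \<open>K\<^sub>i\<close> is the kernel of \<open>y\<^sup>i\<close>. The idea is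
  to recognise the standard submodules associated with \<open>(R\<^sub>1, \<dots>, R\<^sub>l)\<close> by a condition on subgroups
  only, and then to count them through lifts of bases of the \<open>R\<^sub>i\<close>.

  \<^bold>\<open>Recognition.\<close> A submodule \<open>S\<close> is associated with \<open>(R\<^sub>i)\<close> if and only if every map
  \<open>Q\<^sub>i(S) \<rightarrow> Q\<^sub>i(M)\<close> is injective with image \<open>R\<^sub>i\<close> (\<open>associated_iff\<close>; such \<open>S\<close> are called adapted). For an
  associated \<open>S\<close> the kernel is torsion, as \<open>S\<close> has finite index, while \<open>Q\<^sub>i(S)\<close> is free. Conversely,
  injectivity gives \<open>Q\<^sub>i(S) \<cong> R\<^sub>i\<close>, which is free, and the index of \<open>S\<close> turns out to be finite.

  \<^bold>\<open>Indices.\<close> Multiplication by \<open>y\<close> embeds the layer \<open>K\<^sub>i\<^sub>+\<^sub>1/K\<^sub>i\<close> into \<open>K\<^sub>i/K\<^sub>i\<^sub>-\<^sub>1\<close> with cokernel \<open>Q\<^sub>i\<close>. Comparing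
  the layers of an adapted \<open>S\<close> with those of \<open>M\<close>, the index in layer \<open>i\<close> is \<open>h\<^sub>i\<close> times the index in
  layer \<open>i + 1\<close>, thus \<open>h\<^sub>i \<cdots> h\<^sub>l\<close>. Hence \<open>[K\<^sub>i(M) : K\<^sub>i(S)] = \<Prod>\<^sub>k\<^sub>\<le>\<^sub>i h\<^sub>k \<cdots> h\<^sub>l\<close> (\<open>index_Int_K\<close>), and division by
  \<open>h\<^sub>i\<close> gives \<open>e\<^sub>i = [L\<^sub>i(M) : L\<^sub>i(S)]\<close> (\<open>index_L\<close>). All these numbers are the same for all adapted \<open>S\<close>.

  \<^bold>\<open>Lifts.\<close> Let \<open>B\<^sub>i\<close> be a basis of \<open>R\<^sub>i\<close> and choose a lift in \<open>K\<^sub>i(M)\<close> of each element of each \<open>B\<^sub>i\<close>. The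
  submodule generated by the lifts is adapted (\<open>gen_adapted\<close>), and it is the only adapted submodule
  that contains them, because adapted submodules have equal finite index. Every adapted \<open>S\<close> contains
  such a family: the lifts of \<open>b \<in> B\<^sub>i\<close> form a coset of \<open>L\<^sub>i(M)\<close>, and those lying in \<open>S\<close> form a coset of
  \<open>L\<^sub>i(S)\<close>. Modulo a subgroup of finite index contained in all \<open>L\<^sub>i(S)\<close>, the finitely many families of
  lifts are thus divided into classes of equal size, one for each \<open>S\<close>, and the number of classes is
  the product of the powers of the \<open>e\<^sub>i\<close> with exponents \<open>card B\<^sub>i\<close> (\<open>card_adapted_submodules\<close>).

  \<^bold>\<open>Ranks.\<close> Finally \<open>card B\<^sub>i = r\<^sub>i\<close>, since \<open>R\<^sub>i\<close> has finite index in \<open>Q\<^sub>i(M)\<close> (\<open>torsion_free_rank_eq\<close>), and the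
  product is rearranged into \<open>\<pi>\<^sub>1 \<cdots> \<pi>\<^sub>l\<close> (\<open>count_formula\<close>).
\<close>

no_notation Sum_Type.Plus (infixr \<open><+>\<close> 65)

section \<open>The ring of algebraic integers\<close>

definition int_span :: "'a::comm_ring_1 set \<Rightarrow> 'a set" where
  "int_span G = range (\<lambda>c. \<Sum>g\<in>G. of_int (c g) * g)"

lemma int_span_add: "u \<in> int_span G \<Longrightarrow> v \<in> int_span G \<Longrightarrow> u + v \<in> int_span G"
proof -
  assume "u \<in> int_span G" "v \<in> int_span G"
  then obtain c d where "u = (\<Sum>g\<in>G. of_int (c g) * g)" "v = (\<Sum>g\<in>G. of_int (d g) * g)"
    by (auto simp: int_span_def)
  then have "u + v = (\<Sum>g\<in>G. of_int (c g + d g) * g)"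
    by (simp add: sum.distrib distrib_right)
  then show ?thesis unfolding int_span_def by (rule range_eqI[of _ "\<lambda>c. \<Sum>g\<in>G. of_int (c g) * g"])
qed

lemma int_span_of_int_mult: "u \<in> int_span G \<Longrightarrow> of_int k * u \<in> int_span G"
proof -
  assume "u \<in> int_span G"
  then obtain c where "u = (\<Sum>g\<in>G. of_int (c g) * g)" by (auto simp: int_span_def)
  then have "of_int k * u = (\<Sum>g\<in>G. of_int (k * c g) * g)"
    by (simp add: sum_distrib_left mult.assoc)
  then show ?thesis unfolding int_span_def by (rule range_eqI[of _ "\<lambda>c. \<Sum>g\<in>G. of_int (c g) * g"])
qed

lemma int_span_0: "0 \<in> int_span G"
  unfolding int_span_def by (rule range_eqI[of _ _ "\<lambda>_. 0"]) simp

lemma int_span_sum: "(\<And>i. i \<in> I \<Longrightarrow> f i \<in> int_span G) \<Longrightarrow> (\<Sum>i\<in>I. f i) \<in> int_span G"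
  by (induction I rule: infinite_finite_induct) (auto simp: int_span_0 int_span_add)

lemma int_span_base: "finite G \<Longrightarrow> g \<in> G \<Longrightarrow> g \<in> int_span G"
proof -
  assume "finite G" "g \<in> G"
  have "(\<Sum>h\<in>G. of_int (if h = g then 1 else 0) * h) = (\<Sum>h\<in>G. if h = g then h else 0)"
    by (rule sum.cong) auto
  also have "\<dots> = g" using \<open>finite G\<close> \<open>g \<in> G\<close> by simp
  finally have "g = (\<Sum>h\<in>G. of_int (if h = g then 1 else 0) * h)" by (rule sym)
  then show ?thesis unfolding int_span_def by (rule range_eqI[of _ _ "\<lambda>h. if h = g then 1 else 0"])
qed

lemma int_span_mult_closed:
  assumes "\<And>g. g \<in> G \<Longrightarrow> z * g \<in> int_span G" and "u \<in> int_span G"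
  shows "z * u \<in> int_span G"
proof -
  obtain c where "u = (\<Sum>g\<in>G. of_int (c g) * g)" using assms(2) by (auto simp: int_span_def)
  then have "z * u = (\<Sum>g\<in>G. of_int (c g) * (z * g))"
    by (simp add: sum_distrib_left mult.left_commute)
  also have "\<dots> \<in> int_span G" by (intro int_span_sum int_span_of_int_mult assms(1))
  finally show ?thesis .
qed

text \<open>If multiplication by \<open>z\<close> preserves a finitely generated subgroup containing a nonzero
  element, then \<open>z\<close> is an eigenvalue of an integer matrix, hence a root of its (monic, integral)
  characteristic polynomial.\<close>

lemma algebraic_int_if_stable:
  fixes z :: "'a::field_char_0"
  assumes fin: "finite G" and g0: "g0 \<in> G" "g0 \<noteq> 0"
    and stable: "\<And>g. g \<in> G \<Longrightarrow> z * g \<in> int_span G"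
  shows "algebraic_int z"
proof -
  define n where "n = card G"
  obtain w where w: "bij_betw w {0..<n} G"
    using ex_bij_betw_nat_finite[OF fin] n_def by blast
  have "\<forall>g\<in>G. \<exists>c. z * g = (\<Sum>h\<in>G. of_int (c h) * h)"
    using stable by (auto simp: int_span_def)
  then obtain c where c: "\<And>g. g \<in> G \<Longrightarrow> z * g = (\<Sum>h\<in>G. of_int (c g h) * h)"
    by metis
  define A :: "int mat" where "A = mat n n (\<lambda>(i, j). c (w i) (w j))"
  have A: "A \<in> carrier_mat n n" by (simp add: A_def)
  define v where "v = vec n w"
  obtain i0 where i0: "i0 < n" "w i0 = g0" using w g0(1) by (auto simp: bij_betw_def)
  have "eigenvector (map_mat of_int A) v z"
    unfolding eigenvector_def
  proof (intro conjI)
    show "v \<in> carrier_vec (dim_row (map_mat of_int A))" using A by (simp add: v_def)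
    show "v \<noteq> 0\<^sub>v (dim_row (map_mat of_int A))"
    proof
      assume "v = 0\<^sub>v (dim_row (map_mat of_int A))"
      then have "v $ i0 = 0" using i0 A by simp
      then show False using i0 g0 by (simp add: v_def)
    qed
    show "map_mat of_int A *\<^sub>v v = z \<cdot>\<^sub>v v"
    proof
      show "dim_vec (map_mat of_int A *\<^sub>v v) = dim_vec (z \<cdot>\<^sub>v v)" using A by (simp add: v_def)
      fix i assume "i < dim_vec (z \<cdot>\<^sub>v v)"
      then have i: "i < n" by (simp add: v_def)
      then have wi: "w i \<in> G" using w by (auto simp: bij_betw_def)
      have "(map_mat of_int A *\<^sub>v v) $ i = (\<Sum>j = 0..<n. of_int (c (w i) (w j)) * w j)"
        using i A by (simp add: v_def A_def scalar_prod_def)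
      also have "\<dots> = (\<Sum>h\<in>G. of_int (c (w i) h) * h)"
        by (rule sum.reindex_bij_betw[OF w])
      also have "\<dots> = z * w i" using c[OF wi] by simp
      finally show "(map_mat of_int A *\<^sub>v v) $ i = (z \<cdot>\<^sub>v v) $ i" using i by (simp add: v_def)
    qed
  qed
  then have "eigenvalue (map_mat of_int A) z" by (auto simp: eigenvalue_def)
  then have "poly (char_poly (map_mat of_int A)) z = 0"
    using eigenvalue_root_char_poly[of "map_mat of_int A" n z] A by simp
  then have "poly (map_poly of_int (char_poly A)) z = 0"
    by (simp only: of_int_hom.char_poly_hom[OF A])
  moreover have "Polynomial.lead_coeff (char_poly A) = 1" using degree_monic_char_poly[OF A] by simp
  ultimately show ?thesis unfolding algebraic_int_altdef_ipoly by blast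
qed

lemma algebraic_int_top_power:
  fixes x :: "'a::field_char_0"
  assumes "algebraic_int x"
  obtains n c where "n > 0" "x ^ n = (\<Sum>k<n. of_int (c k) * x ^ k)"
proof -
  obtain p :: "int poly" where p: "Polynomial.lead_coeff p = 1" "poly (map_poly of_int p) x = 0"
    using assms unfolding algebraic_int_altdef_ipoly by blast
  define n where "n = Polynomial.degree p"
  have "Polynomial.degree (map_poly of_int p :: 'a poly) = n" by (simp add: n_def)
  then have "0 = (\<Sum>k\<le>n. of_int (Polynomial.coeff p k) * x ^ k)"
    using p(2) by (simp add: poly_altdef)
  also have "\<dots> = x ^ n + (\<Sum>k<n. of_int (Polynomial.coeff p k) * x ^ k)"
    using p(1) by (simp add: n_def atMost_Suc_eq_insert_0 flip: lessThan_Suc_atMost)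
  finally have "x ^ n = (\<Sum>k<n. of_int (- Polynomial.coeff p k) * x ^ k)"
    by (simp add: sum_negf eq_neg_iff_add_eq_0)
  moreover have "n > 0"
  proof (rule ccontr)
    assume "\<not> n > 0"
    then have "n = 0" by simp
    with calculation show False by simp
  qed
  ultimately show thesis by (intro that)
qed

text \<open>The products \<open>x\<^sup>i y\<^sup>j\<close> with \<open>i\<close> and \<open>j\<close> below the degrees of the equations of \<open>x\<close> and \<open>y\<close> generate a
  subgroup that contains \<open>1\<close> and is stable under both \<open>x\<close> and \<open>y\<close>.\<close>

lemma algebraic_int_plus_times:
  fixes x y :: "'a::field_char_0"
  assumes x: "algebraic_int x" and y: "algebraic_int y"
  shows "algebraic_int (x + y)" "algebraic_int (x * y)"
proof -
  obtain n c where n: "n > 0" and xn: "x ^ n = (\<Sum>k<n. of_int (c k) * x ^ k)"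
    using algebraic_int_top_power[OF x] .
  obtain m d where m: "m > 0" and ym: "y ^ m = (\<Sum>k<m. of_int (d k) * y ^ k)"
    using algebraic_int_top_power[OF y] .
  define G where "G = (\<lambda>(i, j). x ^ i * y ^ j) ` ({..<n} \<times> {..<m})"
  have fin: "finite G" by (simp add: G_def)
  have one: "1 \<in> G" unfolding G_def using n m by (force intro!: image_eqI[of _ _ "(0, 0)"])
  have xy: "x ^ i * y ^ j \<in> int_span G" if "i < n" "j < m" for i j
    by (rule int_span_base[OF fin]) (use that in \<open>auto simp: G_def\<close>)
  have x': "x * g \<in> int_span G" if "g \<in> G" for g
  proof -
    obtain i j where ij: "i < n" "j < m" "g = x ^ i * y ^ j" using \<open>g \<in> G\<close> by (auto simp: G_def)
    show ?thesis
    proof (cases "Suc i < n")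
      case True
      then show ?thesis using xy[of "Suc i" j] ij by (simp add: mult.assoc)
    next
      case False
      then have "Suc i = n" using ij by simp
      then have "x * g = x ^ n * y ^ j" using ij by (auto simp: mult.assoc)
      also have "\<dots> = (\<Sum>k<n. of_int (c k) * (x ^ k * y ^ j))"
        by (simp add: xn sum_distrib_right mult.assoc)
      also have "\<dots> \<in> int_span G" by (intro int_span_sum int_span_of_int_mult xy ij) simp
      finally show ?thesis .
    qed
  qed
  have y': "y * g \<in> int_span G" if "g \<in> G" for g
  proof -
    obtain i j where ij: "i < n" "j < m" "g = x ^ i * y ^ j" using \<open>g \<in> G\<close> by (auto simp: G_def)
    show ?thesis
    proof (cases "Suc j < m")
      case True
      then show ?thesis using xy[of i "Suc j"] ij by (simp add: mult.left_commute)
    next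
      case False
      then have "Suc j = m" using ij by simp
      then have "y * g = x ^ i * y ^ m" using ij by (auto simp: mult.left_commute)
      also have "\<dots> = (\<Sum>k<m. of_int (d k) * (x ^ i * y ^ k))"
        by (simp add: ym sum_distrib_left mult.left_commute)
      also have "\<dots> \<in> int_span G" by (intro int_span_sum int_span_of_int_mult xy ij) simp
      finally show ?thesis .
    qed
  qed
  show "algebraic_int (x + y)"
  proof (rule algebraic_int_if_stable[OF fin one])
    show "(x + y) * g \<in> int_span G" if "g \<in> G" for g
      unfolding distrib_right by (rule int_span_add[OF x'[OF that] y'[OF that]])
  qed simp
  show "algebraic_int (x * y)"
  proof (rule algebraic_int_if_stable[OF fin one])
    show "(x * y) * g \<in> int_span G" if "g \<in> G" for g
      unfolding mult.assoc by (rule int_span_mult_closed[OF x' y'[OF that]])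
  qed simp
qed

lemma max_order_simps [simp]:
  "carrier max_order = {x. algebraic_int x}" "\<zero>\<^bsub>max_order\<^esub> = 0" "\<one>\<^bsub>max_order\<^esub> = 1"
  "a \<oplus>\<^bsub>max_order\<^esub> b = a + b" "a \<otimes>\<^bsub>max_order\<^esub> b = a * b"
  by (simp_all add: max_order_def)

lemma cring_max_order: "cring (max_order :: 'k::number_field ring)"
proof (rule cringI)
  show "abelian_group (max_order :: 'k ring)"
  proof (rule abelian_groupI)
    fix x :: 'k assume "x \<in> carrier max_order"
    then show "\<exists>y\<in>carrier max_order. y \<oplus>\<^bsub>max_order\<^esub> x = \<zero>\<^bsub>max_order\<^esub>"
      by (intro bexI[of _ "- x"]) simp_all
  qed (simp_all add: algebraic_int_plus_times algebra_simps)
  show "Group.comm_monoid (max_order :: 'k ring)"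
    by (rule comm_monoidI) (simp_all add: algebraic_int_plus_times algebra_simps)
qed (simp_all add: algebra_simps)

section \<open>Indices of subgroups of an abelian group\<close>

text \<open>Quotient sets are handled as images of the map to cosets; \<open>f\<close> then induces a bijection between
  two of them.\<close>

lemma card_image_transfer:
  assumes "f \<in> A \<rightarrow> A'"
    and "\<And>a b. a \<in> A \<Longrightarrow> b \<in> A \<Longrightarrow> p a = p b \<longleftrightarrow> q (f a) = q (f b)"
    and "\<And>x. x \<in> A' \<Longrightarrow> \<exists>a\<in>A. q x = q (f a)"
  shows "card (p ` A) = card (q ` A')"
proof -
  define t where "t Z = q (f (SOME a. a \<in> A \<and> p a = Z))" for Z
  have t: "t (p a) = q (f a)" if "a \<in> A" for a
  proof -
    define b where "b = (SOME b. b \<in> A \<and> p b = p a)"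
    have b: "b \<in> A \<and> p b = p a"
      unfolding b_def by (rule someI[of _ a]) (use that in simp)
    then show ?thesis using assms(2)[of b a] that by (simp add: t_def b_def)
  qed
  have "inj_on t (p ` A)" using assms(2) by (auto simp: inj_on_def t)
  moreover have "t ` p ` A = q ` A'"
  proof
    show "t ` p ` A \<subseteq> q ` A'" using assms(1) by (auto simp: t)
    show "q ` A' \<subseteq> t ` p ` A"
    proof
      fix z assume "z \<in> q ` A'"
      then obtain a where "a \<in> A" "z = q (f a)" using assms(3) by blast
      then show "z \<in> t ` p ` A" using t by (metis imageI)
    qed
  qed
  ultimately show ?thesis using card_image by metis
qed

text \<open>An infinite index counts as \<open>0\<close>. The product formula below is proved by a bijection, so it
  remains valid in that case, and finiteness of an index is its positivity.\<close>

definition a_index :: "('a, 'b) ring_scheme \<Rightarrow> 'a set \<Rightarrow> 'a set \<Rightarrow> nat" where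
  "a_index G A B = card ((\<lambda>a. B +>\<^bsub>G\<^esub> a) ` A)"

context abelian_group
begin

lemma add_diff_cancel_right': "u \<in> carrier G \<Longrightarrow> v \<in> carrier G \<Longrightarrow> u \<oplus> v \<ominus> v = u"
  by (simp add: a_minus_def a_assoc r_neg)

lemma add_diff_cancel_left': "u \<in> carrier G \<Longrightarrow> v \<in> carrier G \<Longrightarrow> u \<oplus> v \<ominus> u = v"
  using add_diff_cancel_right'[of v u] by (simp add: a_comm)

lemma diff_add_cancel: "u \<in> carrier G \<Longrightarrow> v \<in> carrier G \<Longrightarrow> u \<ominus> v \<oplus> v = u"
  by (simp add: a_minus_def a_assoc l_neg)

lemma diff_zero: "u \<in> carrier G \<Longrightarrow> u \<ominus> \<zero> = u"
  using diff_add_cancel[of u \<zero>] by simp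

lemma add_diff_add:
  "a \<in> carrier G \<Longrightarrow> b \<in> carrier G \<Longrightarrow> c \<in> carrier G \<Longrightarrow> d \<in> carrier G \<Longrightarrow>
    (a \<oplus> b) \<ominus> (c \<oplus> d) = (a \<ominus> c) \<oplus> (b \<ominus> d)"
  by (simp add: a_minus_def minus_add a_ac)

lemma diff_add_diff:
  "a \<in> carrier G \<Longrightarrow> b \<in> carrier G \<Longrightarrow> c \<in> carrier G \<Longrightarrow> (a \<ominus> b) \<oplus> (b \<ominus> c) = a \<ominus> c"
  by (simp add: a_minus_def a_assoc r_neg1)

lemma a_rcos_iff:
  assumes "additive_subgroup B G" and "a \<in> carrier G"
  shows "x \<in> B +> a \<longleftrightarrow> x \<in> carrier G \<and> x \<ominus> a \<in> B"
proof -
  interpret B: additive_subgroup B G by fact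
  show ?thesis
  proof
    assume "x \<in> B +> a"
    then obtain b where b: "b \<in> B" "x = b \<oplus> a" by (auto simp: a_r_coset_def')
    have "b \<oplus> a \<ominus> a = b" using b(1) B.a_Hcarr assms(2) by (simp add: add_diff_cancel_right')
    then show "x \<in> carrier G \<and> x \<ominus> a \<in> B" using b B.a_Hcarr assms(2) by simp
  next
    assume x: "x \<in> carrier G \<and> x \<ominus> a \<in> B"
    then have "x = (x \<ominus> a) \<oplus> a" using assms(2) by (simp add: a_minus_def a_assoc l_neg)
    then show "x \<in> B +> a" using x by (auto simp: a_r_coset_def')
  qed
qed

lemma coset_eq_iff:
  assumes "additive_subgroup B G" and "a \<in> carrier G" "b \<in> carrier G"
  shows "B +> a = B +> b \<longleftrightarrow> a \<ominus> b \<in> B"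
proof -
  interpret B: additive_subgroup B G by fact
  show ?thesis
  proof
    assume "B +> a = B +> b"
    moreover have "a \<in> B +> a"
      using assms by (simp add: a_rcos_iff r_neg a_minus_def)
    ultimately show "a \<ominus> b \<in> B" using assms by (simp add: a_rcos_iff)
  next
    assume ab: "a \<ominus> b \<in> B"
    have "x \<ominus> a \<in> B \<longleftrightarrow> x \<ominus> b \<in> B" if x: "x \<in> carrier G" for x
    proof -
      have "b \<ominus> a = \<ominus> (a \<ominus> b)" using assms(2,3) by (simp add: a_minus_def minus_add a_comm)
      then have "b \<ominus> a \<in> B" using ab by simp
      then show ?thesis
        using ab B.a_closed[of "x \<ominus> a" "a \<ominus> b"] B.a_closed[of "x \<ominus> b" "b \<ominus> a"] x assms(2,3)
        by (auto simp: diff_add_diff)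
    qed
    then show "B +> a = B +> b" using assms by (auto simp: a_rcos_iff)
  qed
qed

lemma additive_subgroup_minus:
  "additive_subgroup B G \<Longrightarrow> a \<in> B \<Longrightarrow> b \<in> B \<Longrightarrow> a \<ominus> b \<in> B"
  by (simp add: a_minus_def additive_subgroup.a_closed additive_subgroup.a_inv_closed)

text \<open>With representatives \<open>\<rho>\<close> for \<open>A/B\<close>, the map \<open>(Z, Y) \<mapsto> Y + \<rho> Z\<close> is a bijection from
  \<open>A/B \<times> B/C\<close> to \<open>A/C\<close>.\<close>

lemma a_index_tower:
  assumes A: "additive_subgroup A G" and B: "additive_subgroup B G" and C: "additive_subgroup C G"
    and CB: "C \<subseteq> B" and BA: "B \<subseteq> A"
  shows "a_index G A C = a_index G A B * a_index G B C"
proof -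
  interpret A: additive_subgroup A G by fact
  interpret B: additive_subgroup B G by fact
  interpret C: additive_subgroup C G by fact
  define \<rho> where "\<rho> Z = (SOME a. a \<in> A \<and> B +> a = Z)" for Z
  have \<rho>: "\<rho> Z \<in> A" "B +> \<rho> Z = Z" if "Z \<in> (\<lambda>a. B +> a) ` A" for Z
    using someI_ex[of "\<lambda>a. a \<in> A \<and> B +> a = Z"] that unfolding \<rho>_def by blast+
  define f where "f = (\<lambda>(Z, Y). (\<lambda>y. y \<oplus> \<rho> Z) ` Y)"
  have f: "f (Z, C +> b) = C +> (b \<oplus> \<rho> Z)" if "Z \<in> (\<lambda>a. B +> a) ` A" "b \<in> B" for Z b
  proof -
    have "b \<in> carrier G" "\<rho> Z \<in> carrier G" using that \<rho> by auto
    then have "f (Z, C +> b) = (\<lambda>c. c \<oplus> (b \<oplus> \<rho> Z)) ` C"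
      by (simp add: f_def a_r_coset_def' UNION_singleton_eq_range image_image a_assoc cong: image_cong_simp)
    then show ?thesis by (simp add: a_r_coset_def' UNION_singleton_eq_range)
  qed
  have "bij_betw f ((\<lambda>a. B +> a) ` A \<times> (\<lambda>a. C +> a) ` B) ((\<lambda>a. C +> a) ` A)"
  proof (rule bij_betw_imageI)
    show "inj_on f ((\<lambda>a. B +> a) ` A \<times> (\<lambda>a. C +> a) ` B)"
    proof (rule inj_onI, clarify)
      fix a b a' b' assume *: "a \<in> A" "b \<in> B" "a' \<in> A" "b' \<in> B"
        and eq: "f (B +> a, C +> b) = f (B +> a', C +> b')"
      let ?r = "\<rho> (B +> a)" and ?r' = "\<rho> (B +> a')"
      have r: "?r \<in> A" "B +> ?r = B +> a" "?r' \<in> A" "B +> ?r' = B +> a'"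
        using \<rho> * by auto
      have c: "b \<in> carrier G" "b' \<in> carrier G" "?r \<in> carrier G" "?r' \<in> carrier G"
        using * r by auto
      have d: "(b \<oplus> ?r) \<ominus> (b' \<oplus> ?r') \<in> C"
        using eq * coset_eq_iff[OF C] c by (simp add: f)
      have "?r \<ominus> ?r' = ((b \<oplus> ?r) \<ominus> (b' \<oplus> ?r')) \<ominus> (b \<ominus> b')"
        using c by (simp add: add_diff_add add_diff_cancel_left')
      also have "\<dots> \<in> B"
        by (intro additive_subgroup_minus[OF B] additive_subgroup_minus[OF B *(2) *(4)] subsetD[OF CB d])
      finally have "B +> ?r = B +> ?r'" using coset_eq_iff[OF B] c by simp
      then have aa: "B +> a = B +> a'" using r by simp
      have "(b \<oplus> ?r) \<ominus> (b' \<oplus> ?r) = b \<ominus> b'"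
        using c by (simp add: add_diff_add) (simp add: a_minus_def r_neg)
      then have "b \<ominus> b' \<in> C" using d aa by simp
      then show "B +> a = B +> a' \<and> C +> b = C +> b'" using aa coset_eq_iff[OF C] c by simp
    qed
    show "f ` ((\<lambda>a. B +> a) ` A \<times> (\<lambda>a. C +> a) ` B) = (\<lambda>a. C +> a) ` A"
    proof
      show "f ` ((\<lambda>a. B +> a) ` A \<times> (\<lambda>a. C +> a) ` B) \<subseteq> (\<lambda>a. C +> a) ` A"
        using BA \<rho> by (auto simp: f intro!: imageI)
      show "(\<lambda>a. C +> a) ` A \<subseteq> f ` ((\<lambda>a. B +> a) ` A \<times> (\<lambda>a. C +> a) ` B)"
      proof clarify
        fix a assume a: "a \<in> A"
        let ?r = "\<rho> (B +> a)"
        have r: "?r \<in> A" "B +> ?r = B +> a" using \<rho> a by auto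
        have c: "a \<in> carrier G" "?r \<in> carrier G" using a r by auto
        have "a \<ominus> ?r \<in> B" using coset_eq_iff[OF B, of a ?r] c r by simp
        moreover have "(a \<ominus> ?r) \<oplus> ?r = a" using c by (simp add: diff_add_cancel)
        ultimately have "C +> a = f (B +> a, C +> (a \<ominus> ?r))" using a by (simp add: f)
        then show "C +> a \<in> f ` ((\<lambda>a. B +> a) ` A \<times> (\<lambda>a. C +> a) ` B)"
          using a \<open>a \<ominus> ?r \<in> B\<close> by blast
      qed
    qed
  qed
  then show ?thesis
    by (simp add: a_index_def bij_betw_same_card[symmetric] card_cartesian_product)
qed

lemma a_index_eq_1_iff:
  assumes A: "additive_subgroup A G" and B: "additive_subgroup B G" and BA: "B \<subseteq> A"
  shows "a_index G A B = 1 \<longleftrightarrow> A = B"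
proof -
  interpret A: additive_subgroup A G by fact
  interpret B: additive_subgroup B G by fact
  show ?thesis
  proof
    assume "a_index G A B = 1"
    then obtain Z where Z: "(\<lambda>a. B +> a) ` A = {Z}" by (auto simp: a_index_def card_1_singleton_iff)
    have "a \<in> B" if a: "a \<in> A" for a
    proof -
      have "B +> a = B +> \<zero>" using Z a A.zero_closed by (metis imageI singletonD)
      then have "a \<ominus> \<zero> \<in> B" using a coset_eq_iff[OF B] by simp
      then show ?thesis using a A.a_Hcarr by (simp add: diff_zero)
    qed
    then show "A = B" using BA by blast
  next
    assume "A = B"
    have "B +> a = B" if "a \<in> B" for a
      using that by (intro a_coset_join2 B.a_subgroup B.a_Hcarr)
    then have "(\<lambda>a. B +> a) ` A = {B}" using \<open>A = B\<close> B.zero_closed by blast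
    then show "a_index G A B = 1" by (simp add: a_index_def)
  qed
qed

lemma set_add_iff: "x \<in> A <+> B \<longleftrightarrow> (\<exists>a\<in>A. \<exists>b\<in>B. x = a \<oplus> b)"
  by (auto simp: set_add_def')

lemma set_add_right:
  "additive_subgroup A G \<Longrightarrow> B \<subseteq> carrier G \<Longrightarrow> B \<subseteq> A <+> B"
  by (force simp: set_add_iff intro: additive_subgroup.zero_closed)

lemma set_add_left:
  "additive_subgroup B G \<Longrightarrow> A \<subseteq> carrier G \<Longrightarrow> A \<subseteq> A <+> B"
  by (force simp: set_add_iff intro: additive_subgroup.zero_closed)

lemma set_add_least:
  "additive_subgroup C G \<Longrightarrow> A \<subseteq> C \<Longrightarrow> B \<subseteq> C \<Longrightarrow> A <+> B \<subseteq> C"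
  by (auto simp: set_add_iff additive_subgroup.a_closed subset_iff)

lemma additive_subgroup_Int:
  "additive_subgroup A G \<Longrightarrow> additive_subgroup B G \<Longrightarrow> additive_subgroup (A \<inter> B) G"
  by (simp add: additive_subgroup_def add.subgroups_Inter_pair)

lemma additive_subgroupI':
  assumes "A \<subseteq> carrier G" "\<zero> \<in> A" "\<And>a b. a \<in> A \<Longrightarrow> b \<in> A \<Longrightarrow> a \<ominus> b \<in> A"
  shows "additive_subgroup A G"
proof (rule additive_subgroup.intro, rule add.subgroupI)
  show "A \<subseteq> carrier G" "A \<noteq> {}" using assms by auto
  show neg: "\<ominus> a \<in> A" if "a \<in> A" for a
  proof -
    have "\<zero> \<ominus> a = \<ominus> a" using that assms(1) by (auto simp: a_minus_def)
    then show ?thesis using assms(3)[OF assms(2) that] by simp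
  qed
  show "a \<oplus> b \<in> A" if "a \<in> A" "b \<in> A" for a b
  proof -
    have "a \<ominus> (\<ominus> b) = a \<oplus> b" using that assms(1) by (auto simp: a_minus_def)
    then show ?thesis using assms(3)[OF that(1) neg[OF that(2)]] by simp
  qed
qed

lemma a_index_second_iso:
  assumes Z: "additive_subgroup Z G" and N: "additive_subgroup N G"
  shows "a_index G (Z <+> N) Z = a_index G N (Z \<inter> N)"
proof -
  interpret Z: additive_subgroup Z G by fact
  interpret N: additive_subgroup N G by fact
  have ZN: "additive_subgroup (Z \<inter> N) G" by (rule additive_subgroup_Int[OF Z N])
  have "a_index G N (Z \<inter> N) = a_index G (Z <+> N) Z"
    unfolding a_index_def
  proof (rule card_image_transfer[where f = "\<lambda>x. x"])
    show "(\<lambda>x. x) \<in> N \<rightarrow> (Z <+> N)" using set_add_right[OF Z N.a_subset] by auto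
    show "Z \<inter> N +> a = Z \<inter> N +> b \<longleftrightarrow> Z +> a = Z +> b" if "a \<in> N" "b \<in> N" for a b
      using that additive_subgroup_minus[OF N] by (simp add: coset_eq_iff[OF Z] coset_eq_iff[OF ZN])
    show "\<exists>a\<in>N. Z +> x = Z +> a" if "x \<in> Z <+> N" for x
    proof -
      obtain u v where uv: "u \<in> Z" "v \<in> N" "x = u \<oplus> v" using \<open>x \<in> Z <+> N\<close> unfolding set_add_iff by blast
      have "u \<oplus> v \<ominus> v = u" using uv Z.a_Hcarr N.a_Hcarr by (simp add: add_diff_cancel_right')
      then show ?thesis using uv by (intro bexI[of _ v]) (simp_all add: coset_eq_iff[OF Z])
    qed
  qed
  then show ?thesis by simp
qed

lemma card_cosets_of_coset:
  assumes H: "additive_subgroup H G" and D: "additive_subgroup D G" and a: "a \<in> carrier G"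
  shows "card ((\<lambda>x. D +> x) ` (H +> a)) = a_index G H D"
proof -
  have Hc: "x \<in> carrier G" if "x \<in> H" for x using additive_subgroup.a_Hcarr[OF H that] .
  have "a_index G H D = card ((\<lambda>x. D +> x) ` (H +> a))"
    unfolding a_index_def
  proof (rule card_image_transfer[where f = "\<lambda>x. x \<oplus> a"])
    show "(\<lambda>x. x \<oplus> a) \<in> H \<rightarrow> (H +> a)" by (auto simp: a_r_coset_def')
    fix x z assume "x \<in> H" "z \<in> H"
    then have c: "x \<in> carrier G" "z \<in> carrier G" using Hc by auto
    then have "(x \<oplus> a) \<ominus> (z \<oplus> a) = x \<ominus> z" using a by (simp add: add_diff_add) (simp add: a_minus_def r_neg)
    then show "D +> x = D +> z \<longleftrightarrow> D +> (x \<oplus> a) = D +> (z \<oplus> a)"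
      using c a by (simp add: coset_eq_iff[OF D])
  next
    fix x assume "x \<in> H +> a"
    then show "\<exists>z\<in>H. D +> x = D +> (z \<oplus> a)" by (auto simp: a_r_coset_def')
  qed
  then show ?thesis by simp
qed

lemma add_pow_mem:
  "additive_subgroup B G \<Longrightarrow> x \<in> B \<Longrightarrow> add_pow G (n::nat) x \<in> B"
proof (induction n)
  case 0 then show ?case by (simp add: additive_subgroup.zero_closed)
next
  case (Suc n) then show ?case by (simp add: additive_subgroup.a_closed)
qed

text \<open>Among the multiples \<open>k x\<close> with \<open>0 \<le> k \<le> n\<close>, two agree modulo a subgroup of index \<open>n\<close>. Their
  difference is a multiple \<open>d x\<close> in the subgroup with \<open>0 < d \<le> n\<close>, and \<open>d\<close> divides \<open>n!\<close>.\<close>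

lemma fact_index_multiple:
  assumes A: "additive_subgroup A G" and B: "additive_subgroup B G"
    and pos: "a_index G A B > 0" and x: "x \<in> A"
  shows "add_pow G (fact (a_index G A B) :: nat) x \<in> B"
proof -
  let ?n = "a_index G A B"
  have xc: "x \<in> carrier G" using additive_subgroup.a_Hcarr[OF A x] .
  let ?f = "\<lambda>k::nat. B +> (add_pow G (k) x)"
  have fin: "finite ((\<lambda>a. B +> a) ` A)" using pos by (simp add: a_index_def card_gt_0_iff)
  have "?f ` {0..?n} \<subseteq> (\<lambda>a. B +> a) ` A" using add_pow_mem[OF A x] by blast
  then have "card (?f ` {0..?n}) \<le> ?n" using card_mono[OF fin] unfolding a_index_def by blast
  then have "\<not> inj_on ?f {0..?n}" using card_image[of ?f "{0..?n}"] by auto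
  then obtain j k where jk: "j < k" "k \<le> ?n" "?f k = ?f j"
    unfolding inj_on_def by (metis atLeastAtMost_iff linorder_neqE_nat)
  have "add_pow G (k) x = add_pow G (k - j) x \<oplus> add_pow G (j) x" using jk xc add.nat_pow_mult[of x "k - j" j] by simp
  then have "add_pow G (k) x \<ominus> add_pow G (j) x = add_pow G (k - j) x" using xc by (simp add: add_diff_cancel_right')
  then have d: "add_pow G (k - j) x \<in> B" using coset_eq_iff[OF B, of "add_pow G (k) x" "add_pow G (j) x"] jk xc by simp
  have "k - j dvd fact ?n" using jk by (intro dvd_fact) auto
  then obtain q where "fact ?n = (k - j) * q" by (elim dvdE)
  then have "add_pow G (fact ?n :: nat) x = add_pow G q (add_pow G (k - j) x)"
    using xc add.nat_pow_pow[of x q "k - j"] by simp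
  then show ?thesis using add_pow_mem[OF B d] by simp
qed

lemma add_pow_subgroup:
  assumes "additive_subgroup A G"
  shows "additive_subgroup ((\<lambda>x. add_pow G (n::nat) x) ` A) G"
proof -
  have Ac: "x \<in> carrier G" if "x \<in> A" for x using additive_subgroup.a_Hcarr[OF assms that] .
  show ?thesis
  proof (rule additive_subgroupI')
    show "(\<lambda>x. add_pow G (n) x) ` A \<subseteq> carrier G" using Ac by auto
    have "add_pow G (n) \<zero> = \<zero>" by simp
    then show "\<zero> \<in> (\<lambda>x. add_pow G (n) x) ` A" using additive_subgroup.zero_closed[OF assms]
      by (intro image_eqI[of _ _ \<zero>]) auto
    fix a b assume "a \<in> (\<lambda>x. add_pow G (n) x) ` A" "b \<in> (\<lambda>x. add_pow G (n) x) ` A"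
    then obtain u v where uv: "u \<in> A" "v \<in> A" "a = add_pow G (n) u" "b = add_pow G (n) v" by blast
    have c: "u \<in> carrier G" "v \<in> carrier G" using uv Ac by auto
    have "add_pow G (n) (u \<ominus> v) \<oplus> add_pow G (n) v = add_pow G (n) u"
      using add.nat_pow_distrib[of "u \<ominus> v" v n] c by (simp add: diff_add_cancel)
    then have "a \<ominus> b = add_pow G (n) (u \<ominus> v)"
      using c uv add_diff_cancel_right'[of "add_pow G (n) (u \<ominus> v)" "add_pow G (n) v"] by simp
    then show "a \<ominus> b \<in> (\<lambda>x. add_pow G (n) x) ` A" using additive_subgroup_minus[OF assms] uv by blast
  qed
qed

lemma a_rcosets_carrier: "a_rcosets H = (\<lambda>a. H +> a) ` carrier G"
  by (auto simp: A_RCOSETS_def')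

end

section \<open>Nilpotent endomorphisms\<close>

locale nilpotent_endo = abelian_group M for M (structure) +
  fixes y :: "'a \<Rightarrow> 'a" and l :: nat
  assumes y_closed [simp]: "x \<in> carrier M \<Longrightarrow> y x \<in> carrier M"
    and y_add: "x \<in> carrier M \<Longrightarrow> z \<in> carrier M \<Longrightarrow> y (x \<oplus> z) = y x \<oplus> y z"
    and y_nilpotent: "x \<in> carrier M \<Longrightarrow> (y ^^ l) x = \<zero>"
begin

definition K :: "nat \<Rightarrow> 'a set" where
  "K i = {x \<in> carrier M. (y ^^ i) x = \<zero>}"

text \<open>\<open>L\<^sub>i(S)\<close>, since \<open>K\<^sub>i(S) = S \<inter> K\<^sub>i(M)\<close>.\<close>

definition LS :: "'a set \<Rightarrow> nat \<Rightarrow> 'a set" where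
  "LS S i = y ` (S \<inter> K (i + 1)) <+> (S \<inter> K (i - 1))"

abbreviation L :: "nat \<Rightarrow> 'a set" where "L \<equiv> LS (carrier M)"

lemma y_zero [simp]: "y \<zero> = \<zero>"
  using y_add[of \<zero> \<zero>] by simp

lemma y_minus: "x \<in> carrier M \<Longrightarrow> z \<in> carrier M \<Longrightarrow> y (x \<ominus> z) = y x \<ominus> y z"
  using y_add[of "x \<ominus> z" z] add_diff_cancel_right'[of "y (x \<ominus> z)" "y z"]
  by (simp add: diff_add_cancel)

lemma y_pow_closed [simp]: "x \<in> carrier M \<Longrightarrow> (y ^^ i) x \<in> carrier M"
  by (induction i) auto

lemma y_pow_minus:
  "x \<in> carrier M \<Longrightarrow> z \<in> carrier M \<Longrightarrow> (y ^^ i) (x \<ominus> z) = (y ^^ i) x \<ominus> (y ^^ i) z"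
  by (induction i) (auto simp: y_minus)

lemma y_pow_zero [simp]: "(y ^^ i) \<zero> = \<zero>"
  by (induction i) auto

lemma K_subgroup: "additive_subgroup (K i) M"
  by (rule additive_subgroupI') (auto simp: K_def y_pow_minus diff_zero)

lemma K_carrier: "K i \<subseteq> carrier M"
  by (auto simp: K_def)

lemma K_0 [simp]: "K 0 = {\<zero>}"
  by (auto simp: K_def)

lemma K_top: "l \<le> i \<Longrightarrow> K i = carrier M"
proof -
  assume "l \<le> i"
  then obtain d where "i = d + l" using le_Suc_ex by (metis add.commute)
  then show ?thesis by (auto simp: K_def funpow_add y_nilpotent)
qed

lemma y_mem_K: "x \<in> carrier M \<Longrightarrow> y x \<in> K i \<longleftrightarrow> x \<in> K (Suc i)"
  by (simp add: K_def funpow_swap1)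

lemma K_mono: "i \<le> j \<Longrightarrow> K i \<subseteq> K j"
proof -
  assume "i \<le> j"
  then obtain d where "j = d + i" using le_Suc_ex by (metis add.commute)
  then show ?thesis by (auto simp: K_def funpow_add)
qed

lemma image_y_subgroup:
  assumes "additive_subgroup A M"
  shows "additive_subgroup (y ` A) M"
proof -
  interpret A: additive_subgroup A M by fact
  show ?thesis
  proof (rule additive_subgroupI')
    show "y ` A \<subseteq> carrier M" using A.a_Hcarr by auto
    show "\<zero> \<in> y ` A" using A.zero_closed by (metis imageI y_zero)
    fix a b assume "a \<in> y ` A" "b \<in> y ` A"
    then obtain u v where uv: "u \<in> A" "v \<in> A" "a = y u" "b = y v" by blast
    then have "a \<ominus> b = y (u \<ominus> v)" using A.a_Hcarr by (simp add: y_minus)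
    then show "a \<ominus> b \<in> y ` A" using additive_subgroup_minus[OF assms] uv by blast
  qed
qed

lemma LS_subgroup: "additive_subgroup S M \<Longrightarrow> additive_subgroup (LS S i) M"
  unfolding LS_def
  by (intro add_additive_subgroups image_y_subgroup additive_subgroup_Int K_subgroup)

lemma LS_iff: "x \<in> LS S i \<longleftrightarrow> (\<exists>a\<in>S \<inter> K (i + 1). \<exists>b\<in>S \<inter> K (i - 1). x = y a \<oplus> b)"
  by (auto simp: LS_def set_add_iff)

lemma LS_mono: "S \<subseteq> S' \<Longrightarrow> LS S i \<subseteq> LS S' i"
  unfolding LS_iff subset_iff by blast

lemma LS_subset_K: "additive_subgroup S M \<Longrightarrow> i > 0 \<Longrightarrow> LS S i \<subseteq> K i"
proof -
  assume S: "additive_subgroup S M" and "i > 0"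
  have "y ` (S \<inter> K (i + 1)) \<subseteq> K i" using K_carrier by (auto simp: y_mem_K subset_iff)
  moreover have "S \<inter> K (i - 1) \<subseteq> K i" using K_mono[of "i - 1" i] by auto
  ultimately show ?thesis unfolding LS_def by (intro set_add_least K_subgroup)
qed

lemma LS_subset:
  assumes S: "additive_subgroup S M" and yS: "y ` S \<subseteq> S"
  shows "LS S i \<subseteq> S"
  unfolding LS_def by (intro set_add_least S) (use yS in auto)

lemma carrier_subgroup: "additive_subgroup (carrier M) M"
  by (rule additive_subgroupI') auto

lemma L_subgroup: "additive_subgroup (L i) M"
  by (intro LS_subgroup carrier_subgroup)

lemma K_pred_subset_L: "K (i - 1) \<subseteq> L i"
proof -
  have "additive_subgroup (y ` (carrier M \<inter> K (i + 1))) M"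
    by (intro image_y_subgroup additive_subgroup_Int K_subgroup carrier_subgroup)
  from set_add_right[OF this, of "carrier M \<inter> K (i - 1)"] show ?thesis
    using K_carrier by (auto simp: LS_def)
qed

lemma y_K_subset_L: "x \<in> K (i + 1) \<Longrightarrow> y x \<in> L i"
proof -
  assume x: "x \<in> K (i + 1)"
  then have "x \<in> carrier M" using K_carrier by auto
  then have "y x = y x \<oplus> \<zero>" "\<zero> \<in> K (i - 1)" by (auto simp: K_def)
  then show ?thesis unfolding LS_iff using x K_carrier by blast
qed

text \<open>The two conditions say that \<open>Q\<^sub>i(S) \<rightarrow> Q\<^sub>i(M)\<close> is injective and that its image is
  \<open>Rh i / L\<^sub>i(M)\<close>.\<close>

definition adapted :: "(nat \<Rightarrow> 'a set) \<Rightarrow> 'a set \<Rightarrow> bool" where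
  "adapted Rh S \<longleftrightarrow> additive_subgroup S M \<and> y ` S \<subseteq> S \<and>
     (\<forall>i\<in>{1..l}. S \<inter> K i \<inter> L i \<subseteq> LS S i \<and> (S \<inter> K i) <+> L i = Rh i)"

lemma adapted_Int_L:
  assumes "adapted Rh S" and i: "i \<in> {1..l}"
  shows "(S \<inter> K i) \<inter> L i = LS S i"
proof -
  have S: "additive_subgroup S M" "y ` S \<subseteq> S" using assms by (auto simp: adapted_def)
  have "LS S i \<subseteq> L i"
    using LS_mono[of S "carrier M"] additive_subgroup.a_subset[OF S(1)] by simp
  moreover have "LS S i \<subseteq> S" by (rule LS_subset[OF S])
  moreover have "LS S i \<subseteq> K i" by (rule LS_subset_K[OF S(1)]) (use i in simp)
  moreover have "S \<inter> K i \<inter> L i \<subseteq> LS S i" using assms by (simp add: adapted_def)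
  ultimately show ?thesis by blast
qed

text \<open>Multiplication by \<open>y\<close> embeds \<open>K\<^sub>i\<^sub>+\<^sub>1/K\<^sub>i\<close> into \<open>K\<^sub>i/K\<^sub>i\<^sub>-\<^sub>1\<close> with cokernel \<open>Q\<^sub>i\<close>, both for \<open>S\<close> and for
  \<open>M\<close>. As \<open>Q\<^sub>i(S) \<rightarrow> Q\<^sub>i(M)\<close> is injective, indices in layer \<open>i\<close> split into the index of the image of
  \<open>Q\<^sub>i(S)\<close> and the index in layer \<open>i + 1\<close>.\<close>

lemma layer_index_step:
  assumes ad: "adapted Rh S" and i: "i \<in> {1..l}"
  shows "a_index M (K i) ((S \<inter> K i) <+> K (i - 1)) =
    a_index M (K i) (Rh i) * a_index M (K (i + 1)) ((S \<inter> K (i + 1)) <+> K i)"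
proof -
  have S: "additive_subgroup S M" and yS: "y ` S \<subseteq> S" and Rh: "(S \<inter> K i) <+> L i = Rh i"
    and C1: "S \<inter> K i \<inter> L i \<subseteq> LS S i"
    using ad i by (auto simp: adapted_def)
  interpret S: additive_subgroup S M by fact
  have SK: "additive_subgroup (S \<inter> K j) M" for j by (intro additive_subgroup_Int S K_subgroup)
  have SKc: "S \<inter> K j \<subseteq> carrier M" for j using K_carrier by auto
  let ?C = "(S \<inter> K i) <+> K (i - 1)" and ?C' = "(S \<inter> K (i + 1)) <+> K i"
  have C: "additive_subgroup ?C M" and C': "additive_subgroup ?C' M"
    by (intro add_additive_subgroups SK K_subgroup)+
  have B: "additive_subgroup (Rh i) M" unfolding Rh[symmetric]
    by (intro add_additive_subgroups SK L_subgroup)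
  have LB: "L i \<subseteq> Rh i" unfolding Rh[symmetric]
    by (intro set_add_right SK additive_subgroup.a_subset L_subgroup)
  have BK: "Rh i \<subseteq> K i" unfolding Rh[symmetric]
    using LS_subset_K[OF carrier_subgroup, of i] i by (intro set_add_least K_subgroup) auto
  have CB: "?C \<subseteq> Rh i"
    using K_pred_subset_L[of i] LB set_add_left[OF L_subgroup SKc, of i i]
    by (intro set_add_least B) (auto simp: Rh)
  \<comment> \<open>The preimage of layer \<open>i\<close> of \<open>S\<close> under \<open>y\<close> is layer \<open>i + 1\<close> of \<open>S\<close>; the injectivity condition
    turns an element \<open>s\<close> of \<open>S\<close> lying in \<open>y K\<^sub>i\<^sub>+\<^sub>1 + K\<^sub>i\<^sub>-\<^sub>1\<close> into one of \<open>y (S \<inter> K\<^sub>i\<^sub>+\<^sub>1) + (S \<inter> K\<^sub>i\<^sub>-\<^sub>1)\<close>.\<close>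
  have key: "y d \<in> ?C \<longleftrightarrow> d \<in> ?C'" if d: "d \<in> K (i + 1)" for d
  proof
    have dc: "d \<in> carrier M" using d K_carrier by auto
    assume "y d \<in> ?C"
    then obtain s b where s: "s \<in> S \<inter> K i" and b: "b \<in> K (i - 1)" and yd: "y d = s \<oplus> b"
      by (auto simp: set_add_iff)
    have sc: "s \<in> carrier M" "b \<in> carrier M" using s b K_carrier by auto
    have "s = y d \<ominus> b" using yd sc by (simp add: add_diff_cancel_right')
    also have "\<dots> \<in> L i"
      using y_K_subset_L[OF d] K_pred_subset_L b
      by (intro additive_subgroup_minus[OF L_subgroup]) auto
    finally have "s \<in> LS S i" using C1 s by blast
    then obtain a b' where a: "a \<in> S \<inter> K (i + 1)" and b': "b' \<in> S \<inter> K (i - 1)" and sa: "s = y a \<oplus> b'"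
      by (auto simp: LS_iff)
    have ac: "a \<in> carrier M" "b' \<in> carrier M" using a b' S.a_Hcarr by auto
    have "y (d \<ominus> a) = (y a \<oplus> (b' \<oplus> b)) \<ominus> y a"
      using dc ac yd sa sc by (simp add: y_minus a_assoc)
    also have "\<dots> = b' \<oplus> b" using ac sc by (simp add: add_diff_cancel_left')
    also have "\<dots> \<in> K (i - 1)" using b b' by (intro additive_subgroup.a_closed[OF K_subgroup]) auto
    finally have "d \<ominus> a \<in> K i" using y_mem_K[of "d \<ominus> a" "i - 1"] dc ac i by simp
    moreover have "d = a \<oplus> (d \<ominus> a)" using dc ac diff_add_cancel[of d a] by (simp add: a_comm)
    ultimately show "d \<in> ?C'" unfolding set_add_iff using a by (intro bexI[of _ a] bexI[of _ "d \<ominus> a"]) auto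
  next
    assume "d \<in> ?C'"
    then obtain s k where s: "s \<in> S \<inter> K (i + 1)" and k: "k \<in> K i" and dk: "d = s \<oplus> k"
      by (auto simp: set_add_iff)
    have sc: "s \<in> carrier M" "k \<in> carrier M" using s k K_carrier by auto
    have "y s \<in> S \<inter> K i" using s yS sc by (auto simp: y_mem_K)
    moreover have "y k \<in> K (i - 1)" using k i sc by (simp add: y_mem_K)
    ultimately show "y d \<in> ?C" unfolding set_add_iff dk y_add[OF sc] by blast
  qed
  have "a_index M (K (i + 1)) ?C' = a_index M (Rh i) ?C"
    unfolding a_index_def
  proof (rule card_image_transfer[where f = y])
    show "y \<in> K (i + 1) \<rightarrow> Rh i" using y_K_subset_L LB by auto
    show "?C' +> a = ?C' +> b \<longleftrightarrow> ?C +> y a = ?C +> y b" if "a \<in> K (i + 1)" "b \<in> K (i + 1)" for a b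
    proof -
      have c: "a \<in> carrier M" "b \<in> carrier M" using that K_carrier by auto
      have ab: "a \<ominus> b \<in> K (i + 1)" by (rule additive_subgroup_minus[OF K_subgroup that])
      have ym: "y (a \<ominus> b) = y a \<ominus> y b" by (rule y_minus[OF c])
      have "?C' +> a = ?C' +> b \<longleftrightarrow> a \<ominus> b \<in> ?C'" by (rule coset_eq_iff[OF C' c])
      moreover have "?C +> y a = ?C +> y b \<longleftrightarrow> y (a \<ominus> b) \<in> ?C"
        unfolding ym by (rule coset_eq_iff[OF C y_closed[OF c(1)] y_closed[OF c(2)]])
      ultimately show ?thesis using key[OF ab] by argo
    qed
    show "\<exists>a\<in>K (i + 1). ?C +> x = ?C +> y a" if xR: "x \<in> Rh i" for x
    proof -
      obtain s u where s: "s \<in> S \<inter> K i" and u: "u \<in> L i" and x: "x = s \<oplus> u"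
        using xR[folded Rh] unfolding set_add_iff by blast
      obtain a b where a: "a \<in> K (i + 1)" and b: "b \<in> K (i - 1)" and ub: "u = y a \<oplus> b"
        using u by (auto simp: LS_iff)
      have c: "s \<in> carrier M" "a \<in> carrier M" "b \<in> carrier M" using s a b K_carrier by auto
      have "x = (s \<oplus> b) \<oplus> y a" using c by (simp add: x ub a_ac)
      then have "x \<ominus> y a = s \<oplus> b" using c by (simp add: add_diff_cancel_right')
      then have "x \<ominus> y a \<in> ?C" using s b unfolding set_add_iff by blast
      moreover have "x \<in> carrier M" using xR BK K_carrier by blast
      ultimately have "?C +> x = ?C +> y a" using coset_eq_iff[OF C _ y_closed[OF c(2)]] by blast
      then show ?thesis using a by blast
    qed
  qed
  then show ?thesis using a_index_tower[OF K_subgroup B C CB BK] by simp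
qed

text \<open>The recursion starts with layer \<open>l + 1\<close>, which vanishes because \<open>K\<^sub>l = K\<^sub>l\<^sub>+\<^sub>1\<close>.\<close>

lemma layer_index:
  assumes ad: "adapted Rh S" and i: "i \<in> {1..l}"
  shows "a_index M (K i) ((S \<inter> K i) <+> K (i - 1)) = (\<Prod>j=i..l. a_index M (K j) (Rh j))"
proof -
  have S: "additive_subgroup S M" using ad by (auto simp: adapted_def)
  have SK: "additive_subgroup (S \<inter> K j) M" for j by (intro additive_subgroup_Int S K_subgroup)
  have "i \<le> Suc l \<Longrightarrow> i \<ge> 1 \<Longrightarrow>
    a_index M (K i) ((S \<inter> K i) <+> K (i - 1)) = (\<Prod>j=i..l. a_index M (K j) (Rh j))"
  proof (induction i rule: inc_induct)
    case base
    have "(S \<inter> K (Suc l)) <+> K l = carrier M"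
    proof
      show "(S \<inter> K (Suc l)) <+> K l \<subseteq> carrier M"
        using K_carrier by (intro set_add_least carrier_subgroup) auto
      show "carrier M \<subseteq> (S \<inter> K (Suc l)) <+> K l"
        using set_add_right[OF SK[of "Suc l"] K_carrier[of l]] by (simp add: K_top)
    qed
    then show ?case
      using a_index_eq_1_iff[OF carrier_subgroup carrier_subgroup] by (simp add: K_top)
  next
    case (step n)
    then have "a_index M (K n) ((S \<inter> K n) <+> K (n - 1)) =
        a_index M (K n) (Rh n) * (\<Prod>j=Suc n..l. a_index M (K j) (Rh j))"
      using layer_index_step[OF ad, of n] by simp
    also have "\<dots> = (\<Prod>j=n..l. a_index M (K j) (Rh j))"
      using step.hyps by (subst prod.atLeast_Suc_atMost[of n]) auto
    finally show ?case .
  qed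
  then show ?thesis using i by simp
qed

text \<open>The index in \<open>K\<^sub>i\<close> is the product of the indices in the layers \<open>K\<^sub>k/K\<^sub>k\<^sub>-\<^sub>1\<close> with \<open>k \<le> i\<close>.\<close>

lemma index_Int_K:
  assumes ad: "adapted Rh S" and "i \<le> l"
  shows "a_index M (K i) (S \<inter> K i) = (\<Prod>k=1..i. \<Prod>j=k..l. a_index M (K j) (Rh j))"
  using \<open>i \<le> l\<close>
proof (induction i)
  case 0
  have S: "additive_subgroup S M" using ad by (auto simp: adapted_def)
  then have "S \<inter> K 0 = K 0" using additive_subgroup.zero_closed by auto
  then show ?case using a_index_eq_1_iff[OF K_subgroup K_subgroup, of 0 0] by simp
next
  case (Suc i)
  have S: "additive_subgroup S M" using ad by (auto simp: adapted_def)
  have SK: "additive_subgroup (S \<inter> K j) M" for j by (intro additive_subgroup_Int S K_subgroup)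
  let ?B = "(S \<inter> K (Suc i)) <+> K i"
  have "?B \<subseteq> K (Suc i)" using K_mono[of i "Suc i"] by (intro set_add_least K_subgroup) auto
  moreover have "S \<inter> K (Suc i) \<subseteq> ?B"
    using K_carrier by (intro set_add_left K_subgroup) auto
  ultimately have "a_index M (K (Suc i)) (S \<inter> K (Suc i)) =
      a_index M (K (Suc i)) ?B * a_index M ?B (S \<inter> K (Suc i))"
    by (intro a_index_tower K_subgroup SK add_additive_subgroups)
  also have "a_index M ?B (S \<inter> K (Suc i)) = a_index M (K i) (S \<inter> K (Suc i) \<inter> K i)"
    by (rule a_index_second_iso[OF SK K_subgroup])
  also have "S \<inter> K (Suc i) \<inter> K i = S \<inter> K i" using K_mono[of i "Suc i"] by auto
  also have "a_index M (K (Suc i)) ?B = (\<Prod>j=Suc i..l. a_index M (K j) (Rh j))"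
    using layer_index[OF ad, of "Suc i"] Suc.prems by simp
  finally show ?case using Suc by (simp add: mult.commute)
qed

lemma index_L:
  assumes ad: "adapted Rh S" and i: "i \<in> {1..l}"
  shows "a_index M (K i) (Rh i) * a_index M (L i) (LS S i) =
    (\<Prod>k=1..i. \<Prod>j=k..l. a_index M (K j) (Rh j))"
proof -
  have S: "additive_subgroup S M" and Rh: "(S \<inter> K i) <+> L i = Rh i"
    using ad i by (auto simp: adapted_def)
  have SK: "additive_subgroup (S \<inter> K j) M" for j by (intro additive_subgroup_Int S K_subgroup)
  have "L i \<subseteq> K i" using LS_subset_K[OF carrier_subgroup, of i] i by simp
  then have "(S \<inter> K i) <+> L i \<subseteq> K i" by (intro set_add_least K_subgroup) auto
  moreover have "S \<inter> K i \<subseteq> (S \<inter> K i) <+> L i"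
    using K_carrier by (intro set_add_left L_subgroup) auto
  ultimately have "a_index M (K i) (S \<inter> K i) =
      a_index M (K i) (Rh i) * a_index M (Rh i) (S \<inter> K i)"
    unfolding Rh[symmetric] by (intro a_index_tower K_subgroup SK L_subgroup add_additive_subgroups)
  moreover have "a_index M (Rh i) (S \<inter> K i) = a_index M (L i) (LS S i)"
    unfolding Rh[symmetric] a_index_second_iso[OF SK L_subgroup] adapted_Int_L[OF ad i] ..
  ultimately show ?thesis using index_Int_K[OF ad, of i] i by simp
qed

text \<open>Both subgroups have the index computed above, which is finite.\<close>

lemma adapted_eq:
  assumes S: "adapted Rh S" and S': "adapted Rh S'" and sub: "S' \<subseteq> S"
    and fin: "\<And>i. i \<in> {1..l} \<Longrightarrow> a_index M (K i) (Rh i) > 0"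
  shows "S' = S"
proof -
  have *: "additive_subgroup S M" "additive_subgroup S' M" using S S' by (auto simp: adapted_def)
  have **: "S \<inter> carrier M = S" "S' \<inter> carrier M = S'"
    using *[THEN additive_subgroup.a_subset] by auto
  define n where "n = (\<Prod>k=1..l. \<Prod>j=k..l. a_index M (K j) (Rh j))"
  have "n > 0" using fin unfolding n_def by (intro prod_pos) auto
  moreover have "a_index M (carrier M) S = n" "a_index M (carrier M) S' = n"
    using index_Int_K[OF S, of l] index_Int_K[OF S', of l] ** by (simp_all add: K_top n_def)
  moreover have "a_index M (carrier M) S' = a_index M (carrier M) S * a_index M S S'"
    using * sub additive_subgroup.a_subset by (intro a_index_tower carrier_subgroup) auto
  ultimately have "a_index M S S' = 1" by simp
  then show ?thesis using a_index_eq_1_iff * sub by blast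
qed

section \<open>Subgroups generated by lifts\<close>

text \<open>\<open>tail U k\<close> is \<open>U\<^sub>i + y U\<^sub>i\<^sub>+\<^sub>1 + y\<^sup>2 U\<^sub>i\<^sub>+\<^sub>2 + \<dots>\<close> with \<open>i = l + 1 - k\<close>, and \<open>gen U i\<close> is the sum of
  these subgroups for the indices up to \<open>i\<close>.\<close>

primrec tail :: "(nat \<Rightarrow> 'a set) \<Rightarrow> nat \<Rightarrow> 'a set" where
  "tail U 0 = {\<zero>}"
| "tail U (Suc k) = U (l - k) <+> y ` tail U k"

abbreviation T :: "(nat \<Rightarrow> 'a set) \<Rightarrow> nat \<Rightarrow> 'a set" where
  "T U i \<equiv> tail U (Suc l - i)"

primrec gen :: "(nat \<Rightarrow> 'a set) \<Rightarrow> nat \<Rightarrow> 'a set" where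
  "gen U 0 = {\<zero>}"
| "gen U (Suc i) = gen U i <+> T U (Suc i)"

lemma T_rec: "i \<in> {1..l} \<Longrightarrow> T U i = U i <+> y ` T U (Suc i)"
  using tail.simps(2)[of U "l - i"] by (simp add: Suc_diff_le)

lemma zero_subgroup: "additive_subgroup {\<zero>} M"
  by (rule additive_subgroupI') (auto simp: diff_zero)

lemma tail_induct [consumes 1, case_names base step]:
  assumes "i \<in> {1..Suc l}" and "P (Suc l)" and "\<And>i. i \<in> {1..l} \<Longrightarrow> P (Suc i) \<Longrightarrow> P i"
  shows "P i"
proof -
  have "i \<le> Suc l \<Longrightarrow> 1 \<le> i \<Longrightarrow> P i"
    by (induction i rule: inc_induct) (use assms(2,3) in auto)
  then show ?thesis using assms(1) by simp
qed

context
  fixes U :: "nat \<Rightarrow> 'a set" and Rh :: "nat \<Rightarrow> 'a set"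
  assumes U: "i \<in> {1..l} \<Longrightarrow> additive_subgroup (U i) M"
    and U_K: "i \<in> {1..l} \<Longrightarrow> U i \<subseteq> K i"
    and U_L: "i \<in> {1..l} \<Longrightarrow> U i \<inter> L i \<subseteq> {\<zero>}"
    and U_Rh: "i \<in> {1..l} \<Longrightarrow> U i <+> L i = Rh i"
begin

lemma T_subgroup: "i \<in> {1..Suc l} \<Longrightarrow> additive_subgroup (T U i) M"
proof (induction i rule: tail_induct)
  case base then show ?case by (simp add: zero_subgroup)
next
  case (step i)
  then show ?case unfolding T_rec[OF step(1)]
    by (intro add_additive_subgroups U image_y_subgroup)
qed

lemma T_K: "i \<in> {1..Suc l} \<Longrightarrow> T U i \<subseteq> K i"
proof (induction i rule: tail_induct)
  case base then show ?case using K_subgroup additive_subgroup.zero_closed by auto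
next
  case (step i)
  have "y t \<in> K i" if "t \<in> T U (Suc i)" for t
    using subsetD[OF step(2) that] K_carrier y_mem_K by blast
  then have "y ` T U (Suc i) \<subseteq> K i" by blast
  then show ?case unfolding T_rec[OF step(1)] by (intro set_add_least K_subgroup U_K step)
qed

text \<open>Let \<open>u + y t \<in> K\<^sub>i\<^sub>-\<^sub>1\<close> with \<open>u \<in> U\<^sub>i\<close> and \<open>t \<in> T\<^sub>i\<^sub>+\<^sub>1\<close>. Then \<open>u \<in> L\<^sub>i\<close>, so \<open>u = 0\<close>; now \<open>y t \<in> K\<^sub>i\<^sub>-\<^sub>1\<close> means
  \<open>t \<in> K\<^sub>i\<close>, and \<open>t = 0\<close> by induction. So \<open>T\<^sub>i\<close> meets only layer \<open>i\<close>.\<close>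

lemma T_Int_K: "i \<in> {1..Suc l} \<Longrightarrow> T U i \<inter> K (i - 1) \<subseteq> {\<zero>}"
proof (induction i rule: tail_induct)
  case base then show ?case by simp
next
  case (step i)
  show ?case
  proof
    fix x assume x: "x \<in> T U i \<inter> K (i - 1)"
    then obtain u t where u: "u \<in> U i" and t: "t \<in> T U (Suc i)" and xu: "x = u \<oplus> y t"
      unfolding T_rec[OF step(1)] set_add_iff Int_iff by blast
    have tK: "t \<in> K (i + 1)" using T_K[of "Suc i"] t step(1) by auto
    have c: "u \<in> carrier M" "t \<in> carrier M" using U_K[OF step(1)] u tK K_carrier by blast+
    have "u = x \<ominus> y t" using c by (simp add: xu add_diff_cancel_right')
    also have "\<dots> \<in> L i"
      using x K_pred_subset_L y_K_subset_L[OF tK]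
      by (intro additive_subgroup_minus[OF L_subgroup]) auto
    finally have u0: "u = \<zero>" using U_L[OF step(1)] u by blast
    then have "y t \<in> K (i - 1)" using x xu c by simp
    then have "t \<in> K i" using y_mem_K[of t "i - 1"] c step(1) by simp
    then have "t = \<zero>" using step(2) t by auto
    then show "x \<in> {\<zero>}" using xu u0 by simp
  qed
qed

lemma gen_subgroup: "i \<le> l \<Longrightarrow> additive_subgroup (gen U i) M"
proof (induction i)
  case 0 then show ?case by (simp add: zero_subgroup)
next
  case (Suc i) then show ?case
    unfolding gen.simps by (intro add_additive_subgroups T_subgroup) auto
qed

lemma gen_K: "i \<le> l \<Longrightarrow> gen U i \<subseteq> K i"
proof (induction i)
  case (Suc i)
  have "gen U i \<subseteq> K (Suc i)" using Suc K_mono[of i "Suc i"] by auto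
  moreover have "T U (Suc i) \<subseteq> K (Suc i)" using T_K[of "Suc i"] Suc by simp
  ultimately show ?case unfolding gen.simps by (intro set_add_least K_subgroup)
qed simp

lemma gen_mono: "i \<le> j \<Longrightarrow> j \<le> l \<Longrightarrow> gen U i \<subseteq> gen U j"
proof (induction j)
  case (Suc j)
  have "gen U j \<subseteq> gen U (Suc j)" unfolding gen.simps
    using gen_K[of j] K_carrier Suc.prems by (intro set_add_left T_subgroup) auto
  then show ?case using Suc by (cases "i = Suc j") auto
qed simp

lemma T_gen: "i \<in> {1..l} \<Longrightarrow> T U i \<subseteq> gen U i"
proof -
  assume i: "i \<in> {1..l}"
  then obtain k where k: "i = Suc k" by (cases i) auto
  have "T U i \<subseteq> carrier M" using T_K[of i] K_carrier[of i] i by auto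
  then show ?thesis unfolding k gen.simps using i k by (intro set_add_right gen_subgroup) auto
qed

lemma U_T: "i \<in> {1..l} \<Longrightarrow> U i \<subseteq> T U i"
  unfolding T_rec using U_K[of i] K_carrier[of i]
  by (intro set_add_left image_y_subgroup T_subgroup) auto

lemma U_gen: "i \<in> {1..l} \<Longrightarrow> U i \<subseteq> gen U l"
  using U_T[of i] T_gen[of i] gen_mono[of i l] by auto

lemma y_gen: "i \<le> l \<Longrightarrow> y ` gen U i \<subseteq> gen U (i - 1)"
proof (induction i)
  case (Suc i)
  have A: "additive_subgroup (gen U i) M" using Suc by (intro gen_subgroup) simp
  have "y x \<in> gen U i" if x: "x \<in> gen U (Suc i)" for x
  proof -
    obtain w t where w: "w \<in> gen U i" and t: "t \<in> T U (Suc i)" and xw: "x = w \<oplus> t"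
      using x unfolding gen.simps set_add_iff by blast
    have tK: "t \<in> K (Suc i)" using T_K[of "Suc i"] t Suc.prems by auto
    have c: "w \<in> carrier M" "t \<in> carrier M" using gen_K[of i] w tK K_carrier Suc.prems by auto
    have "y w \<in> gen U i" using Suc w gen_mono[of "i - 1" i] by auto
    moreover have "y t \<in> gen U i"
    proof (cases "i = 0")
      case True
      then have "y t \<in> K 0" using tK c by (simp add: y_mem_K del: K_0)
      then show ?thesis using additive_subgroup.zero_closed[OF A] by simp
    next
      case False
      then have i: "i \<in> {1..l}" using Suc.prems by simp
      have "y ` T U (Suc i) \<subseteq> T U i" unfolding T_rec[OF i]
        using T_K[of "Suc i"] K_carrier Suc.prems by (intro set_add_right U i) force
      then show ?thesis using t T_gen[OF i] by auto
    qed
    ultimately show ?thesis using c xw A by (simp add: y_add additive_subgroup.a_closed)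
  qed
  then show ?case by auto
qed simp

text \<open>The components in the layers above \<open>i\<close> are removed one at a time: the top one of an element
  of a smaller kernel is zero.\<close>

lemma gen_Int_K: "i \<le> j \<Longrightarrow> j \<le> l \<Longrightarrow> gen U j \<inter> K i = gen U i"
proof (induction j)
  case 0 then show ?case by auto
next
  case (Suc j)
  show ?case
  proof (cases "i = Suc j")
    case True then show ?thesis using gen_K[of i] Suc.prems by auto
  next
    case False
    then have ij: "i \<le> j" using Suc.prems by simp
    have "x \<in> gen U j" if x: "x \<in> gen U (Suc j) \<inter> K i" for x
    proof -
      obtain w t where w: "w \<in> gen U j" and t: "t \<in> T U (Suc j)" and xw: "x = w \<oplus> t"
        using x unfolding gen.simps Int_iff set_add_iff by blast
      have tc: "t \<in> carrier M" using T_K[of "Suc j"] t K_carrier Suc.prems by auto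
      have wK: "w \<in> K j" using w gen_K[of j] Suc.prems by auto
      then have wc: "w \<in> carrier M" using K_carrier by auto
      have "x \<in> K j" using x K_mono[OF ij] by auto
      then have "x \<ominus> w \<in> K j" using wK by (intro additive_subgroup_minus[OF K_subgroup])
      then have "t \<in> K j" using xw wc tc by (simp add: add_diff_cancel_left')
      then have "t = \<zero>" using T_Int_K[of "Suc j"] t Suc.prems by auto
      then show ?thesis using xw w wc by simp
    qed
    then have "gen U (Suc j) \<inter> K i \<subseteq> gen U j \<inter> K i" by auto
    moreover have "gen U j \<inter> K i = gen U i" using Suc ij by simp
    moreover have "gen U i \<subseteq> gen U (Suc j) \<inter> K i"
      using gen_mono[of i "Suc j"] gen_K[of i] ij Suc.prems by auto
    ultimately show ?thesis by auto
  qed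
qed

text \<open>An element of \<open>gen U l \<inter> K\<^sub>i\<close> has the form \<open>w + u + y t\<close> with \<open>u \<in> U\<^sub>i\<close> and \<open>w + y t \<in> L\<^sub>i(gen U l)\<close>.
  So \<open>Q\<^sub>i\<close> of it is a quotient of \<open>U\<^sub>i\<close>, and \<open>U\<^sub>i\<close> maps isomorphically onto \<open>Rh i / L\<^sub>i(M)\<close>.\<close>

lemma gen_adapted: "adapted Rh (gen U l)"
  unfolding adapted_def
proof (intro conjI ballI)
  show G: "additive_subgroup (gen U l) M" by (rule gen_subgroup) simp
  show yG: "y ` gen U l \<subseteq> gen U l" using y_gen[of l] gen_mono[of "l - 1" l] by auto
  fix i assume i: "i \<in> {1..l}"
  have gi: "gen U l \<inter> K j = gen U j" if "j \<le> l" for j using gen_Int_K[of j l] that by simp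
  have split: "\<exists>w u t. w \<in> gen U (i - 1) \<and> u \<in> U i \<and> t \<in> T U (Suc i) \<and> x = w \<oplus> (u \<oplus> y t)"
    if xi: "x \<in> gen U i" for x
  proof -
    obtain k where k: "i = Suc k" using i by (cases i) auto
    obtain w v where w: "w \<in> gen U k" and v: "v \<in> T U i" and xw: "x = w \<oplus> v"
      using xi[unfolded k gen.simps set_add_iff] unfolding k by blast
    obtain u t where "u \<in> U i" "t \<in> T U (Suc i)" "v = u \<oplus> y t"
      using v unfolding T_rec[OF i] set_add_iff by blast
    moreover have "k = i - 1" using k by simp
    ultimately show ?thesis using w xw by blast
  qed
  have T1: "T U (Suc i) \<subseteq> gen U l \<inter> K (i + 1)"
  proof (cases "i = l")
    case True
    then show ?thesis using additive_subgroup.zero_closed[OF G]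
      additive_subgroup.zero_closed[OF K_subgroup] by simp
  next
    case False
    then show ?thesis using T_gen[of "Suc i"] gen_mono[of "Suc i" l] T_K[of "Suc i"] i by auto
  qed
  have mem: "w \<in> K (i - 1)" "u \<in> carrier M" "t \<in> K (i + 1)" "w \<in> carrier M" "t \<in> carrier M"
    if "w \<in> gen U (i - 1)" "u \<in> U i" "t \<in> T U (Suc i)" for w u t
  proof -
    have il: "i - 1 \<le> l" using i by auto
    show wK: "w \<in> K (i - 1)" by (rule subsetD[OF gen_K[OF il] that(1)])
    show tK: "t \<in> K (i + 1)" using that(3) T1 by blast
    show "w \<in> carrier M" "t \<in> carrier M" using wK tK K_carrier by blast+
    show "u \<in> carrier M" using that(2) U_K[OF i] K_carrier by blast
  qed
  have yL: "w \<oplus> y t \<in> L i" if "w \<in> K (i - 1)" "t \<in> K (i + 1)" for w t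
    using that K_pred_subset_L y_K_subset_L
    by (intro additive_subgroup.a_closed[OF L_subgroup]) auto
  show "gen U l \<inter> K i \<inter> L i \<subseteq> LS (gen U l) i"
  proof
    fix x assume x: "x \<in> gen U l \<inter> K i \<inter> L i"
    then have "x \<in> gen U i" using gi[of i] i by auto
    then obtain w u t where *: "w \<in> gen U (i - 1)" "u \<in> U i" "t \<in> T U (Suc i)"
      and xw: "x = w \<oplus> (u \<oplus> y t)"
      using split by blast
    note c = mem[OF *]
    have "x = u \<oplus> (w \<oplus> y t)" using c by (simp add: xw a_ac)
    then have "u = x \<ominus> (w \<oplus> y t)" using c by (simp add: add_diff_cancel_right')
    also have "\<dots> \<in> L i" using x yL[of w t] c by (intro additive_subgroup_minus[OF L_subgroup]) auto
    finally have "u = \<zero>" using U_L[OF i] * by auto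
    then have "x = y t \<oplus> w" using c by (simp add: xw a_comm)
    moreover have "i - 1 \<le> l" using i by auto
    from gi[OF this] have "w \<in> gen U l \<inter> K (i - 1)" using *(1) by simp
    ultimately show "x \<in> LS (gen U l) i" unfolding LS_iff using T1 *(3) by blast
  qed
  have Gi: "additive_subgroup (gen U i) M" using i by (intro gen_subgroup) simp
  have UR: "U i \<subseteq> Rh i" "L i \<subseteq> Rh i" and R: "additive_subgroup (Rh i) M"
    unfolding U_Rh[OF i, symmetric] using U_K[OF i] K_carrier
    by (intro set_add_left set_add_right add_additive_subgroups U L_subgroup i
        additive_subgroup.a_subset[OF L_subgroup]; blast)+
  show "(gen U l \<inter> K i) <+> L i = Rh i"
  proof
    have "x \<in> Rh i" if xi: "x \<in> gen U i" for x
    proof -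
      obtain w u t where *: "w \<in> gen U (i - 1)" "u \<in> U i" "t \<in> T U (Suc i)"
        and xw: "x = w \<oplus> (u \<oplus> y t)"
        using split[OF xi] by blast
      note c = mem[OF *]
      have "x = u \<oplus> (w \<oplus> y t)" using c by (simp add: xw a_ac)
      also have "\<dots> \<in> Rh i" 
        by (rule additive_subgroup.a_closed[OF R subsetD[OF UR(1) *(2)] subsetD[OF UR(2) yL[OF c(1) c(3)]]])
      finally show ?thesis .
    qed
    then show "(gen U l \<inter> K i) <+> L i \<subseteq> Rh i"
      using gi[of i] i UR by (intro set_add_least R) auto
    have "U i \<subseteq> gen U i" using U_T[OF i] T_gen[OF i] by simp
    moreover have "gen U l \<inter> K i = gen U i" using gi[of i] i by simp
    ultimately show "Rh i \<subseteq> (gen U l \<inter> K i) <+> L i"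
      unfolding U_Rh[OF i, symmetric] set_add_iff subset_iff by blast
  qed
qed

lemma gen_least:
  assumes S: "additive_subgroup S M" "y ` S \<subseteq> S" and US: "\<And>i. i \<in> {1..l} \<Longrightarrow> U i \<subseteq> S"
  shows "gen U l \<subseteq> S"
proof -
  have T: "T U i \<subseteq> S" if "i \<in> {1..Suc l}" for i
    using that
  proof (induction i rule: tail_induct)
    case base then show ?case using additive_subgroup.zero_closed[OF S(1)] by simp
  next
    case (step i)
    show ?case unfolding T_rec[OF step(1)] using step S(2) by (intro set_add_least S(1) US) auto
  qed
  have "i \<le> l \<Longrightarrow> gen U i \<subseteq> S" for i
  proof (induction i)
    case 0 then show ?case using additive_subgroup.zero_closed[OF S(1)] by simp
  next
    case (Suc i) then show ?case unfolding gen.simps by (intro set_add_least S(1) T) auto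
  qed
  then show ?thesis by simp
qed

text \<open>For \<open>f\<close> the action of a scalar, this makes \<open>gen U l\<close> a submodule.\<close>

lemma gen_invariant:
  assumes closed: "\<And>x. x \<in> carrier M \<Longrightarrow> f x \<in> carrier M"
    and add: "\<And>x z. x \<in> carrier M \<Longrightarrow> z \<in> carrier M \<Longrightarrow> f (x \<oplus> z) = f x \<oplus> f z"
    and comm: "\<And>x. x \<in> carrier M \<Longrightarrow> f (y x) = y (f x)"
    and inv: "\<And>i. i \<in> {1..l} \<Longrightarrow> f ` U i \<subseteq> U i"
  shows "f ` gen U l \<subseteq> gen U l"
proof -
  have "f \<zero> \<oplus> f \<zero> = f \<zero>" using add[of \<zero> \<zero>] by simp
  then have f0: "f \<zero> = \<zero>" using closed by simp
  have T: "f ` T U i \<subseteq> T U i" if "i \<in> {1..Suc l}" for i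
    using that
  proof (induction i rule: tail_induct)
    case base then show ?case by (simp add: f0)
  next
    case (step i)
    have "f (u \<oplus> y t) \<in> T U i" if u: "u \<in> U i" and t: "t \<in> T U (Suc i)" for u t
    proof -
      have "u \<in> carrier M" "t \<in> carrier M"
        using u t U_K[OF step(1)] T_K[of "Suc i"] step(1) K_carrier by auto
      then have "f (u \<oplus> y t) = f u \<oplus> y (f t)" by (simp add: add comm)
      moreover have "f u \<in> U i" "f t \<in> T U (Suc i)" using u t inv step by auto
      ultimately show ?thesis unfolding T_rec[OF step(1)] set_add_iff by blast
    qed
    then show ?case unfolding T_rec[OF step(1)] by (auto simp: set_add_iff simp del: tail.simps)
  qed
  have "i \<le> l \<Longrightarrow> f ` gen U i \<subseteq> gen U i" for i
  proof (induction i)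
    case 0 then show ?case by (simp add: f0)
  next
    case (Suc i)
    have "f (w \<oplus> t) \<in> gen U (Suc i)" if w: "w \<in> gen U i" and t: "t \<in> T U (Suc i)" for w t
    proof -
      have "w \<in> carrier M" "t \<in> carrier M"
        using w t gen_K[of i] T_K[of "Suc i"] Suc.prems K_carrier by auto
      then have "f (w \<oplus> t) = f w \<oplus> f t" by (simp add: add)
      moreover have "f w \<in> gen U i" "f t \<in> T U (Suc i)" using w t T[of "Suc i"] Suc by auto
      ultimately show ?thesis unfolding gen.simps set_add_iff by blast
    qed
    then show ?case unfolding gen.simps by (auto simp: set_add_iff simp del: tail.simps)
  qed
  then show ?thesis by simp
qed

end

end

section \<open>Bases, and quotients of submodules\<close>

text \<open>The witnesses in the definition of \<^const>\<open>free_module\<close>.\<close>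

definition basis_of :: "('a, 'c) ring_scheme \<Rightarrow> ('a, 'b, 'd) module_scheme \<Rightarrow> 'b set \<Rightarrow> bool" where
  "basis_of R M B \<longleftrightarrow> B \<subseteq> carrier M \<and>
     (\<forall>F c. finite F \<longrightarrow> F \<subseteq> B \<longrightarrow> c \<in> F \<rightarrow> carrier R \<longrightarrow>
        (\<Oplus>\<^bsub>M\<^esub>b\<in>F. c b \<odot>\<^bsub>M\<^esub> b) = \<zero>\<^bsub>M\<^esub> \<longrightarrow> (\<forall>b\<in>F. c b = \<zero>\<^bsub>R\<^esub>)) \<and>
     (\<forall>x\<in>carrier M. \<exists>F c. finite F \<and> F \<subseteq> B \<and> c \<in> F \<rightarrow> carrier R \<and>
        x = (\<Oplus>\<^bsub>M\<^esub>b\<in>F. c b \<odot>\<^bsub>M\<^esub> b))"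

lemma free_module_iff_basis: "free_module R M \<longleftrightarrow> (\<exists>B. basis_of R M B)"
  unfolding free_module_def basis_of_def by blast

context module
begin

lemma basis_subset: "basis_of R M B \<Longrightarrow> B \<subseteq> carrier M"
  by (simp add: basis_of_def)

lemma basis_independent:
  assumes "basis_of R M B" "finite F" "F \<subseteq> B" "c \<in> F \<rightarrow> carrier R"
    "(\<Oplus>\<^bsub>M\<^esub>b\<in>F. c b \<odot>\<^bsub>M\<^esub> b) = \<zero>\<^bsub>M\<^esub>" "b \<in> F"
  shows "c b = \<zero>"
proof -
  have "\<forall>F c. finite F \<longrightarrow> F \<subseteq> B \<longrightarrow> c \<in> F \<rightarrow> carrier R \<longrightarrow>
      (\<Oplus>\<^bsub>M\<^esub>b\<in>F. c b \<odot>\<^bsub>M\<^esub> b) = \<zero>\<^bsub>M\<^esub> \<longrightarrow> (\<forall>b\<in>F. c b = \<zero>)"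
    using assms(1) unfolding basis_of_def by (elim conjE)
  from this[rule_format, OF assms(2-6)] show ?thesis .
qed

lemma basis_comb:
  assumes "basis_of R M B" "x \<in> carrier M"
  obtains F c where "finite F" "F \<subseteq> B" "c \<in> F \<rightarrow> carrier R"
    "x = (\<Oplus>\<^bsub>M\<^esub>b\<in>F. c b \<odot>\<^bsub>M\<^esub> b)"
proof -
  have "\<forall>x\<in>carrier M. \<exists>F c. finite F \<and> F \<subseteq> B \<and> c \<in> F \<rightarrow> carrier R \<and>
        x = (\<Oplus>\<^bsub>M\<^esub>b\<in>F. c b \<odot>\<^bsub>M\<^esub> b)"
    using assms(1) unfolding basis_of_def by (elim conjE)
  from bspec[OF this assms(2)] show thesis by (elim exE conjE) (rule that)
qed

lemma basis_span:
  assumes B: "basis_of R M B" and fin: "finite B" and x: "x \<in> carrier M"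
  obtains c where "c \<in> B \<rightarrow> carrier R" "x = (\<Oplus>\<^bsub>M\<^esub>b\<in>B. c b \<odot>\<^bsub>M\<^esub> b)"
proof -
  obtain F c where "finite F" and F: "F \<subseteq> B" and c: "c \<in> F \<rightarrow> carrier R"
    and xc: "x = (\<Oplus>\<^bsub>M\<^esub>b\<in>F. c b \<odot>\<^bsub>M\<^esub> b)"
    using basis_comb[OF B x] .
  define d where "d b = (if b \<in> F then c b else \<zero>)" for b
  have d: "d \<in> B \<rightarrow> carrier R" using c by (auto simp: d_def)
  have BM: "B \<subseteq> carrier M" by (rule basis_subset[OF B])
  have "(\<Oplus>\<^bsub>M\<^esub>b\<in>F. c b \<odot>\<^bsub>M\<^esub> b) = (\<Oplus>\<^bsub>M\<^esub>b\<in>B. d b \<odot>\<^bsub>M\<^esub> b)"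
    using fin F BM c by (intro M.add.finprod_mono_neutral_cong_left) (auto simp: d_def Pi_iff subset_iff)
  then show thesis using that d xc by simp
qed

lemma basis_torsion_free:
  assumes "domain R" and B: "basis_of R M B"
    and r: "r \<in> carrier R" "r \<noteq> \<zero>" and x: "x \<in> carrier M" and rx: "r \<odot>\<^bsub>M\<^esub> x = \<zero>\<^bsub>M\<^esub>"
  shows "x = \<zero>\<^bsub>M\<^esub>"
proof -
  interpret domain R by fact
  obtain F c where F: "finite F" "F \<subseteq> B" and c: "c \<in> F \<rightarrow> carrier R"
    and xc: "x = (\<Oplus>\<^bsub>M\<^esub>b\<in>F. c b \<odot>\<^bsub>M\<^esub> b)"
    using basis_comb[OF B x] .
  have FM: "F \<subseteq> carrier M" using F basis_subset[OF B] by blast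
  have "r \<odot>\<^bsub>M\<^esub> x = (\<Oplus>\<^bsub>M\<^esub>b\<in>F. r \<odot>\<^bsub>M\<^esub> (c b \<odot>\<^bsub>M\<^esub> b))"
    unfolding xc using F FM c r by (intro finsum_smult_ldistr) auto
  also have "\<dots> = (\<Oplus>\<^bsub>M\<^esub>b\<in>F. (r \<otimes> c b) \<odot>\<^bsub>M\<^esub> b)"
    using FM c r by (intro M.finsum_cong') (auto simp: smult_assoc1 Pi_iff subset_iff)
  finally have s: "(\<Oplus>\<^bsub>M\<^esub>b\<in>F. (r \<otimes> c b) \<odot>\<^bsub>M\<^esub> b) = \<zero>\<^bsub>M\<^esub>" using rx by simp
  have rc: "(\<lambda>b. r \<otimes> c b) \<in> F \<rightarrow> carrier R" using c r by auto
  have c0: "c b = \<zero>" if b: "b \<in> F" for b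
  proof -
    have "r \<otimes> c b = \<zero>" by (rule basis_independent[OF B F rc s b])
    then show ?thesis using integral r c b by blast
  qed
  have "x = (\<Oplus>\<^bsub>M\<^esub>b\<in>F. \<zero>\<^bsub>M\<^esub>)"
    unfolding xc using FM c0 by (intro M.finsum_cong') (auto simp: subset_iff)
  then show ?thesis by simp
qed

text \<open>A finite sum is a fold restricted to the carrier, so it has to be compared when the carrier
  shrinks.\<close>

lemma finsum_submodule:
  assumes H: "submodule H R M" and f: "f \<in> F \<rightarrow> H"
  shows "finsum (M\<lparr>carrier := H\<rparr>) f F = finsum M f F"
proof -
  interpret N: module R "M\<lparr>carrier := H\<rparr>"
    by (rule submodule.submodule_is_module[OF H module_axioms])
  have HM: "H \<subseteq> carrier M" by (rule submoduleE(1)[OF H])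
  show ?thesis using f
  proof (induction F rule: infinite_finite_induct)
    case (infinite A)
    then show ?case by (simp add: finsum_def finprod_def)
  next
    case empty
    then show ?case using N.M.finsum_empty by simp
  next
    case (insert x F)
    have "f \<in> F \<rightarrow> carrier M" "f x \<in> carrier M" using insert.prems HM by auto
    moreover have "f \<in> F \<rightarrow> carrier (M\<lparr>carrier := H\<rparr>)" "f x \<in> carrier (M\<lparr>carrier := H\<rparr>)"
      using insert.prems by auto
    ultimately show ?case
      using insert N.M.finsum_insert[OF insert.hyps] M.finsum_insert[OF insert.hyps] by simp
  qed
qed

lemma finsum_hom:
  assumes N: "module R N"
    and closed: "\<And>x. x \<in> carrier M \<Longrightarrow> f x \<in> carrier N"
    and add: "\<And>x z. x \<in> carrier M \<Longrightarrow> z \<in> carrier M \<Longrightarrow> f (x \<oplus>\<^bsub>M\<^esub> z) = f x \<oplus>\<^bsub>N\<^esub> f z"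
    and g: "g \<in> F \<rightarrow> carrier M"
  shows "f (finsum M g F) = finsum N (\<lambda>i. f (g i)) F"
proof -
  interpret N: module R N by fact
  have "f \<zero>\<^bsub>M\<^esub> \<oplus>\<^bsub>N\<^esub> f \<zero>\<^bsub>M\<^esub> = f \<zero>\<^bsub>M\<^esub>" using add[of "\<zero>\<^bsub>M\<^esub>" "\<zero>\<^bsub>M\<^esub>"] by simp
  then have f0: "f \<zero>\<^bsub>M\<^esub> = \<zero>\<^bsub>N\<^esub>" using closed[OF M.zero_closed] by simp
  show ?thesis using g
    by (induction F rule: infinite_finite_induct) (auto simp: f0 add closed Pi_iff)
qed

lemma free_module_pullback:
  assumes N: "module R N" and bij: "bij_betw f (carrier M) (carrier N)"
    and add: "\<And>x z. x \<in> carrier M \<Longrightarrow> z \<in> carrier M \<Longrightarrow> f (x \<oplus>\<^bsub>M\<^esub> z) = f x \<oplus>\<^bsub>N\<^esub> f z"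
    and smult: "\<And>r x. r \<in> carrier R \<Longrightarrow> x \<in> carrier M \<Longrightarrow> f (r \<odot>\<^bsub>M\<^esub> x) = r \<odot>\<^bsub>N\<^esub> f x"
    and free: "free_module R N"
  shows "free_module R M"
proof -
  interpret N: module R N by fact
  have inj: "inj_on f (carrier M)" and im: "f ` carrier M = carrier N"
    using bij by (auto simp: bij_betw_def)
  have closed: "f x \<in> carrier N" if "x \<in> carrier M" for x using im that by auto
  have "f \<zero>\<^bsub>M\<^esub> \<oplus>\<^bsub>N\<^esub> f \<zero>\<^bsub>M\<^esub> = f \<zero>\<^bsub>M\<^esub>" using add[of "\<zero>\<^bsub>M\<^esub>" "\<zero>\<^bsub>M\<^esub>"] by simp
  then have f0: "f \<zero>\<^bsub>M\<^esub> = \<zero>\<^bsub>N\<^esub>" using closed[OF M.zero_closed] by simp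
  define g where "g = inv_into (carrier M) f"
  have g: "g b \<in> carrier M" "f (g b) = b" if "b \<in> carrier N" for b
    using that im by (auto simp: g_def inv_into_into f_inv_into_f)
  obtain B where B: "basis_of R N B" using free unfolding free_module_iff_basis by blast
  have BN: "B \<subseteq> carrier N" by (rule N.basis_subset[OF B])
  have comb: "f (\<Oplus>\<^bsub>M\<^esub>a\<in>F. c a \<odot>\<^bsub>M\<^esub> a) = (\<Oplus>\<^bsub>N\<^esub>a\<in>F. c a \<odot>\<^bsub>N\<^esub> f a)"
    if F: "F \<subseteq> carrier M" and c: "c \<in> F \<rightarrow> carrier R" for F c
  proof -
    have "f (\<Oplus>\<^bsub>M\<^esub>a\<in>F. c a \<odot>\<^bsub>M\<^esub> a) = (\<Oplus>\<^bsub>N\<^esub>a\<in>F. f (c a \<odot>\<^bsub>M\<^esub> a))"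
      using F c by (intro finsum_hom[OF N closed add, of "\<lambda>a. c a \<odot>\<^bsub>M\<^esub> a" F]) auto
    also have "\<dots> = (\<Oplus>\<^bsub>N\<^esub>a\<in>F. c a \<odot>\<^bsub>N\<^esub> f a)"
      using F c by (intro N.M.finsum_cong') (auto simp: smult closed Pi_iff subset_iff)
    finally show ?thesis .
  qed
  have "basis_of R M (g ` B)"
    unfolding basis_of_def
  proof (intro conjI allI impI ballI)
    show gB: "g ` B \<subseteq> carrier M" using g BN by auto
    fix F c b
    assume F: "finite F" "F \<subseteq> g ` B" and c: "c \<in> F \<rightarrow> carrier R"
      and s: "(\<Oplus>\<^bsub>M\<^esub>b\<in>F. c b \<odot>\<^bsub>M\<^esub> b) = \<zero>\<^bsub>M\<^esub>" and b: "b \<in> F"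
    have FM: "F \<subseteq> carrier M" using F gB by blast
    have gf: "g (f a) = a" if "a \<in> F" for a
      using that FM inj by (auto simp: g_def inv_into_f_f)
    have "f a \<in> B" if "a \<in> F" for a
    proof -
      obtain b where "b \<in> B" "a = g b" using F \<open>a \<in> F\<close> by blast
      then show ?thesis using g(2) BN by auto
    qed
    then have fF: "f ` F \<subseteq> B" by blast
    have injF: "inj_on f F" using inj FM by (rule inj_on_subset)
    have "(\<Oplus>\<^bsub>N\<^esub>b\<in>f ` F. c (g b) \<odot>\<^bsub>N\<^esub> b) = (\<Oplus>\<^bsub>N\<^esub>a\<in>F. c (g (f a)) \<odot>\<^bsub>N\<^esub> f a)"
      using injF c fF BN gf closed FM by (intro N.M.finsum_reindex) (auto simp: Pi_iff)
    also have "\<dots> = (\<Oplus>\<^bsub>N\<^esub>a\<in>F. c a \<odot>\<^bsub>N\<^esub> f a)"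
      using gf c closed FM by (intro N.M.finsum_cong') (auto simp: Pi_iff subset_iff)
    also have "\<dots> = \<zero>\<^bsub>N\<^esub>" using comb[OF FM c] s f0 by simp
    finally have s': "(\<Oplus>\<^bsub>N\<^esub>b\<in>f ` F. c (g b) \<odot>\<^bsub>N\<^esub> b) = \<zero>\<^bsub>N\<^esub>" .
    have "(\<lambda>b. c (g b)) \<in> f ` F \<rightarrow> carrier R" using c gf by auto
    from N.basis_independent[OF B _ fF this s' imageI[OF b]] show "c b = \<zero>"
      using F gf[OF b] by simp
  next
    fix x assume x: "x \<in> carrier M"
    obtain F c where F: "finite F" "F \<subseteq> B" and c: "c \<in> F \<rightarrow> carrier R"
      and fx: "f x = (\<Oplus>\<^bsub>N\<^esub>b\<in>F. c b \<odot>\<^bsub>N\<^esub> b)"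
      using N.basis_comb[OF B closed[OF x]] .
    have FN: "F \<subseteq> carrier N" using F BN by blast
    have gF: "g ` F \<subseteq> carrier M" using g FN by auto
    have injF: "inj_on g F" by (rule inj_on_inverseI[of _ f]) (use g FN in auto)
    have c': "(\<lambda>a. c (f a)) \<in> g ` F \<rightarrow> carrier R"
      using c g FN by (auto simp: Pi_iff subset_iff)
    have "f (\<Oplus>\<^bsub>M\<^esub>a\<in>g ` F. c (f a) \<odot>\<^bsub>M\<^esub> a) = (\<Oplus>\<^bsub>N\<^esub>a\<in>g ` F. c (f a) \<odot>\<^bsub>N\<^esub> f a)"
      by (rule comb[OF gF c'])
    also have "\<dots> = (\<Oplus>\<^bsub>N\<^esub>b\<in>F. c (f (g b)) \<odot>\<^bsub>N\<^esub> f (g b))"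
      using injF c g FN by (intro N.M.finsum_reindex) (auto simp: Pi_iff subset_iff)
    also have "\<dots> = f x"
      unfolding fx using c g FN by (intro N.M.finsum_cong') (auto simp: Pi_iff subset_iff)
    finally have fs: "f (\<Oplus>\<^bsub>M\<^esub>a\<in>g ` F. c (f a) \<odot>\<^bsub>M\<^esub> a) = f x" .
    have "(\<Oplus>\<^bsub>M\<^esub>a\<in>g ` F. c (f a) \<odot>\<^bsub>M\<^esub> a) \<in> carrier M"
      using gF c' by (intro M.finsum_closed) (auto simp: Pi_iff subset_iff)
    from inj_onD[OF inj fs this x] have "x = (\<Oplus>\<^bsub>M\<^esub>a\<in>g ` F. c (f a) \<odot>\<^bsub>M\<^esub> a)"
      by (rule sym)
    then show "\<exists>F c. finite F \<and> F \<subseteq> g ` B \<and> c \<in> F \<rightarrow> carrier R \<and>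
        x = (\<Oplus>\<^bsub>M\<^esub>b\<in>F. c b \<odot>\<^bsub>M\<^esub> b)"
      using F c' by (intro exI[of _ "g ` F"] exI[of _ "\<lambda>a. c (f a)"]) auto
  qed
  then show ?thesis unfolding free_module_iff_basis by blast
qed

end

text \<open>The setting of \<open>Q\<^sub>i\<close>: the quotient of a submodule by a submodule, in the encoding of
  \<^const>\<open>quot_module\<close>.\<close>

locale sub_quotient = module R M for R (structure) and M (structure) +
  fixes A H :: "'c set"
  assumes A: "submodule A R M" and H: "submodule H R M" and HA: "H \<subseteq> A"
begin

abbreviation Q :: "('a, 'c set) module" where
  "Q \<equiv> quot_module (\<lambda>r. r) (M\<lparr>carrier := A\<rparr>) H"

lemma A_carrier: "A \<subseteq> carrier M"
  by (rule submoduleE(1)[OF A])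

lemma A_subgroup: "additive_subgroup A M" and H_subgroup: "additive_subgroup H M"
  using A H by (auto simp: submodule_def additive_subgroup_def)

lemma carrier_Q: "carrier Q = (\<lambda>x. H +>\<^bsub>M\<^esub> x) ` A"
  by (auto simp: quot_module_def A_RCOSETS_def' a_r_coset_def')

lemma zero_Q: "\<zero>\<^bsub>Q\<^esub> = H"
  by (simp add: quot_module_def)

lemma coset_zero: "H +>\<^bsub>M\<^esub> \<zero>\<^bsub>M\<^esub> = H"
  by (rule M.a_coset_add_zero[OF additive_subgroup.a_subset[OF H_subgroup]])

lemma coset_add:
  assumes "x \<in> carrier M" "z \<in> carrier M"
  shows "(H +>\<^bsub>M\<^esub> x) \<oplus>\<^bsub>Q\<^esub> (H +>\<^bsub>M\<^esub> z) = H +>\<^bsub>M\<^esub> (x \<oplus>\<^bsub>M\<^esub> z)"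
proof -
  interpret abelian_subgroup H M by (rule abelian_subgroupI3[OF H_subgroup M.abelian_group_axioms])
  have "(H +>\<^bsub>M\<^esub> x) \<oplus>\<^bsub>Q\<^esub> (H +>\<^bsub>M\<^esub> z) = (H +>\<^bsub>M\<^esub> x) <+>\<^bsub>M\<^esub> (H +>\<^bsub>M\<^esub> z)"
    by (simp add: quot_module_def set_add_def')
  then show ?thesis using a_rcos_sum[OF assms] by simp
qed

lemma coset_smult:
  assumes r: "r \<in> carrier R" and x: "x \<in> carrier M"
  shows "r \<odot>\<^bsub>Q\<^esub> (H +>\<^bsub>M\<^esub> x) = H +>\<^bsub>M\<^esub> (r \<odot>\<^bsub>M\<^esub> x)"
proof -
  interpret H: additive_subgroup H M by (rule H_subgroup)
  have "H +>\<^bsub>M\<^esub> (r \<odot>\<^bsub>M\<^esub> m) = H +>\<^bsub>M\<^esub> (r \<odot>\<^bsub>M\<^esub> x)" if "m \<in> H +>\<^bsub>M\<^esub> x" for m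
  proof -
    obtain h where h: "h \<in> H" and m: "m = h \<oplus>\<^bsub>M\<^esub> x" using \<open>m \<in> H +>\<^bsub>M\<^esub> x\<close> by (auto simp: a_r_coset_def')
    have "r \<odot>\<^bsub>M\<^esub> m \<ominus>\<^bsub>M\<^esub> r \<odot>\<^bsub>M\<^esub> x = r \<odot>\<^bsub>M\<^esub> h"
      using r x H.a_Hcarr[OF h] by (simp add: m smult_r_distr M.add_diff_cancel_right')
    also have "\<dots> \<in> H" by (rule submoduleE(4)[OF H r h])
    finally show ?thesis using r x H.a_Hcarr[OF h] by (simp add: M.coset_eq_iff[OF H_subgroup] m)
  qed
  then have "(\<Union>m\<in>H +>\<^bsub>M\<^esub> x. H +>\<^bsub>M\<^esub> (r \<odot>\<^bsub>M\<^esub> m)) = (\<Union>m\<in>H +>\<^bsub>M\<^esub> x. H +>\<^bsub>M\<^esub> (r \<odot>\<^bsub>M\<^esub> x))"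
    by (intro SUP_cong) auto
  moreover have "x \<in> H +>\<^bsub>M\<^esub> x" using x H.zero_closed by (simp add: M.a_rcos_iff[OF H_subgroup] a_minus_def M.r_neg)
  moreover have "r \<odot>\<^bsub>Q\<^esub> (H +>\<^bsub>M\<^esub> x) = (\<Union>m\<in>H +>\<^bsub>M\<^esub> x. H +>\<^bsub>M\<^esub> (r \<odot>\<^bsub>M\<^esub> m))"
    by (simp add: quot_module_def a_r_coset_def')
  ultimately show ?thesis by (auto simp del: SUP_apply split: if_splits)
qed

lemma carrier_QE:
  assumes "C \<in> carrier Q"
  obtains x where "x \<in> A" "C = H +>\<^bsub>M\<^esub> x"
  using assms unfolding carrier_Q by blast

lemma Q_module: "module R Q"
proof (rule moduleI)
  note c = subsetD[OF A_carrier]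
  show "abelian_group Q"
  proof (rule abelian_groupI)
    fix C D assume "C \<in> carrier Q" "D \<in> carrier Q"
    then obtain x z where *: "x \<in> A" "z \<in> A" "C = H +>\<^bsub>M\<^esub> x" "D = H +>\<^bsub>M\<^esub> z"
      by (metis carrier_QE)
    then show "C \<oplus>\<^bsub>Q\<^esub> D \<in> carrier Q" "C \<oplus>\<^bsub>Q\<^esub> D = D \<oplus>\<^bsub>Q\<^esub> C"
      using c submoduleE(5)[OF A] by (auto simp: coset_add carrier_Q M.a_comm)
    fix E assume "E \<in> carrier Q"
    then obtain w where "w \<in> A" "E = H +>\<^bsub>M\<^esub> w" by (rule carrier_QE)
    then show "C \<oplus>\<^bsub>Q\<^esub> D \<oplus>\<^bsub>Q\<^esub> E = C \<oplus>\<^bsub>Q\<^esub> (D \<oplus>\<^bsub>Q\<^esub> E)"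
      using * c by (simp add: coset_add M.a_assoc)
  next
    have "\<zero>\<^bsub>M\<^esub> \<in> A" using A_subgroup by (rule additive_subgroup.zero_closed)
    then show "\<zero>\<^bsub>Q\<^esub> \<in> carrier Q" unfolding zero_Q carrier_Q using coset_zero by blast
  next
    fix C assume "C \<in> carrier Q"
    then obtain x where *: "x \<in> A" "C = H +>\<^bsub>M\<^esub> x" by (rule carrier_QE)
    then have x: "x \<in> carrier M" using c by simp
    show "\<zero>\<^bsub>Q\<^esub> \<oplus>\<^bsub>Q\<^esub> C = C"
      using coset_add[OF M.zero_closed x] x by (simp add: zero_Q coset_zero *)
    have "(H +>\<^bsub>M\<^esub> (\<ominus>\<^bsub>M\<^esub> x)) \<oplus>\<^bsub>Q\<^esub> C = \<zero>\<^bsub>Q\<^esub>"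
      using coset_add[OF M.a_inv_closed[OF x] x] x by (simp add: zero_Q coset_zero * M.l_neg)
    then show "\<exists>D\<in>carrier Q. D \<oplus>\<^bsub>Q\<^esub> C = \<zero>\<^bsub>Q\<^esub>"
      unfolding carrier_Q using submoduleE(3)[OF A *(1)] by blast
  qed
  show "cring R" by (rule R.is_cring)
  fix a C assume a: "a \<in> carrier R" and "C \<in> carrier Q"
  then obtain x where x: "x \<in> A" "C = H +>\<^bsub>M\<^esub> x" by (auto elim: carrier_QE)
  then show "a \<odot>\<^bsub>Q\<^esub> C \<in> carrier Q"
    using a c submoduleE(4)[OF A a] by (auto simp: coset_smult carrier_Q)
  show "a \<odot>\<^bsub>Q\<^esub> (C \<oplus>\<^bsub>Q\<^esub> D) = a \<odot>\<^bsub>Q\<^esub> C \<oplus>\<^bsub>Q\<^esub> a \<odot>\<^bsub>Q\<^esub> D" if "D \<in> carrier Q" for D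
  proof -
    obtain z where "z \<in> A" "D = H +>\<^bsub>M\<^esub> z" using \<open>D \<in> carrier Q\<close> by (rule carrier_QE)
    then show ?thesis using x a c by (simp add: coset_smult coset_add smult_r_distr)
  qed
  fix b assume b: "b \<in> carrier R"
  show "(a \<oplus> b) \<odot>\<^bsub>Q\<^esub> C = a \<odot>\<^bsub>Q\<^esub> C \<oplus>\<^bsub>Q\<^esub> b \<odot>\<^bsub>Q\<^esub> C"
    "a \<otimes> b \<odot>\<^bsub>Q\<^esub> C = a \<odot>\<^bsub>Q\<^esub> (b \<odot>\<^bsub>Q\<^esub> C)"
    using x a b c by (simp_all add: coset_smult coset_add smult_l_distr smult_assoc1)
next
  fix C assume "C \<in> carrier Q"
  then obtain x where x: "x \<in> A" "C = H +>\<^bsub>M\<^esub> x" by (rule carrier_QE)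
  then show "\<one> \<odot>\<^bsub>Q\<^esub> C = C" using A_carrier by (auto simp: coset_smult)
qed

lemma coset_finsum:
  assumes "f \<in> F \<rightarrow> A"
  shows "H +>\<^bsub>M\<^esub> (finsum M f F) = finsum Q (\<lambda>i. H +>\<^bsub>M\<^esub> f i) F"
proof -
  interpret N: module R "M\<lparr>carrier := A\<rparr>"
    by (rule submodule.submodule_is_module[OF A module_axioms])
  have "H +>\<^bsub>M\<^esub> (finsum (M\<lparr>carrier := A\<rparr>) f F) = finsum Q (\<lambda>i. H +>\<^bsub>M\<^esub> f i) F"
    using assms
    by (intro N.finsum_hom[OF Q_module]) (simp_all add: carrier_Q coset_add subsetD[OF A_carrier])
  then show ?thesis by (simp add: finsum_submodule[OF A assms])
qed

lemma coset_self: "x \<in> A \<Longrightarrow> x \<in> H +>\<^bsub>M\<^esub> x"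
proof -
  assume "x \<in> A"
  then have "x \<in> carrier M" using A_carrier by auto
  then show ?thesis
    using additive_subgroup.zero_closed[OF H_subgroup]
    by (simp add: M.a_rcos_iff[OF H_subgroup] a_minus_def M.r_neg)
qed

lemma coset_eq_H_iff: "x \<in> carrier M \<Longrightarrow> H +>\<^bsub>M\<^esub> x = H \<longleftrightarrow> x \<in> H"
  using M.coset_eq_iff[OF H_subgroup, of x "\<zero>\<^bsub>M\<^esub>"] by (simp add: coset_zero M.diff_zero)

interpretation Q: module R Q by (rule Q_module)

lemma coset_in_iff:
  assumes C: "C \<subseteq> carrier Q" and x: "x \<in> A"
  shows "H +>\<^bsub>M\<^esub> x \<in> C \<longleftrightarrow> x \<in> \<Union>C"
proof
  assume "H +>\<^bsub>M\<^esub> x \<in> C"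
  then show "x \<in> \<Union>C" using coset_self[OF x] by blast
next
  assume "x \<in> \<Union>C"
  then obtain b where b: "b \<in> C" "x \<in> b" by blast
  then obtain a where a: "a \<in> A" "b = H +>\<^bsub>M\<^esub> a" using C by (blast elim: carrier_QE)
  have c: "x \<in> carrier M" "a \<in> carrier M" using x a A_carrier by auto
  then have "x \<ominus>\<^bsub>M\<^esub> a \<in> H" using b(2) a(2) M.a_rcos_iff[OF H_subgroup c(2)] by simp
  then show "H +>\<^bsub>M\<^esub> x \<in> C" using M.coset_eq_iff[OF H_subgroup c] a(2) b(1) by simp
qed

lemma coset_minus:
  assumes "x \<in> carrier M" "z \<in> carrier M" "x \<in> A" "z \<in> A"
  shows "(H +>\<^bsub>M\<^esub> x) \<ominus>\<^bsub>Q\<^esub> (H +>\<^bsub>M\<^esub> z) = H +>\<^bsub>M\<^esub> (x \<ominus>\<^bsub>M\<^esub> z)"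
proof -
  have xz: "x \<ominus>\<^bsub>M\<^esub> z \<in> A" by (rule M.additive_subgroup_minus[OF A_subgroup assms(3,4)])
  have cQ: "H +>\<^bsub>M\<^esub> w \<in> carrier Q" if "w \<in> A" for w using that by (auto simp: carrier_Q)
  have "(H +>\<^bsub>M\<^esub> (x \<ominus>\<^bsub>M\<^esub> z)) \<oplus>\<^bsub>Q\<^esub> (H +>\<^bsub>M\<^esub> z) = H +>\<^bsub>M\<^esub> x"
    using coset_add[of "x \<ominus>\<^bsub>M\<^esub> z" z] assms by (simp add: M.diff_add_cancel)
  then show ?thesis
    using Q.M.add_diff_cancel_right'[OF cQ[OF xz] cQ[OF assms(4)]] by simp
qed

text \<open>Third isomorphism theorem for indices.\<close>

lemma index_quotient:
  assumes C: "submodule C R Q"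
  shows "a_index Q (carrier Q) C = a_index M A (\<Union>C)"
    and "additive_subgroup (\<Union>C) M"
proof -
  have CQ: "C \<subseteq> carrier Q" by (rule Q.submoduleE(1)[OF C])
  have Csub: "additive_subgroup C Q" using C by (simp add: submodule_def additive_subgroup_def)
  have UA: "\<Union>C \<subseteq> A"
  proof
    fix x assume "x \<in> \<Union>C"
    then obtain b where b: "b \<in> C" "x \<in> b" by blast
    then obtain a where a: "a \<in> A" "b = H +>\<^bsub>M\<^esub> a" using CQ by (blast elim: carrier_QE)
    have ac: "a \<in> carrier M" using a A_carrier by auto
    then have "x \<in> carrier M" "x \<ominus>\<^bsub>M\<^esub> a \<in> H" using b(2) a(2) M.a_rcos_iff[OF H_subgroup ac] by auto
    then have "x \<ominus>\<^bsub>M\<^esub> a \<oplus>\<^bsub>M\<^esub> a \<in> A"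
      using HA a by (intro additive_subgroup.a_closed[OF A_subgroup]) auto
    then show "x \<in> A" using \<open>x \<in> carrier M\<close> ac by (simp add: M.diff_add_cancel)
  qed
  have Ac: "x \<in> carrier M" if "x \<in> A" for x using that A_carrier by auto
  have minus: "x \<ominus>\<^bsub>M\<^esub> z \<in> \<Union>C \<longleftrightarrow> (H +>\<^bsub>M\<^esub> x) \<ominus>\<^bsub>Q\<^esub> (H +>\<^bsub>M\<^esub> z) \<in> C" if "x \<in> A" "z \<in> A" for x z
    using coset_in_iff[OF CQ M.additive_subgroup_minus[OF A_subgroup that]] coset_minus[OF Ac Ac] that by simp
  show U: "additive_subgroup (\<Union>C) M"
  proof (rule M.additive_subgroupI')
    show "\<Union>C \<subseteq> carrier M" using UA Ac by blast
    have "H \<in> C" using additive_subgroup.zero_closed[OF Csub] zero_Q by simp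
    then show "\<zero>\<^bsub>M\<^esub> \<in> \<Union>C" using additive_subgroup.zero_closed[OF H_subgroup] by blast
    fix x z assume xz: "x \<in> \<Union>C" "z \<in> \<Union>C"
    then have "x \<in> A" "z \<in> A" using UA by auto
    then have "H +>\<^bsub>M\<^esub> x \<in> C" "H +>\<^bsub>M\<^esub> z \<in> C" using xz coset_in_iff[OF CQ] by simp_all
    then show "x \<ominus>\<^bsub>M\<^esub> z \<in> \<Union>C"
      unfolding minus[OF \<open>x \<in> A\<close> \<open>z \<in> A\<close>] by (rule Q.M.additive_subgroup_minus[OF Csub])
  qed
  have "a_index M A (\<Union>C) = a_index Q (carrier Q) C"
    unfolding a_index_def
  proof (rule card_image_transfer[where f = "\<lambda>x. H +>\<^bsub>M\<^esub> x"])
    show "(\<lambda>x. H +>\<^bsub>M\<^esub> x) \<in> A \<rightarrow> carrier Q" by (auto simp: carrier_Q)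
    show "\<exists>z\<in>A. C +>\<^bsub>Q\<^esub> X' = C +>\<^bsub>Q\<^esub> (H +>\<^bsub>M\<^esub> z)" if "X' \<in> carrier Q" for X'
      using that by (auto simp: carrier_Q)
    fix x z assume xz: "x \<in> A" "z \<in> A"
    then have "H +>\<^bsub>M\<^esub> x \<in> carrier Q" "H +>\<^bsub>M\<^esub> z \<in> carrier Q" by (auto simp: carrier_Q)
    then show "\<Union>C +>\<^bsub>M\<^esub> x = \<Union>C +>\<^bsub>M\<^esub> z \<longleftrightarrow> C +>\<^bsub>Q\<^esub> (H +>\<^bsub>M\<^esub> x) = C +>\<^bsub>Q\<^esub> (H +>\<^bsub>M\<^esub> z)"
      using M.coset_eq_iff[OF U Ac[OF xz(1)] Ac[OF xz(2)]] Q.M.coset_eq_iff[OF Csub] minus[OF xz] by simp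
  qed
  then show "a_index Q (carrier Q) C = a_index M A (\<Union>C)" by simp
qed

end

section \<open>Spans of lifted bases\<close>

context module
begin

definition lin_span :: "('i \<Rightarrow> 'c) \<Rightarrow> 'i set \<Rightarrow> 'c set" where
  "lin_span s B = (\<lambda>c. \<Oplus>\<^bsub>M\<^esub>b\<in>B. c b \<odot>\<^bsub>M\<^esub> s b) ` (B \<rightarrow> carrier R)"

lemma lin_span_submodule:
  assumes fin: "finite B" and s: "s \<in> B \<rightarrow> carrier M"
  shows "submodule (lin_span s B) R M"
proof -
  have cs: "(\<lambda>b. c b \<odot>\<^bsub>M\<^esub> s b) \<in> B \<rightarrow> carrier M" if "c \<in> B \<rightarrow> carrier R" for c
    using that s by (auto simp: Pi_iff)
  have smult: "r \<odot>\<^bsub>M\<^esub> x \<in> lin_span s B" if r: "r \<in> carrier R" and x: "x \<in> lin_span s B" for r x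
  proof -
    obtain c where c: "c \<in> B \<rightarrow> carrier R" and xc: "x = (\<Oplus>\<^bsub>M\<^esub>b\<in>B. c b \<odot>\<^bsub>M\<^esub> s b)"
      using x by (auto simp: lin_span_def)
    have "r \<odot>\<^bsub>M\<^esub> x = (\<Oplus>\<^bsub>M\<^esub>b\<in>B. r \<odot>\<^bsub>M\<^esub> (c b \<odot>\<^bsub>M\<^esub> s b))"
      unfolding xc by (rule finsum_smult_ldistr[OF fin r cs[OF c]])
    also have "\<dots> = (\<Oplus>\<^bsub>M\<^esub>b\<in>B. (r \<otimes> c b) \<odot>\<^bsub>M\<^esub> s b)"
      using c r s by (intro M.finsum_cong') (auto simp: smult_assoc1 Pi_iff)
    finally show ?thesis
      unfolding lin_span_def using c r by (intro image_eqI[of _ _ "\<lambda>b. r \<otimes> c b"]) auto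
  qed
  have carr: "lin_span s B \<subseteq> carrier M" using cs by (auto simp: lin_span_def intro!: M.finsum_closed)
  show ?thesis
  proof (rule submoduleI)
    show "lin_span s B \<subseteq> carrier M" by (rule carr)
    have "(\<Oplus>\<^bsub>M\<^esub>b\<in>B. \<zero> \<odot>\<^bsub>M\<^esub> s b) = (\<Oplus>\<^bsub>M\<^esub>b\<in>B. \<zero>\<^bsub>M\<^esub>)"
      using s by (intro M.finsum_cong') (auto simp: Pi_iff)
    then show "\<zero>\<^bsub>M\<^esub> \<in> lin_span s B"
      unfolding lin_span_def by (intro image_eqI[of _ _ "\<lambda>b. \<zero>"]) auto
    show "r \<odot>\<^bsub>M\<^esub> x \<in> lin_span s B" if "r \<in> carrier R" "x \<in> lin_span s B" for r x
      by (rule smult[OF that])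
    show "\<ominus>\<^bsub>M\<^esub> x \<in> lin_span s B" if x: "x \<in> lin_span s B" for x
      using smult[of "\<ominus> \<one>" x] x subsetD[OF carr x] by (simp add: smult_l_minus)
    fix x z assume "x \<in> lin_span s B" "z \<in> lin_span s B"
    then obtain c d where c: "c \<in> B \<rightarrow> carrier R" and d: "d \<in> B \<rightarrow> carrier R"
      and xz: "x = (\<Oplus>\<^bsub>M\<^esub>b\<in>B. c b \<odot>\<^bsub>M\<^esub> s b)" "z = (\<Oplus>\<^bsub>M\<^esub>b\<in>B. d b \<odot>\<^bsub>M\<^esub> s b)"
      by (auto simp: lin_span_def)
    have "x \<oplus>\<^bsub>M\<^esub> z = (\<Oplus>\<^bsub>M\<^esub>b\<in>B. c b \<odot>\<^bsub>M\<^esub> s b \<oplus>\<^bsub>M\<^esub> d b \<odot>\<^bsub>M\<^esub> s b)"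
      unfolding xz by (rule M.finsum_addf[OF cs[OF c] cs[OF d], symmetric])
    also have "\<dots> = (\<Oplus>\<^bsub>M\<^esub>b\<in>B. (c b \<oplus> d b) \<odot>\<^bsub>M\<^esub> s b)"
      using c d s by (intro M.finsum_cong') (auto simp: smult_l_distr Pi_iff)
    finally show "x \<oplus>\<^bsub>M\<^esub> z \<in> lin_span s B"
      unfolding lin_span_def using c d by (intro image_eqI[of _ _ "\<lambda>b. c b \<oplus> d b"]) auto
  qed
qed

lemma lin_span_base:
  assumes fin: "finite B" and s: "s \<in> B \<rightarrow> carrier M" and a: "a \<in> B"
  shows "s a \<in> lin_span s B"
proof -
  define c where "c b = (if a = b then \<one> else \<zero>)" for b
  have "(\<Oplus>\<^bsub>M\<^esub>b\<in>B. c b \<odot>\<^bsub>M\<^esub> s b) = (\<Oplus>\<^bsub>M\<^esub>b\<in>B. if a = b then s b else \<zero>\<^bsub>M\<^esub>)"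
    using s by (intro M.finsum_cong') (auto simp: c_def Pi_iff)
  also have "\<dots> = s a" by (rule M.add.finprod_singleton[OF a fin s])
  finally show ?thesis unfolding lin_span_def by (intro image_eqI[of _ _ c]) (auto simp: c_def)
qed

lemma lin_span_least:
  assumes S: "submodule S R M" and s: "s \<in> B \<rightarrow> S"
  shows "lin_span s B \<subseteq> S"
proof -
  interpret N: module R "M\<lparr>carrier := S\<rparr>"
    by (rule submodule.submodule_is_module[OF S module_axioms])
  have "(\<Oplus>\<^bsub>M\<^esub>b\<in>B. c b \<odot>\<^bsub>M\<^esub> s b) \<in> S" if "c \<in> B \<rightarrow> carrier R" for c
  proof -
    have *: "(\<lambda>b. c b \<odot>\<^bsub>M\<^esub> s b) \<in> B \<rightarrow> S" using that s submoduleE(4)[OF S] by (auto simp: Pi_iff)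
    then show ?thesis using N.M.finsum_closed[of "\<lambda>b. c b \<odot>\<^bsub>M\<^esub> s b" B] finsum_submodule[OF S *] by simp
  qed
  then show ?thesis by (auto simp: lin_span_def)
qed

end

context sub_quotient
begin

text \<open>A basis of a submodule \<open>C\<close> of \<open>A/H\<close> consists of cosets, and \<open>s\<close> chooses an element in each. The
  span of the chosen elements is a complement of \<open>H\<close> in the preimage \<open>\<Union>C\<close> of \<open>C\<close>.\<close>

context
  fixes C :: "'c set set" and B :: "'c set set" and s :: "'c set \<Rightarrow> 'c"
  assumes C: "submodule C R Q" and B: "basis_of R (Q\<lparr>carrier := C\<rparr>) B" and fin: "finite B"
    and s: "\<And>b. b \<in> B \<Longrightarrow> s b \<in> b"
begin

interpretation Q: module R Q by (rule Q_module)

interpretation C: module R "Q\<lparr>carrier := C\<rparr>"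
  by (rule submodule.submodule_is_module[OF C Q_module])

lemma C_carrier: "C \<subseteq> carrier Q"
  by (rule Q.submoduleE(1)[OF C])

lemma basis_in_C: "B \<subseteq> C"
  using C.basis_subset[OF B] by simp

lemma mem_coset:
  assumes "b \<in> carrier Q" "x \<in> b"
  shows "x \<in> A" "H +>\<^bsub>M\<^esub> x = b"
proof -
  obtain a where a: "a \<in> A" "b = H +>\<^bsub>M\<^esub> a" using assms(1) by (rule carrier_QE)
  have ac: "a \<in> carrier M" using a A_carrier by auto
  have xa: "x \<in> carrier M" "x \<ominus>\<^bsub>M\<^esub> a \<in> H"
    using assms(2) M.a_rcos_iff[OF H_subgroup ac] a by auto
  then have "x \<ominus>\<^bsub>M\<^esub> a \<oplus>\<^bsub>M\<^esub> a \<in> A"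
    using HA a by (intro additive_subgroup.a_closed[OF A_subgroup]) auto
  then show "x \<in> A" using xa ac by (simp add: M.diff_add_cancel)
  show "H +>\<^bsub>M\<^esub> x = b" using M.coset_eq_iff[OF H_subgroup xa(1) ac] xa(2) a(2) by simp
qed

lemma lift_mem: "b \<in> B \<Longrightarrow> s b \<in> A" and lift_coset: "b \<in> B \<Longrightarrow> H +>\<^bsub>M\<^esub> s b = b"
  using mem_coset[OF _ s] basis_in_C C_carrier by blast+

lemma coset_lin_comb:
  assumes c: "c \<in> B \<rightarrow> carrier R"
  shows "H +>\<^bsub>M\<^esub> (\<Oplus>\<^bsub>M\<^esub>b\<in>B. c b \<odot>\<^bsub>M\<^esub> s b) = (\<Oplus>\<^bsub>Q\<lparr>carrier := C\<rparr>\<^esub>b\<in>B. c b \<odot>\<^bsub>Q\<lparr>carrier := C\<rparr>\<^esub> b)"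
proof -
  have "H +>\<^bsub>M\<^esub> (\<Oplus>\<^bsub>M\<^esub>b\<in>B. c b \<odot>\<^bsub>M\<^esub> s b) = (\<Oplus>\<^bsub>Q\<^esub>b\<in>B. H +>\<^bsub>M\<^esub> (c b \<odot>\<^bsub>M\<^esub> s b))"
    using c lift_mem submoduleE(4)[OF A] by (intro coset_finsum) (auto simp: Pi_iff)
  also have "\<dots> = (\<Oplus>\<^bsub>Q\<^esub>b\<in>B. c b \<odot>\<^bsub>Q\<^esub> b)"
  proof (rule Q.M.finsum_cong'[OF refl])
    show cb: "(\<lambda>b. c b \<odot>\<^bsub>Q\<^esub> b) \<in> B \<rightarrow> carrier Q"
      using c basis_in_C C_carrier by (intro Pi_I Q.smult_closed) (auto simp: Pi_iff)
    fix b assume b: "b \<in> B"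
    then have "s b \<in> carrier M" "c b \<in> carrier R" using lift_mem A_carrier c by (auto simp: Pi_iff)
    then show "H +>\<^bsub>M\<^esub> (c b \<odot>\<^bsub>M\<^esub> s b) = c b \<odot>\<^bsub>Q\<^esub> b"
      using coset_smult[of "c b" "s b"] lift_coset[OF b] by simp
  qed
  also have "\<dots> = (\<Oplus>\<^bsub>Q\<lparr>carrier := C\<rparr>\<^esub>b\<in>B. c b \<odot>\<^bsub>Q\<^esub> b)"
    using c basis_in_C Q.submoduleE(4)[OF C] by (intro Q.finsum_submodule[OF C, symmetric]) (auto simp: Pi_iff)
  finally show ?thesis by simp
qed

lemma lift_span_Int: "lin_span s B \<inter> H \<subseteq> {\<zero>\<^bsub>M\<^esub>}"
proof
  fix u assume u: "u \<in> lin_span s B \<inter> H"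
  then obtain c where c: "c \<in> B \<rightarrow> carrier R" and uc: "u = (\<Oplus>\<^bsub>M\<^esub>b\<in>B. c b \<odot>\<^bsub>M\<^esub> s b)"
    by (auto simp: lin_span_def)
  have "u \<in> carrier M" using u HA A_carrier by blast
  then have "H +>\<^bsub>M\<^esub> u = H" using coset_eq_H_iff u by simp
  then have "(\<Oplus>\<^bsub>Q\<lparr>carrier := C\<rparr>\<^esub>b\<in>B. c b \<odot>\<^bsub>Q\<lparr>carrier := C\<rparr>\<^esub> b) = \<zero>\<^bsub>Q\<lparr>carrier := C\<rparr>\<^esub>"
    using coset_lin_comb[OF c] uc zero_Q by simp
  from C.basis_independent[OF B fin subset_refl c this] have c0: "c b = \<zero>" if "b \<in> B" for b
    using that by blast
  have "u = (\<Oplus>\<^bsub>M\<^esub>b\<in>B. \<zero>\<^bsub>M\<^esub>)"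
    unfolding uc using c0 lift_mem A_carrier by (intro M.finsum_cong') (auto simp: subset_iff)
  then show "u \<in> {\<zero>\<^bsub>M\<^esub>}" by simp
qed

lemma lift_span_add: "lin_span s B <+>\<^bsub>M\<^esub> H = \<Union>C"
proof -
  have sA: "s \<in> B \<rightarrow> A" using lift_mem by blast
  have UA: "lin_span s B \<subseteq> A" by (rule lin_span_least[OF A sA])
  show ?thesis
  proof
    show "lin_span s B <+>\<^bsub>M\<^esub> H \<subseteq> \<Union>C"
    proof
      fix x assume "x \<in> lin_span s B <+>\<^bsub>M\<^esub> H"
      then obtain u h where u: "u \<in> lin_span s B" and h: "h \<in> H" and x: "x = u \<oplus>\<^bsub>M\<^esub> h"
        by (auto simp: M.set_add_iff)
      obtain c where c: "c \<in> B \<rightarrow> carrier R" and uc: "u = (\<Oplus>\<^bsub>M\<^esub>b\<in>B. c b \<odot>\<^bsub>M\<^esub> s b)"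
        using u by (auto simp: lin_span_def)
      have carr: "u \<in> carrier M" "h \<in> carrier M" using u UA h HA A_carrier by blast+
      have xA: "x \<in> A" unfolding x
        using u UA h HA by (intro additive_subgroup.a_closed[OF A_subgroup]) auto
      have "x \<ominus>\<^bsub>M\<^esub> u = h" using carr by (simp add: x M.add_diff_cancel_left')
      then have "H +>\<^bsub>M\<^esub> x = H +>\<^bsub>M\<^esub> u" using M.coset_eq_iff[OF H_subgroup, of x u] carr h x by simp
      also have "\<dots> = (\<Oplus>\<^bsub>Q\<lparr>carrier := C\<rparr>\<^esub>b\<in>B. c b \<odot>\<^bsub>Q\<lparr>carrier := C\<rparr>\<^esub> b)"
        unfolding uc by (rule coset_lin_comb[OF c])
      also have "\<dots> \<in> carrier (Q\<lparr>carrier := C\<rparr>)"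
        using c C.basis_subset[OF B] by (intro C.M.finsum_closed) (auto simp: Pi_iff subset_iff intro!: C.smult_closed[simplified])
      finally show "x \<in> \<Union>C" using coset_self[OF xA] by auto
    qed
    show "\<Union>C \<subseteq> lin_span s B <+>\<^bsub>M\<^esub> H"
    proof
      fix x assume "x \<in> \<Union>C"
      then obtain b where b: "b \<in> C" "x \<in> b" by blast
      obtain c where c: "c \<in> B \<rightarrow> carrier R"
        and bc: "b = (\<Oplus>\<^bsub>Q\<lparr>carrier := C\<rparr>\<^esub>b\<in>B. c b \<odot>\<^bsub>Q\<lparr>carrier := C\<rparr>\<^esub> b)"
        using C.basis_span[OF B fin, of b] b by auto
      define u where "u = (\<Oplus>\<^bsub>M\<^esub>b\<in>B. c b \<odot>\<^bsub>M\<^esub> s b)"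
      have u: "u \<in> lin_span s B" using c by (auto simp: lin_span_def u_def)
      have uc: "u \<in> carrier M" using u UA A_carrier by blast
      have "b = H +>\<^bsub>M\<^esub> u" unfolding u_def coset_lin_comb[OF c] by (rule bc)
      then have "x \<in> carrier M \<and> x \<ominus>\<^bsub>M\<^esub> u \<in> H" using b(2) M.a_rcos_iff[OF H_subgroup uc] by simp
      moreover from this have "x = u \<oplus>\<^bsub>M\<^esub> (x \<ominus>\<^bsub>M\<^esub> u)"
        using uc M.diff_add_cancel[of x u] by (simp add: M.a_comm)
      ultimately show "x \<in> lin_span s B <+>\<^bsub>M\<^esub> H" unfolding M.set_add_iff using u by blast
    qed
  qed
qed

end

end

section \<open>Counting adapted submodules\<close>

text \<open>The boxes \<open>PiE I (Y' S)\<close> partition the box \<open>PiE I X'\<close> and all have the same size. Here \<open>I\<close> is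
  the set of all basis elements, the points of the large box are families of lifts up to a small
  subgroup, and the small boxes are the families of lifts lying in \<open>S\<close>.\<close>

lemma card_partition_PiE:
  assumes finI: "finite I" and finX: "\<And>j. j \<in> I \<Longrightarrow> finite (X' j)"
    and sub: "\<And>S j. S \<in> \<S> \<Longrightarrow> j \<in> I \<Longrightarrow> Y' S j \<subseteq> X' j"
    and card: "\<And>S j. S \<in> \<S> \<Longrightarrow> j \<in> I \<Longrightarrow> card (Y' S j) = m j"
    and pos: "\<And>j. j \<in> I \<Longrightarrow> m j > 0"
    and ex: "\<And>w. w \<in> PiE I X' \<Longrightarrow> \<exists>S\<in>\<S>. w \<in> PiE I (Y' S)"
    and unique: "\<And>S S' w. S \<in> \<S> \<Longrightarrow> S' \<in> \<S> \<Longrightarrow> w \<in> PiE I (Y' S) \<Longrightarrow> w \<in> PiE I (Y' S') \<Longrightarrow> S = S'"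
  shows "finite \<S> \<and> card \<S> * (\<Prod>j\<in>I. m j) = (\<Prod>j\<in>I. card (X' j))"
proof -
  have fin: "finite (PiE I X')" using finI finX by (rule finite_PiE)
  have YX: "PiE I (Y' S) \<subseteq> PiE I X'" if "S \<in> \<S>" for S
    using sub[OF that] by (intro PiE_mono) auto
  have ne: "PiE I (Y' S) \<noteq> {}" if "S \<in> \<S>" for S
  proof -
    have "Y' S j \<noteq> {}" if "j \<in> I" for j using card[OF \<open>S \<in> \<S>\<close> that] pos[OF that] by auto
    then show ?thesis by (simp add: PiE_eq_empty_iff)
  qed
  have inj: "inj_on (\<lambda>S. PiE I (Y' S)) \<S>"
  proof (rule inj_onI)
    fix S S' assume *: "S \<in> \<S>" "S' \<in> \<S>" "PiE I (Y' S) = PiE I (Y' S')"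
    obtain w where w: "w \<in> PiE I (Y' S)" using ne[OF *(1)] by blast
    show "S = S'" by (rule unique[OF *(1,2) w]) (use w * in simp)
  qed
  have "(\<lambda>S. PiE I (Y' S)) ` \<S> \<subseteq> Pow (PiE I X')" using YX by blast
  then have "finite ((\<lambda>S. PiE I (Y' S)) ` \<S>)" using fin by (simp add: finite_subset)
  then have finS: "finite \<S>" using inj by (rule finite_imageD)
  have "PiE I X' = (\<Union>S\<in>\<S>. PiE I (Y' S))"
  proof (intro subset_antisym subsetI)
    show "w \<in> (\<Union>S\<in>\<S>. PiE I (Y' S))" if "w \<in> PiE I X'" for w
      using ex[OF that] by (simp only: UN_iff)
    show "w \<in> PiE I X'" if "w \<in> (\<Union>S\<in>\<S>. PiE I (Y' S))" for w
      using that YX by (elim UN_E) (rule subsetD)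
  qed
  then have "card (PiE I X') = (\<Sum>S\<in>\<S>. card (PiE I (Y' S)))"
  proof (simp only:, intro card_UN_disjoint ballI impI finS)
    show "finite (PiE I (Y' S))" if "S \<in> \<S>" for S
      by (rule finite_subset[OF YX[OF that] fin])
    show "PiE I (Y' S) \<inter> PiE I (Y' S') = {}" if "S \<in> \<S>" "S' \<in> \<S>" "S \<noteq> S'" for S S'
      using unique[OF that(1,2)] that(3) by (meson disjoint_iff)
  qed
  also have "\<dots> = (\<Sum>S\<in>\<S>. \<Prod>j\<in>I. m j)"
    using card by (intro sum.cong refl) (simp add: card_PiE[OF finI])
  finally show ?thesis using finS by (simp add: card_PiE[OF finI])
qed

locale nilpotent_module = module R M + nilpotent_endo M y l
  for R (structure) and M (structure) and y l +
  assumes y_smult: "r \<in> carrier R \<Longrightarrow> x \<in> carrier M \<Longrightarrow> y (r \<odot>\<^bsub>M\<^esub> x) = r \<odot>\<^bsub>M\<^esub> y x"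
begin

lemma K_submodule: "submodule (K i) R M"
proof -
  have y: "(y ^^ i) (r \<odot>\<^bsub>M\<^esub> x) = r \<odot>\<^bsub>M\<^esub> (y ^^ i) x" if "r \<in> carrier R" "x \<in> carrier M" for r x
    using that by (induction i) (auto simp: y_smult)
  show ?thesis
    using K_subgroup[of i] unfolding submodule_def submodule_axioms_def additive_subgroup_def
    by (auto simp: K_def y)
qed

lemma submodule_subgroup: "submodule S R M \<Longrightarrow> additive_subgroup S M"
  by (simp add: submodule_def additive_subgroup_def)

lemma LS_submodule:
  assumes S: "submodule S R M"
  shows "submodule (LS S i) R M"
proof -
  have "r \<odot>\<^bsub>M\<^esub> x \<in> LS S i" if r: "r \<in> carrier R" and x: "x \<in> LS S i" for r x
  proof -
    obtain a b where a: "a \<in> S \<inter> K (i + 1)" and b: "b \<in> S \<inter> K (i - 1)" and xab: "x = y a \<oplus>\<^bsub>M\<^esub> b"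
      using x by (auto simp: LS_iff)
    have c: "a \<in> carrier M" "b \<in> carrier M" using a b K_carrier by auto
    have "r \<odot>\<^bsub>M\<^esub> x = y (r \<odot>\<^bsub>M\<^esub> a) \<oplus>\<^bsub>M\<^esub> r \<odot>\<^bsub>M\<^esub> b"
      using c r by (simp add: xab smult_r_distr y_smult)
    moreover have "r \<odot>\<^bsub>M\<^esub> a \<in> S \<inter> K (i + 1)" "r \<odot>\<^bsub>M\<^esub> b \<in> S \<inter> K (i - 1)"
      using a b submoduleE(4)[OF S r] submoduleE(4)[OF K_submodule r] by auto
    ultimately show ?thesis unfolding LS_iff by blast
  qed
  then show ?thesis
    using LS_subgroup[OF submodule_subgroup[OF S]]
    unfolding submodule_def submodule_axioms_def additive_subgroup_def by auto
qed

lemma L_submodule: "submodule (L i) R M"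
  by (rule LS_submodule[OF carrier_is_submodule])

lemma Int_K_submodule:
  assumes S: "submodule S R M"
  shows "submodule (S \<inter> K i) R M"
proof -
  have "additive_subgroup (S \<inter> K i) M"
    by (intro additive_subgroup_Int submodule_subgroup S K_submodule)
  moreover have "r \<odot>\<^bsub>M\<^esub> x \<in> S \<inter> K i" if "r \<in> carrier R" "x \<in> S \<inter> K i" for r x
    using submoduleE(4)[OF S that(1)] submoduleE(4)[OF K_submodule that(1)] that(2) by blast
  ultimately show ?thesis
    unfolding submodule_def submodule_axioms_def additive_subgroup_def by blast
qed

abbreviation QM :: "nat \<Rightarrow> ('a, 'c set) module" where
  "QM i \<equiv> quot_module (\<lambda>r. r) (M\<lparr>carrier := K i\<rparr>) (L i)"

lemma L_subset_K: "i \<in> {1..l} \<Longrightarrow> L i \<subseteq> K i"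
  using LS_subset_K[OF carrier_subgroup, of i] by simp

lemma sub_quotient_L: "i \<in> {1..l} \<Longrightarrow> sub_quotient R M (K i) (L i)"
  by (intro sub_quotient.intro sub_quotient_axioms.intro module_axioms K_submodule L_submodule L_subset_K)

definition adapted_submodules :: "(nat \<Rightarrow> 'c set set) \<Rightarrow> 'c set set" where
  "adapted_submodules C = {S. submodule S R M \<and> adapted (\<lambda>i. \<Union>(C i)) S}"

context
  fixes C B :: "nat \<Rightarrow> 'c set set"
  assumes C: "\<And>i. i \<in> {1..l} \<Longrightarrow> submodule (C i) R (QM i)"
    and B: "\<And>i. i \<in> {1..l} \<Longrightarrow> basis_of R ((QM i)\<lparr>carrier := C i\<rparr>) (B i)"
    and finB: "\<And>i. i \<in> {1..l} \<Longrightarrow> finite (B i)"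
    and pos: "\<And>i. i \<in> {1..l} \<Longrightarrow> a_index M (K i) (\<Union>(C i)) > 0"
begin

text \<open>The submodule generated by the lifts is contained in every adapted submodule that contains the
  lifts, and therefore equal to it by equality of the indices.\<close>

lemma unique_adapted_of_lifts:
  assumes s: "\<And>i b. i \<in> {1..l} \<Longrightarrow> b \<in> B i \<Longrightarrow> s (i, b) \<in> b"
  obtains S where "S \<in> adapted_submodules C" "\<And>i b. i \<in> {1..l} \<Longrightarrow> b \<in> B i \<Longrightarrow> s (i, b) \<in> S"
    "\<And>S'. S' \<in> adapted_submodules C \<Longrightarrow> (\<And>i b. i \<in> {1..l} \<Longrightarrow> b \<in> B i \<Longrightarrow> s (i, b) \<in> S') \<Longrightarrow> S' = S"
proof -
  define U where "U i = lin_span (\<lambda>b. s (i, b)) (B i)" for i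
  let ?Rh = "\<lambda>i. \<Union>(C i)"
  have sK: "s (i, b) \<in> K i" if "i \<in> {1..l}" "b \<in> B i" for i b
    by (rule sub_quotient.lift_mem[OF sub_quotient_L[OF that(1)] C[OF that(1)] B[OF that(1)] finB[OF that(1)]
        s[OF that(1)] that(2)])
  have sc: "(\<lambda>b. s (i, b)) \<in> B i \<rightarrow> carrier M" if "i \<in> {1..l}" for i
    using sK[OF that] K_carrier by blast
  have Usub: "submodule (U i) R M" if "i \<in> {1..l}" for i
    unfolding U_def by (rule lin_span_submodule[OF finB[OF that] sc[OF that]])
  note hyps = submodule_subgroup[OF Usub]
  have UK: "U i \<subseteq> K i" if "i \<in> {1..l}" for i
    unfolding U_def by (rule lin_span_least[OF K_submodule]) (use sK[OF that] in blast)
  have UL: "U i \<inter> L i \<subseteq> {\<zero>\<^bsub>M\<^esub>}" if "i \<in> {1..l}" for i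
    unfolding U_def
    by (rule sub_quotient.lift_span_Int[OF sub_quotient_L[OF that] C[OF that] B[OF that] finB[OF that] s[OF that]])
  have UR: "U i <+>\<^bsub>M\<^esub> L i = ?Rh i" if "i \<in> {1..l}" for i
    unfolding U_def
    by (rule sub_quotient.lift_span_add[OF sub_quotient_L[OF that] C[OF that] B[OF that] finB[OF that] s[OF that]])
  let ?S = "gen U l"
  have ad: "adapted ?Rh ?S" by (rule gen_adapted[OF hyps UK UL UR])
  have "r \<odot>\<^bsub>M\<^esub> x \<in> ?S" if r: "r \<in> carrier R" and x: "x \<in> ?S" for r x
  proof -
    have "(\<lambda>x. r \<odot>\<^bsub>M\<^esub> x) ` gen U l \<subseteq> gen U l"
    proof (rule gen_invariant[OF hyps UK UL UR])
      show "(\<lambda>x. r \<odot>\<^bsub>M\<^esub> x) ` U i \<subseteq> U i" if "i \<in> {1..l}" for i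
        using submoduleE(4)[OF Usub[OF that] r] by blast
    qed (use r in \<open>simp_all add: smult_r_distr y_smult\<close>)
    then show ?thesis using x by blast
  qed
  then have "submodule ?S R M"
    using ad unfolding adapted_def submodule_def submodule_axioms_def additive_subgroup_def by blast
  then have S: "?S \<in> adapted_submodules C" using ad by (simp add: adapted_submodules_def)
  have sU: "s (i, b) \<in> U i" if "i \<in> {1..l}" "b \<in> B i" for i b
    unfolding U_def by (rule lin_span_base[OF finB[OF that(1)] sc[OF that(1)] that(2)])
  have "s (i, b) \<in> ?S" if "i \<in> {1..l}" "b \<in> B i" for i b
    using U_gen[OF hyps UK UL UR, of i] sU[OF that] that(1) by blast
  moreover have "S' = ?S" if S': "S' \<in> adapted_submodules C"
    and s': "\<And>i b. i \<in> {1..l} \<Longrightarrow> b \<in> B i \<Longrightarrow> s (i, b) \<in> S'" for S'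
  proof -
    have m: "submodule S' R M" and a: "adapted ?Rh S'" using S' by (auto simp: adapted_submodules_def)
    have "U i \<subseteq> S'" if "i \<in> {1..l}" for i
      unfolding U_def by (rule lin_span_least[OF m]) (use s'[OF that] in blast)
    then have "?S \<subseteq> S'" using a by (intro gen_least[OF hyps UK UL UR]) (auto simp: adapted_def)
    from adapted_eq[OF a ad this] pos show ?thesis by simp
  qed
  ultimately show thesis using that[OF S] by blast
qed

text \<open>As \<open>R\<^sub>i\<close> is the image of \<open>Q\<^sub>i(S)\<close>, the coset \<open>b\<close> contains some \<open>x \<in> K\<^sub>i(S)\<close>; the other elements of
  \<open>b \<inter> S\<close> differ from \<open>x\<close> by elements of \<open>L\<^sub>i(M) \<inter> K\<^sub>i(S) = L\<^sub>i(S)\<close>.\<close>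

lemma coset_Int_adapted:
  assumes S: "S \<in> adapted_submodules C" and i: "i \<in> {1..l}" and b: "b \<in> B i"
  obtains x where "x \<in> carrier M" "b \<inter> S = LS S i +>\<^bsub>M\<^esub> x" "b = L i +>\<^bsub>M\<^esub> x"
proof -
  interpret q: sub_quotient R M "K i" "L i" by (rule sub_quotient_L[OF i])
  have m: "submodule S R M" and ad: "adapted (\<lambda>i. \<Union>(C i)) S" using S by (auto simp: adapted_submodules_def)
  have Ssub: "additive_subgroup S M" by (rule submodule_subgroup[OF m])
  have Rh: "(S \<inter> K i) <+>\<^bsub>M\<^esub> L i = \<Union>(C i)" using ad i by (simp add: adapted_def)
  have bC: "b \<in> C i" using module.basis_subset[OF submodule.submodule_is_module[OF C[OF i] q.Q_module] B[OF i]] b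
    by auto
  then have bQ: "b \<in> carrier (QM i)" using module.submoduleE(1)[OF q.Q_module C[OF i]] by blast
  then obtain a where a: "a \<in> K i" "b = L i +>\<^bsub>M\<^esub> a" by (rule q.carrier_QE)
  have ac: "a \<in> carrier M" using a K_carrier by auto
  have "a \<in> L i +>\<^bsub>M\<^esub> a"
    using additive_subgroup.zero_closed[OF L_subgroup] ac
    by (simp add: M.a_rcos_iff[OF L_subgroup] a_minus_def M.r_neg)
  then have "a \<in> (S \<inter> K i) <+>\<^bsub>M\<^esub> L i" unfolding Rh using bC a(2) by blast
  then obtain x u where x: "x \<in> S \<inter> K i" and u: "u \<in> L i" and axu: "a = x \<oplus>\<^bsub>M\<^esub> u"
    unfolding M.set_add_iff by blast
  have c: "x \<in> carrier M" "u \<in> carrier M" using x u K_carrier additive_subgroup.a_Hcarr[OF L_subgroup] by auto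
  have "a \<ominus>\<^bsub>M\<^esub> x = u" using c by (simp add: axu M.add_diff_cancel_left')
  then have bx: "b = L i +>\<^bsub>M\<^esub> x" using M.coset_eq_iff[OF L_subgroup ac c(1)] u a(2) by simp
  have "z \<ominus>\<^bsub>M\<^esub> x \<in> LS S i \<longleftrightarrow> z \<ominus>\<^bsub>M\<^esub> x \<in> L i \<and> z \<in> S" if z: "z \<in> carrier M" for z
  proof -
    have "z \<in> S \<longleftrightarrow> z \<ominus>\<^bsub>M\<^esub> x \<in> S"
      using x additive_subgroup.a_closed[OF Ssub, of "z \<ominus>\<^bsub>M\<^esub> x" x]
        M.additive_subgroup_minus[OF Ssub, of z x] z c by (auto simp: M.diff_add_cancel)
    then show ?thesis unfolding adapted_Int_L[OF ad i, symmetric] using L_subset_K[OF i] by blast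
  qed
  then have "b \<inter> S = LS S i +>\<^bsub>M\<^esub> x"
    unfolding bx using M.a_rcos_iff[OF L_subgroup c(1)] M.a_rcos_iff[OF LS_subgroup[OF Ssub] c(1)]
    by blast
  then show thesis using that c(1) bx by blast
qed

text \<open>There are infinitely many families of lifts in general, so they are counted modulo
  \<open>D\<^sub>i = e\<^sub>i! L\<^sub>i(M)\<close>. This is contained in \<open>L\<^sub>i(S)\<close> for all adapted \<open>S\<close>, as \<open>L\<^sub>i(S)\<close> has index \<open>e\<^sub>i\<close> in \<open>L\<^sub>i(M)\<close>,
  and it has finite index \<open>n\<^sub>i\<close> in \<open>L\<^sub>i(M)\<close>. Each basis element in \<open>B\<^sub>i\<close> has \<open>n\<^sub>i\<close> lifts modulo \<open>D\<^sub>i\<close>, and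
  \<open>n\<^sub>i / e\<^sub>i\<close> of them lie in a given \<open>S\<close>.\<close>

lemma card_adapted_submodules:
  assumes fg: "\<And>i n. i \<in> {1..l} \<Longrightarrow> n > 0 \<Longrightarrow> a_index M (L i) ((\<lambda>x. add_pow M (n::nat) x) ` L i) > 0"
    and e: "\<And>i. i \<in> {1..l} \<Longrightarrow> a_index M (K i) (\<Union>(C i)) * e i =
      (\<Prod>k=1..i. \<Prod>j=k..l. a_index M (K j) (\<Union>(C j)))"
  shows "finite (adapted_submodules C)"
    and "card (adapted_submodules C) = (\<Prod>i=1..l. e i ^ card (B i))"
proof -
  have idx: "a_index M (L i) (LS S i) = e i" if S: "S \<in> adapted_submodules C" and i: "i \<in> {1..l}" for S i
  proof -
    have "a_index M (K i) (\<Union>(C i)) * a_index M (L i) (LS S i) = a_index M (K i) (\<Union>(C i)) * e i"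
      unfolding e[OF i] using index_L[of "\<lambda>i. \<Union>(C i)" S i] S i by (simp add: adapted_submodules_def)
    then show ?thesis using pos[OF i] by (simp only: mult_left_cancel)
  qed
  have epos: "e i > 0" if i: "i \<in> {1..l}" for i
  proof -
    have "(\<Prod>k=1..i. \<Prod>j=k..l. a_index M (K j) (\<Union>(C j))) > 0" using pos i by (intro prod_pos) auto
    then show ?thesis using e[OF i] by (metis gr0I mult_0_right)
  qed
  define D where "D i = (\<lambda>x. add_pow M (fact (e i) :: nat) x) ` L i" for i
  have D: "additive_subgroup (D i) M" for i unfolding D_def by (rule M.add_pow_subgroup[OF L_subgroup])
  have LSsub: "additive_subgroup (LS S i) M" if "S \<in> adapted_submodules C" for S i
    using that by (intro LS_subgroup) (auto simp: adapted_submodules_def adapted_def)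
  have LSL: "LS S i \<subseteq> L i" if "S \<in> adapted_submodules C" for S i
    using that additive_subgroup.a_subset
    by (intro LS_mono) (auto simp: adapted_submodules_def adapted_def)
  have DLS: "D i \<subseteq> LS S i" if S: "S \<in> adapted_submodules C" and i: "i \<in> {1..l}" for S i
    using M.fact_index_multiple[OF L_subgroup LSsub[OF S], of i i] idx[OF S i] epos[OF i] by (auto simp: D_def)
  define n where "n i = a_index M (L i) (D i)" for i
  have npos: "n i > 0" if "i \<in> {1..l}" for i unfolding n_def D_def using fg[OF that] by simp
  have n: "n i = e i * a_index M (LS S i) (D i)" if S: "S \<in> adapted_submodules C" and i: "i \<in> {1..l}" for S i
    unfolding n_def idx[OF S i, symmetric]
    by (rule M.a_index_tower[OF L_subgroup LSsub[OF S] D DLS[OF S i] LSL[OF S]])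
  define I where "I = (SIGMA i:{1..l}. B i)"
  have finI: "finite I" unfolding I_def by (intro finite_SigmaI finB) simp
  define X' where "X' = (\<lambda>(i, b). (\<lambda>x. D i +>\<^bsub>M\<^esub> x) ` b)"
  define Y' where "Y' S = (\<lambda>(i, b). (\<lambda>x. D i +>\<^bsub>M\<^esub> x) ` (b \<inter> S))" for S
  define m where "m = (\<lambda>(i, b :: 'c set). n i div e i)"
  have bL: "\<exists>x\<in>carrier M. b = L i +>\<^bsub>M\<^esub> x" if i: "i \<in> {1..l}" and b: "b \<in> B i" for i b
  proof -
    interpret q: sub_quotient R M "K i" "L i" by (rule sub_quotient_L[OF i])
    have "b \<in> C i" using module.basis_subset[OF submodule.submodule_is_module[OF C[OF i] q.Q_module] B[OF i]] b
      by auto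
    then have "b \<in> carrier (QM i)" using module.submoduleE(1)[OF q.Q_module C[OF i]] by blast
    then obtain a where "a \<in> K i" "b = L i +>\<^bsub>M\<^esub> a" by (rule q.carrier_QE)
    then show ?thesis using K_carrier by blast
  qed
  have cardX: "card (X' (i, b)) = n i" if i: "i \<in> {1..l}" and b: "b \<in> B i" for i b
    using bL[OF that] M.card_cosets_of_coset[OF L_subgroup D] by (auto simp: X'_def n_def)
  have selfc: "x \<in> D i +>\<^bsub>M\<^esub> x" if "x \<in> carrier M" for x i
    using that additive_subgroup.zero_closed[OF D, of i]
    by (simp add: M.a_rcos_iff[OF D] a_minus_def M.r_neg)
  have bc: "b \<subseteq> carrier M" if "i \<in> {1..l}" "b \<in> B i" for i b
    using bL[OF that] M.a_rcos_iff[OF L_subgroup] by auto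
  have DL: "D i \<subseteq> L i" for i
    using M.add_pow_mem[OF L_subgroup] by (auto simp: D_def)
  have some: "(SOME x. x \<in> b') \<in> b'" if i': "i' \<in> {1..l}" and b': "b' \<in> B i'" for i' b'
  proof -
    obtain x where "x \<in> carrier M" "b' = L i' +>\<^bsub>M\<^esub> x" using bL[OF i' b'] by blast
    then have "x \<in> b'" using additive_subgroup.zero_closed[OF L_subgroup, of i']
      by (simp add: M.a_rcos_iff[OF L_subgroup] a_minus_def M.r_neg)
    then show ?thesis by (rule someI)
  qed
  \<comment> \<open>Some family of lifts exists, so there is at least one adapted submodule.\<close>
  define s0 where "s0 = (\<lambda>j :: nat \<times> 'c set. SOME x. x \<in> snd j)"
  have "s0 (i, b) \<in> b" if "i \<in> {1..l}" "b \<in> B i" for i b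
    using some[OF that] by (simp add: s0_def)
  then obtain S0 where S0: "S0 \<in> adapted_submodules C"
    using unique_adapted_of_lifts[of s0] by metis
  have *: "finite (adapted_submodules C) \<and>
    card (adapted_submodules C) * (\<Prod>j\<in>I. m j) = (\<Prod>j\<in>I. card (X' j))"
  proof (rule card_partition_PiE[OF finI, of X' "adapted_submodules C" Y' m])
    fix j assume "j \<in> I"
    then obtain i b where j: "j = (i, b)" "i \<in> {1..l}" "b \<in> B i" by (auto simp: I_def)
    show "finite (X' j)" using cardX[OF j(2,3)] npos[OF j(2)] j(1) by (metis card_gt_0_iff)
  next
    fix S j assume S: "S \<in> adapted_submodules C" and "j \<in> I"
    then obtain i b where j: "j = (i, b)" "i \<in> {1..l}" "b \<in> B i" by (auto simp: I_def)
    show "Y' S j \<subseteq> X' j" by (auto simp: j(1) X'_def Y'_def)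
    obtain x where x: "x \<in> carrier M" "b \<inter> S = LS S i +>\<^bsub>M\<^esub> x" "b = L i +>\<^bsub>M\<^esub> x"
      using coset_Int_adapted[OF S j(2,3)] .
    have "card (Y' S j) = a_index M (LS S i) (D i)"
      using M.card_cosets_of_coset[OF LSsub[OF S] D x(1)] x(2) by (simp add: j(1) Y'_def)
    then show "card (Y' S j) = m j" using n[OF S j(2)] epos[OF j(2)] by (simp add: m_def j(1))
  next
    fix w assume w: "w \<in> PiE I X'"
    have "\<forall>j\<in>I. \<exists>x. x \<in> snd j \<and> w j = D (fst j) +>\<^bsub>M\<^esub> x"
      using w by (fastforce simp: PiE_iff X'_def)
    then obtain s where s: "\<And>j. j \<in> I \<Longrightarrow> s j \<in> snd j \<and> w j = D (fst j) +>\<^bsub>M\<^esub> s j" by metis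
    have "s (i, b) \<in> b" if "i \<in> {1..l}" "b \<in> B i" for i b using s[of "(i, b)"] that by (simp add: I_def)
    then obtain S where S: "S \<in> adapted_submodules C"
      and sS: "\<And>i b. i \<in> {1..l} \<Longrightarrow> b \<in> B i \<Longrightarrow> s (i, b) \<in> S"
      using unique_adapted_of_lifts[of s] by metis
    have "w j \<in> Y' S j" if "j \<in> I" for j
      using s[OF that] sS that by (auto simp: Y'_def I_def split: prod.splits)
    then have "w \<in> PiE I (Y' S)" using w by (auto simp: PiE_iff)
    then show "\<exists>S\<in>adapted_submodules C. w \<in> PiE I (Y' S)" using S by blast
  next
    fix S S' w assume S: "S \<in> adapted_submodules C" and S': "S' \<in> adapted_submodules C"
      and w: "w \<in> PiE I (Y' S)" "w \<in> PiE I (Y' S')"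
    have "\<forall>j\<in>I. \<exists>x. x \<in> snd j \<inter> S \<and> w j = D (fst j) +>\<^bsub>M\<^esub> x"
      using w(1) by (fastforce simp: PiE_iff Y'_def)
    then obtain s where s: "\<And>j. j \<in> I \<Longrightarrow> s j \<in> snd j \<inter> S \<and> w j = D (fst j) +>\<^bsub>M\<^esub> s j" by metis
    have sS': "s (i, b) \<in> S'" if i: "i \<in> {1..l}" and b: "b \<in> B i" for i b
    proof -
      have j: "(i, b) \<in> I" using i b by (simp add: I_def)
      have sb: "s (i, b) \<in> b" "w (i, b) = D i +>\<^bsub>M\<^esub> s (i, b)" using s[OF j] by auto
      have sc: "s (i, b) \<in> carrier M" using sb bc[OF i b] by blast
      have "w (i, b) \<in> Y' S' (i, b)" using w(2) j by (auto simp: PiE_iff)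
      then obtain x where x: "x \<in> b \<inter> S'" "w (i, b) = D i +>\<^bsub>M\<^esub> x" by (auto simp: Y'_def)
      have xc: "x \<in> carrier M" using x bc[OF i b] by blast
      have "s (i, b) \<in> D i +>\<^bsub>M\<^esub> x" using selfc[OF sc, of i] sb x by simp
      then obtain d where d: "d \<in> D i" "s (i, b) = d \<oplus>\<^bsub>M\<^esub> x" by (auto simp: a_r_coset_def')
      have ad: "additive_subgroup S' M" "y ` S' \<subseteq> S'"
        using S' by (auto simp: adapted_submodules_def adapted_def)
      have "d \<in> S'" using d(1) DLS[OF S' i] LS_subset[OF ad] by blast
      then show ?thesis using d(2) x additive_subgroup.a_closed[OF ad(1)] by simp
    qed
    have sb: "s (i, b) \<in> b" "s (i, b) \<in> S" if "i \<in> {1..l}" "b \<in> B i" for i b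
      using s[of "(i, b)"] that by (auto simp: I_def)
    obtain S0 where "\<And>S'. S' \<in> adapted_submodules C \<Longrightarrow>
        (\<And>i b. i \<in> {1..l} \<Longrightarrow> b \<in> B i \<Longrightarrow> s (i, b) \<in> S') \<Longrightarrow> S' = S0"
      using unique_adapted_of_lifts[of s] sb(1) by metis
    then show "S = S'" using S S' sb(2) sS' by metis
  next
    fix j assume jI: "j \<in> I"
    then obtain i b where j: "j = (i, b)" "i \<in> {1..l}" "b \<in> B i" by (auto simp: I_def)
    have "n i = e i * a_index M (LS S0 i) (D i)" by (rule n[OF S0 j(2)])
    then show "m j > 0" using npos[OF j(2)] epos[OF j(2)] by (auto simp: m_def j(1))
  qed
  show "finite (adapted_submodules C)" using * by blast
  show "card (adapted_submodules C) = (\<Prod>i=1..l. e i ^ card (B i))"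
  proof -
    have m: "m j > 0 \<and> card (X' j) = e (fst j) * m j" if jI: "j \<in> I" for j
    proof -
      obtain i b where j: "j = (i, b)" "i \<in> {1..l}" "b \<in> B i" using jI by (auto simp: I_def)
      show ?thesis using n[OF S0 j(2)] npos[OF j(2)] epos[OF j(2)] cardX[OF j(2,3)] by (auto simp: m_def j(1))
    qed
    have "card (adapted_submodules C) * (\<Prod>j\<in>I. m j) = (\<Prod>j\<in>I. e (fst j)) * (\<Prod>j\<in>I. m j)"
      unfolding conjunct2[OF *] prod.distrib[symmetric] using m by (intro prod.cong) auto
    moreover have "(\<Prod>j\<in>I. m j) > 0" using m by (intro prod_pos) auto
    ultimately have "card (adapted_submodules C) = (\<Prod>j\<in>I. e (fst j))" by simp
    also have "\<dots> = (\<Prod>i=1..l. \<Prod>b\<in>B i. e i)"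
      unfolding I_def using finB by (subst prod.Sigma) (auto simp: case_prod_unfold)
    finally show ?thesis by simp
  qed
qed

end

end

section \<open>Integral linear algebra and ranks\<close>

text \<open>Elimination without division: if some \<open>a p x\<close> is nonzero, the row \<open>p\<close> is used to clear the
  column \<open>x\<close> in the other rows.\<close>

lemma int_linear_relation:
  fixes a :: "'j \<Rightarrow> 'x \<Rightarrow> int"
  assumes "finite X'" "finite J" "card X' < card J"
  obtains c where "\<exists>j\<in>J. c j \<noteq> 0" "\<And>x. x \<in> X' \<Longrightarrow> (\<Sum>j\<in>J. c j * a j x) = 0"
proof -
  have "\<exists>c. (\<exists>j\<in>J. c j \<noteq> 0) \<and> (\<forall>x\<in>X'. (\<Sum>j\<in>J. c j * a j x) = 0)"
    using assms
  proof (induction X' arbitrary: J a rule: finite_induct)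
    case empty
    then have "J \<noteq> {}" by auto
    then show ?case by (intro exI[of _ "\<lambda>_. 1"]) auto
  next
    case (insert x Y)
    show ?case
    proof (cases "\<forall>j\<in>J. a j x = 0")
      case True
      obtain c where "\<exists>j\<in>J. c j \<noteq> 0" "\<forall>x\<in>Y. (\<Sum>j\<in>J. c j * a j x) = 0"
        using insert.IH[of J a] insert.prems insert.hyps by auto
      then show ?thesis using True by (intro exI[of _ c]) auto
    next
      case False
      then obtain p where p: "p \<in> J" "a p x \<noteq> 0" by blast
      let ?J = "J - {p}"
      have J: "J = insert p ?J" "finite ?J" "p \<notin> ?J" using p insert.prems by auto
      have "card Y < card ?J" using insert.prems insert.hyps p by simp
      then obtain c where c: "\<exists>j\<in>?J. c j \<noteq> 0"
        "\<And>z. z \<in> Y \<Longrightarrow> (\<Sum>j\<in>?J. c j * (a p x * a j z - a j x * a p z)) = 0"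
        using insert.IH[of ?J "\<lambda>j z. a p x * a j z - a j x * a p z"] J by blast
      define d where "d j = (if j = p then - (\<Sum>j\<in>?J. c j * a j x) else a p x * c j)" for j
      have d: "(\<Sum>j\<in>J. d j * a j z) = (\<Sum>j\<in>?J. c j * (a p x * a j z - a j x * a p z))" for z
      proof -
        have "(\<Sum>j\<in>J. d j * a j z) = d p * a p z + (\<Sum>j\<in>?J. d j * a j z)"
          by (subst J(1), subst sum.insert[OF J(2,3)]) simp
        also have "(\<Sum>j\<in>?J. d j * a j z) = (\<Sum>j\<in>?J. a p x * c j * a j z)"
          by (rule sum.cong) (auto simp: d_def)
        also have "d p * a p z = (\<Sum>j\<in>?J. - (c j * a j x * a p z))"
          by (simp add: d_def sum_distrib_right sum_negf)
        also have "(\<Sum>j\<in>?J. - (c j * a j x * a p z)) + (\<Sum>j\<in>?J. a p x * c j * a j z) =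
            (\<Sum>j\<in>?J. c j * (a p x * a j z - a j x * a p z))"
          by (subst sum.distrib[symmetric]) (auto intro!: sum.cong simp: algebra_simps)
        finally show ?thesis .
      qed
      have "(\<Sum>j\<in>J. d j * a j z) = 0" if "z \<in> insert x Y" for z
        using that unfolding d by (auto simp: c(2))
      moreover have "\<exists>j\<in>J. d j \<noteq> 0" using c(1) p by (auto simp: d_def)
      ultimately show ?thesis by blast
    qed
  qed
  then show thesis using that by blast
qed

lemma rat_common_denominator:
  assumes "finite F"
  obtains D :: int where "D \<noteq> 0" "\<And>x. x \<in> F \<Longrightarrow> \<exists>n :: int. of_int D * (x :: rat) = of_int n"
proof -
  have "\<exists>D :: int. D \<noteq> 0 \<and> (\<forall>x\<in>F. \<exists>n :: int. of_int D * (x :: rat) = of_int n)"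
    using assms
  proof (induction F)
    case empty then show ?case by (intro exI[of _ 1]) auto
  next
    case (insert x F)
    then obtain D :: int where D: "D \<noteq> 0" "\<forall>x\<in>F. \<exists>n :: int. of_int D * x = of_int n" by blast
    obtain p q where pq: "quotient_of x = (p, q)" by force
    have q: "q > 0" "x = of_int p / of_int q" using quotient_of_denom_pos[OF pq] quotient_of_div[OF pq] by auto
    have "\<exists>n :: int. of_int (q * D) * z = of_int n" if "z \<in> insert x F" for z
    proof (cases "z = x")
      case True
      then have "of_int (q * D) * z = of_int (D * p)" using q by simp
      then show ?thesis by blast
    next
      case False
      then obtain n :: int where "of_int D * z = of_int n" using D \<open>z \<in> insert x F\<close> by blast
      then have "of_int (q * D) * z = of_int (q * n)" by (simp add: mult.assoc)
      then show ?thesis by blast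
    qed
    then show ?case using D q by (intro exI[of _ "q * D"]) auto
  qed
  then show thesis using that by blast
qed

lemma torsion_free_rank_eqI:
  assumes "B \<subseteq> carrier G" "finite B" "int_independent G B"
    and "\<And>B'. B' \<subseteq> carrier G \<Longrightarrow> finite B' \<Longrightarrow> int_independent G B' \<Longrightarrow> card B' \<le> card B"
  shows "torsion_free_rank G = card B"
  unfolding torsion_free_rank_def using assms by (intro Greatest_equality) auto

lemma algebraic_int_of_int [simp]: "algebraic_int (of_int k)"
  by (rule int_imp_algebraic_int) simp

text \<open>Restatement of the module laws in terms of the field operations, and the action of the integers
  through the maximal order.\<close>

locale max_order_module = module "max_order :: 'k::number_field ring" M
  for M :: "('k::number_field, 'm, 'd) module_scheme" (structure)
begin

lemma act_closed [simp, intro]: "algebraic_int a \<Longrightarrow> x \<in> carrier M \<Longrightarrow> a \<odot> x \<in> carrier M"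
  using smult_closed by simp

lemma act_add_left: "algebraic_int a \<Longrightarrow> algebraic_int b \<Longrightarrow> x \<in> carrier M \<Longrightarrow> (a + b) \<odot> x = a \<odot> x \<oplus> b \<odot> x"
  using smult_l_distr[of a b x] by simp

lemma act_add_right: "algebraic_int a \<Longrightarrow> x \<in> carrier M \<Longrightarrow> z \<in> carrier M \<Longrightarrow> a \<odot> (x \<oplus> z) = a \<odot> x \<oplus> a \<odot> z"
  using smult_r_distr[of a x z] by simp

lemma act_mult: "algebraic_int a \<Longrightarrow> algebraic_int b \<Longrightarrow> x \<in> carrier M \<Longrightarrow> (a * b) \<odot> x = a \<odot> (b \<odot> x)"
  using smult_assoc1[of a b x] by simp

lemma act_one [simp]: "x \<in> carrier M \<Longrightarrow> 1 \<odot> x = x"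
  using smult_one[of x] by simp

lemma act_zero [simp]: "x \<in> carrier M \<Longrightarrow> 0 \<odot> x = \<zero>"
  using smult_l_null[of x] by simp

lemma act_zero_right [simp]: "algebraic_int a \<Longrightarrow> a \<odot> \<zero> = \<zero>"
  using smult_r_null[of a] by simp

lemma act_minus_one: "x \<in> carrier M \<Longrightarrow> (- 1) \<odot> x = \<ominus> x"
proof -
  assume x: "x \<in> carrier M"
  have "x \<oplus> (- 1) \<odot> x = (1 + - 1) \<odot> x" using x act_add_left[of 1 "- 1" x] by simp
  then have "x \<oplus> (- 1) \<odot> x = \<zero>" using x by simp
  moreover have "(- 1) \<odot> x \<in> carrier M" using x by (intro act_closed) auto
  ultimately show ?thesis using x by (metis M.minus_equality M.a_comm)
qed

lemma nat_pow_eq_act: "x \<in> carrier M \<Longrightarrow> add_pow M (n::nat) x = of_nat n \<odot> x"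
proof (induction n)
  case 0 then show ?case by simp
next
  case (Suc n)
  have "algebraic_int (of_nat n :: 'k)" using algebraic_int_of_int[of "int n"] by simp
  then show ?case using Suc act_add_left[of "of_nat n" 1 x] by (simp add: add.commute)
qed

lemma int_pow_eq_act: "x \<in> carrier M \<Longrightarrow> add_pow M (k::int) x = of_int k \<odot> x"
proof -
  assume x: "x \<in> carrier M"
  show ?thesis
  proof (cases "k \<ge> 0")
    case True
    then show ?thesis using x nat_pow_eq_act[of x "nat k"] by (simp add: add_pow_int_ge)
  next
    case False
    then have "add_pow M k x = \<ominus> (of_nat (nat (- k)) \<odot> x)"
      using x nat_pow_eq_act[of x "nat (- k)"] by (simp add: add_pow_int_lt)
    also have "of_nat (nat (- k)) = - (of_int k :: 'k)" using False by simp
    also have "\<ominus> ((- of_int k) \<odot> x) = of_int k \<odot> x"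
    proof -
      have "of_int k \<odot> x \<oplus> (- of_int k) \<odot> x = \<zero>"
        using x act_add_left[of "of_int k" "- of_int k" x] by simp
      then show ?thesis using x M.minus_equality by simp
    qed
    finally show ?thesis .
  qed
qed

lemma lin_comb_closed:
  "s \<in> B \<rightarrow> carrier M \<Longrightarrow> (\<And>b. b \<in> B \<Longrightarrow> algebraic_int (a b)) \<Longrightarrow> (\<Oplus>b\<in>B. a b \<odot> s b) \<in> carrier M"
  by (intro M.finsum_closed) (auto simp: Pi_iff)

lemma algebraic_int_sum: "(\<And>i. i \<in> I \<Longrightarrow> algebraic_int (f i)) \<Longrightarrow> algebraic_int (\<Sum>i\<in>I. f i :: 'k)"
  by (induction I rule: infinite_finite_induct) (auto simp: algebraic_int_plus_times)

lemma lin_comb_add: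
  assumes "s \<in> B \<rightarrow> carrier M" "\<And>b. b \<in> B \<Longrightarrow> algebraic_int (a b)" "\<And>b. b \<in> B \<Longrightarrow> algebraic_int (d b)"
  shows "(\<Oplus>b\<in>B. (a b + d b) \<odot> s b) = (\<Oplus>b\<in>B. a b \<odot> s b) \<oplus> (\<Oplus>b\<in>B. d b \<odot> s b)"
proof -
  have "(\<Oplus>b\<in>B. (a b + d b) \<odot> s b) = (\<Oplus>b\<in>B. a b \<odot> s b \<oplus> d b \<odot> s b)"
    using assms by (intro M.finsum_cong') (auto simp: Pi_iff act_add_left)
  also have "\<dots> = (\<Oplus>b\<in>B. a b \<odot> s b) \<oplus> (\<Oplus>b\<in>B. d b \<odot> s b)"
    using assms by (intro M.finsum_addf) (auto simp: Pi_iff)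
  finally show ?thesis .
qed

lemma lin_comb_scale:
  assumes "finite B" "s \<in> B \<rightarrow> carrier M" "\<And>b. b \<in> B \<Longrightarrow> algebraic_int (a b)" "algebraic_int r"
  shows "r \<odot> (\<Oplus>b\<in>B. a b \<odot> s b) = (\<Oplus>b\<in>B. (r * a b) \<odot> s b)"
proof -
  have "r \<odot> (\<Oplus>b\<in>B. a b \<odot> s b) = (\<Oplus>b\<in>B. r \<odot> (a b \<odot> s b))"
    using assms by (intro finsum_smult_ldistr) (auto simp: Pi_iff)
  also have "\<dots> = (\<Oplus>b\<in>B. (r * a b) \<odot> s b)"
    using assms by (intro M.finsum_cong') (auto simp: Pi_iff act_mult)
  finally show ?thesis .
qed

lemma lin_comb_zero:
  assumes "s \<in> B \<rightarrow> carrier M" "\<And>b. b \<in> B \<Longrightarrow> a b = 0"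
  shows "(\<Oplus>b\<in>B. a b \<odot> s b) = \<zero>"
proof -
  have "(\<Oplus>b\<in>B. a b \<odot> s b) = (\<Oplus>b\<in>B. \<zero>)"
    using assms by (intro M.finsum_cong') (auto simp: Pi_iff)
  then show ?thesis by simp
qed

lemma lin_comb_collect:
  assumes fin: "finite B" and s: "s \<in> B \<rightarrow> carrier M"
    and a: "\<And>x b. x \<in> J \<Longrightarrow> b \<in> B \<Longrightarrow> algebraic_int (a x b)"
    and k: "\<And>x. x \<in> J \<Longrightarrow> algebraic_int (k x)" and "finite J"
  shows "(\<Oplus>x\<in>J. k x \<odot> (\<Oplus>b\<in>B. a x b \<odot> s b)) = (\<Oplus>b\<in>B. (\<Sum>x\<in>J. k x * a x b) \<odot> s b)"
  using \<open>finite J\<close> a k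
proof (induction J)
  case empty
  then show ?case using lin_comb_zero[OF s, of "\<lambda>_. 0"] by simp
next
  case (insert x J)
  have c: "(\<Oplus>b\<in>B. a z b \<odot> s b) \<in> carrier M" if "z \<in> insert x J" for z
    using that insert.prems(1) by (intro lin_comb_closed s) auto
  have "(\<Oplus>z\<in>insert x J. k z \<odot> (\<Oplus>b\<in>B. a z b \<odot> s b)) =
      k x \<odot> (\<Oplus>b\<in>B. a x b \<odot> s b) \<oplus> (\<Oplus>z\<in>J. k z \<odot> (\<Oplus>b\<in>B. a z b \<odot> s b))"
    using insert.hyps insert.prems c by (intro M.finsum_insert) (auto simp: Pi_iff)
  also have "(\<Oplus>z\<in>J. k z \<odot> (\<Oplus>b\<in>B. a z b \<odot> s b)) = (\<Oplus>b\<in>B. (\<Sum>z\<in>J. k z * a z b) \<odot> s b)"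
    using insert.IH insert.prems by simp
  also have "k x \<odot> (\<Oplus>b\<in>B. a x b \<odot> s b) = (\<Oplus>b\<in>B. (k x * a x b) \<odot> s b)"
    using insert.prems by (intro lin_comb_scale fin s) auto
  also have "\<dots> \<oplus> (\<Oplus>b\<in>B. (\<Sum>z\<in>J. k z * a z b) \<odot> s b) =
      (\<Oplus>b\<in>B. (k x * a x b + (\<Sum>z\<in>J. k z * a z b)) \<odot> s b)"
    using insert.prems by (intro lin_comb_add[symmetric] s algebraic_int_sum) (auto simp: algebraic_int_plus_times)
  finally show ?case using insert.hyps by simp
qed

end

section \<open>Ranks over the maximal order\<close>

lemma finsum_max_order:
  fixes f :: "'i \<Rightarrow> 'k::number_field"
  assumes "\<And>i. i \<in> I \<Longrightarrow> algebraic_int (f i)"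
  shows "finsum max_order f I = sum f I"
proof -
  interpret O: cring "max_order :: 'k ring" by (rule cring_max_order)
  show ?thesis using assms
  proof (induction I rule: infinite_finite_induct)
    case (insert x I)
    then have "finsum max_order f (insert x I) = f x \<oplus>\<^bsub>max_order\<^esub> finsum max_order f I"
      by (intro O.finsum_insert) (auto simp: Pi_iff)
    then show ?case using insert by simp
  next
    case (infinite I)
    then show ?case by (simp add: finsum_def finprod_def)
  next
    case empty
    show ?case using O.finsum_empty[of f] by simp
  qed
qed

lemma add_pow_max_order:
  fixes x :: "'k::number_field"
  assumes x: "algebraic_int x"
  shows "add_pow max_order (k::int) x = of_int k * x"
proof -
  interpret O: cring "max_order :: 'k ring" by (rule cring_max_order)
  have nat: "add_pow max_order n x = of_nat n * x" for n :: nat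
  proof (induction n)
    case 0 then show ?case using O.add.nat_pow_0 by simp
  next
    case (Suc n)
    then show ?case by (simp add: O.add.nat_pow_Suc algebra_simps)
  qed
  have neg: "\<ominus>\<^bsub>max_order\<^esub> z = - z" if "algebraic_int z" for z :: 'k
    using O.minus_equality[of "- z" z] that by simp
  show ?thesis
  proof (cases "k \<ge> 0")
    case True then show ?thesis by (simp add: add_pow_int_ge nat)
  next
    case False
    have "algebraic_int (of_nat (nat (- k)) * x)"
      using algebraic_int_of_int[of "- k", where 'a = 'k] x False by (intro algebraic_int_plus_times) auto
    then show ?thesis using False by (simp add: add_pow_int_lt nat neg)
  qed
qed

lemma int_independent_max_order:
  fixes B :: "'k::number_field set"
  assumes "\<And>b. b \<in> B \<Longrightarrow> algebraic_int b"
  shows "int_independent max_order B \<longleftrightarrow>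
    (\<forall>c :: 'k \<Rightarrow> int. (\<Sum>b\<in>B. of_int (c b) * b) = 0 \<longrightarrow> (\<forall>b\<in>B. c b = 0))"
proof -
  have "finsum max_order (\<lambda>b. add_pow max_order (c b) b) B = (\<Sum>b\<in>B. of_int (c b) * b)"
    for c :: "'k \<Rightarrow> int"
  proof -
    have "finsum max_order (\<lambda>b. add_pow max_order (c b) b) B = (\<Sum>b\<in>B. add_pow max_order (c b) b)"
      using assms by (intro finsum_max_order) (simp add: add_pow_max_order algebraic_int_plus_times)
    also have "\<dots> = (\<Sum>b\<in>B. of_int (c b) * b)"
      using assms by (intro sum.cong) (simp_all add: add_pow_max_order)
    finally show ?thesis .
  qed
  then show ?thesis by (simp add: int_independent_def)
qed

text \<open>Coordinates with respect to a finite spanning set over the rationals become integral after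
  multiplication by a common denominator; then more vectors than coordinates are dependent.\<close>

lemma number_field_rank_bound:
  "\<exists>m. \<forall>J :: 'k::number_field set. finite J \<longrightarrow>
    (\<forall>c :: 'k \<Rightarrow> int. (\<Sum>j\<in>J. of_int (c j) * j) = 0 \<longrightarrow> (\<forall>j\<in>J. c j = 0)) \<longrightarrow> card J \<le> m"
proof -
  obtain E :: "'k set" where E: "finite E" "\<And>x. \<exists>q :: 'k \<Rightarrow> rat. x = (\<Sum>b\<in>E. of_rat (q b) * b)"
    using finite_dimensional_over_rat by metis
  obtain q :: "'k \<Rightarrow> 'k \<Rightarrow> rat" where q: "\<And>x. x = (\<Sum>b\<in>E. of_rat (q x b) * b)" using E(2) by metis
  have "card J \<le> card E" if J: "finite J" and
    ind: "\<And>c :: 'k \<Rightarrow> int. (\<Sum>j\<in>J. of_int (c j) * j) = 0 \<Longrightarrow> \<forall>j\<in>J. c j = 0" for J :: "'k set"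
  proof (rule ccontr)
    assume "\<not> card J \<le> card E"
    then have less: "card E < card J" by simp
    have "finite ((\<lambda>(j, b). q j b) ` (J \<times> E))" using J E by simp
    then obtain D :: int where D: "D \<noteq> 0"
      "\<And>x. x \<in> (\<lambda>(j, b). q j b) ` (J \<times> E) \<Longrightarrow> \<exists>n :: int. of_int D * x = of_int n"
      using rat_common_denominator by metis
    have "\<forall>j\<in>J. \<forall>b\<in>E. \<exists>n :: int. of_int D * q j b = of_int n" using D(2) by force
    then obtain a :: "'k \<Rightarrow> 'k \<Rightarrow> int" where a: "\<And>j b. j \<in> J \<Longrightarrow> b \<in> E \<Longrightarrow> of_int D * q j b = of_int (a j b)"
      by metis
    obtain c where c: "\<exists>j\<in>J. c j \<noteq> 0" "\<And>b. b \<in> E \<Longrightarrow> (\<Sum>j\<in>J. c j * a j b) = 0"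
      using int_linear_relation[OF E(1) J less] by metis
    have Dj: "of_int D * j = (\<Sum>b\<in>E. of_int (a j b) * b)" if "j \<in> J" for j
    proof -
      have "of_int D * j = (\<Sum>b\<in>E. of_rat (of_int D * q j b) * b)"
        by (subst q[of j]) (simp add: sum_distrib_left of_rat_mult mult.assoc)
      also have "\<dots> = (\<Sum>b\<in>E. of_int (a j b) * b)"
        using a[OF that] by (intro sum.cong) auto
      finally show ?thesis .
    qed
    have "of_int D * (\<Sum>j\<in>J. of_int (c j) * j) = (\<Sum>j\<in>J. of_int (c j) * (of_int D * j))"
      by (simp add: sum_distrib_left mult.left_commute)
    also have "\<dots> = (\<Sum>j\<in>J. \<Sum>b\<in>E. of_int (c j * a j b) * b)"
      using Dj by (intro sum.cong) (simp_all add: sum_distrib_left mult.assoc)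
    also have "\<dots> = (\<Sum>b\<in>E. \<Sum>j\<in>J. of_int (c j * a j b) * b)" by (rule sum.swap)
    also have "\<dots> = (\<Sum>b\<in>E. of_int (\<Sum>j\<in>J. c j * a j b) * b)"
      by (simp add: sum_distrib_right)
    also have "\<dots> = 0" using c(2) by simp
    finally have "(\<Sum>j\<in>J. of_int (c j) * j) = 0" using D(1) by simp
    then show False using ind c(1) by blast
  qed
  then show ?thesis by blast
qed

text \<open>If \<open>W\<close> is a maximal independent subset of the maximal order, adding a further \<open>a\<close> creates a
  relation, in which the coefficient of \<open>a\<close> is nonzero.\<close>

lemma max_order_rational_basis:
  obtains W :: "'k::number_field set" where "finite W" "\<forall>w\<in>W. algebraic_int w"
    "card W = torsion_free_rank (max_order :: 'k ring)" "card W > 0"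
    "\<forall>c :: 'k \<Rightarrow> int. (\<Sum>w\<in>W. of_int (c w) * w) = 0 \<longrightarrow> (\<forall>w\<in>W. c w = 0)"
    "\<forall>a :: 'k. algebraic_int a \<longrightarrow> (\<exists>D z. D \<noteq> 0 \<and> of_int D * a = (\<Sum>w\<in>W. of_int (z w) * w))"
proof -
  obtain m where m: "\<forall>J :: 'k set. finite J \<longrightarrow>
    (\<forall>c :: 'k \<Rightarrow> int. (\<Sum>j\<in>J. of_int (c j) * j) = 0 \<longrightarrow> (\<forall>j\<in>J. c j = 0)) \<longrightarrow> card J \<le> m"
    using number_field_rank_bound[where 'k = 'k] by (elim exE)
  define P where "P W \<longleftrightarrow> W \<subseteq> carrier (max_order :: 'k ring) \<and> finite W \<and> int_independent max_order W" for W
  have indep: "(\<forall>c :: 'k \<Rightarrow> int. (\<Sum>b\<in>W. of_int (c b) * b) = 0 \<longrightarrow> (\<forall>b\<in>W. c b = 0))" if "P W" for W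
    using that int_independent_max_order[of W] by (auto simp: P_def)
  have bound: "card W \<le> m" if "P W" for W
    using m[rule_format, of W] indep[OF that] that by (auto simp: P_def)
  have "P {}" by (simp add: P_def int_independent_def)
  have "P {1}" using int_independent_max_order[of "{1::'k}"] by (auto simp: P_def)
  obtain W where W: "P W" and max: "\<And>W'. P W' \<Longrightarrow> card W' \<le> card W"
    using ex_has_greatest_nat[of P "{}" card "Suc m"] \<open>P {}\<close> bound by (metis less_Suc_eq_le)
  have fin: "finite W" and Wc: "\<And>w. w \<in> W \<Longrightarrow> algebraic_int w" using W by (auto simp: P_def)
  have "torsion_free_rank (max_order :: 'k ring) = card W"
    using W max by (intro torsion_free_rank_eqI) (auto simp: P_def)
  moreover have "card W > 0" using max[OF \<open>P {1}\<close>] by simp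
  moreover have "\<exists>D z. D \<noteq> 0 \<and> of_int D * a = (\<Sum>w\<in>W. of_int (z w) * w)"
    if a: "algebraic_int a" for a :: 'k
  proof (cases "a \<in> W")
    case True
    have "(\<Sum>w\<in>W. of_int (if w = a then 1 else 0) * w) = (\<Sum>w\<in>W. if w = a then w else 0)"
      by (rule sum.cong) auto
    also have "\<dots> = a" using True fin by simp
    finally show ?thesis by (intro exI[of _ 1] exI[of _ "\<lambda>w. if w = a then 1 else 0"]) simp
  next
    case False
    have "\<not> P (insert a W)" using max[of "insert a W"] False fin by auto
    then have "\<not> int_independent max_order (insert a W)" using W a by (auto simp: P_def)
    then obtain c :: "'k \<Rightarrow> int" where c: "(\<Sum>b\<in>insert a W. of_int (c b) * b) = 0" "\<exists>b\<in>insert a W. c b \<noteq> 0"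
      using int_independent_max_order[of "insert a W"] a Wc by auto
    have s: "of_int (c a) * a + (\<Sum>b\<in>W. of_int (c b) * b) = 0" using c(1) False fin by simp
    have "c a \<noteq> 0"
    proof
      assume ca: "c a = 0"
      then have "(\<Sum>b\<in>W. of_int (c b) * b) = 0" using s by simp
      then have "\<forall>b\<in>W. c b = 0" using indep[OF W] by blast
      then show False using c(2) ca by auto
    qed
    moreover have "of_int (c a) * a = (\<Sum>b\<in>W. of_int (- c b) * b)"
      using s by (simp add: sum_negf eq_neg_iff_add_eq_0)
    ultimately show ?thesis by (intro exI[of _ "c a"] exI[of _ "\<lambda>b. - c b"]) simp
  qed
  ultimately show thesis using that[OF fin] Wc indep[OF W] by simp
qed

lemma max_order_common_denominator:
  fixes W :: "'k::number_field set"
  assumes "finite A"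
    and "\<forall>a\<in>A. \<exists>D z. D \<noteq> 0 \<and> of_int D * a = (\<Sum>w\<in>W. of_int (z w) * w)"
  obtains D where "D \<noteq> 0" "\<forall>a\<in>A. \<exists>z. of_int D * a = (\<Sum>w\<in>W. of_int (z w) * w)"
proof -
  have "\<exists>D. D \<noteq> 0 \<and> (\<forall>a\<in>A. \<exists>z. of_int D * a = (\<Sum>w\<in>W. of_int (z w) * w))"
    using assms
  proof (induction A)
    case empty then show ?case by (intro exI[of _ 1]) auto
  next
    case (insert x A)
    obtain D where D: "D \<noteq> 0" "\<forall>a\<in>A. \<exists>z. of_int D * a = (\<Sum>w\<in>W. of_int (z w) * w)"
      using insert.IH insert.prems by auto
    obtain D' z' where D': "D' \<noteq> 0" "of_int D' * x = (\<Sum>w\<in>W. of_int (z' w) * w)"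
      using insert.prems by auto
    have "\<exists>z. of_int (D * D') * a = (\<Sum>w\<in>W. of_int (z w) * w)" if "a \<in> insert x A" for a
    proof (cases "a = x")
      case True
      then have "of_int (D * D') * a = of_int D * (of_int D' * x)" by simp
      also have "\<dots> = (\<Sum>w\<in>W. of_int (D * z' w) * w)"
        unfolding D'(2) by (simp add: sum_distrib_left mult.assoc)
      finally show ?thesis by (intro exI[of _ "\<lambda>w. D * z' w"])
    next
      case False
      then obtain z where z: "of_int D * a = (\<Sum>w\<in>W. of_int (z w) * w)" using D \<open>a \<in> insert x A\<close> by blast
      have "of_int (D * D') * a = of_int D' * (of_int D * a)" by simp
      also have "\<dots> = (\<Sum>w\<in>W. of_int (D' * z w) * w)"
        unfolding z by (simp add: sum_distrib_left mult.assoc)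
      finally show ?thesis by (intro exI[of _ "\<lambda>w. D' * z w"])
    qed
    then show ?case using D D' by (intro exI[of _ "D * D'"]) auto
  qed
  then show thesis using that by blast
qed

context max_order_module
begin

lemma int_independent_iff:
  assumes "J \<subseteq> carrier M"
  shows "int_independent M J \<longleftrightarrow>
    (\<forall>c :: 'm \<Rightarrow> int. (\<Oplus>x\<in>J. of_int (c x) \<odot> x) = \<zero> \<longrightarrow> (\<forall>x\<in>J. c x = 0))"
proof -
  have "(\<Oplus>x\<in>J. add_pow M (c x) x) = (\<Oplus>x\<in>J. of_int (c x) \<odot> x)" for c :: "'m \<Rightarrow> int"
    using assms by (intro M.finsum_cong') (auto simp: int_pow_eq_act)
  then show ?thesis by (simp add: int_independent_def)
qed

text \<open>A relation between the coefficient vectors of the elements \<open>F x\<close> is a relation between the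
  \<open>x\<close>; the factor \<open>F\<close> accounts for elements that have only a multiple in the span of \<open>s\<close>.\<close>

lemma relation_of_span:
  fixes s :: "'i \<Rightarrow> 'm" and a :: "'m \<Rightarrow> 'i \<Rightarrow> 'k"
  assumes B: "finite B" "s \<in> B \<rightarrow> carrier M" and J: "finite J" "J \<subseteq> carrier M"
    and a: "\<And>x b. x \<in> J \<Longrightarrow> b \<in> B \<Longrightarrow> algebraic_int (a x b)"
    and xa: "\<And>x. x \<in> J \<Longrightarrow> of_int F \<odot> x = (\<Oplus>b\<in>B. a x b \<odot> s b)"
    and c: "\<And>b. b \<in> B \<Longrightarrow> (\<Sum>x\<in>J. of_int (c x) * a x b) = 0"
  shows "(\<Oplus>x\<in>J. of_int (c x * F) \<odot> x) = \<zero>"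
proof -
  have "(\<Oplus>x\<in>J. of_int (c x * F) \<odot> x) = (\<Oplus>x\<in>J. of_int (c x) \<odot> (\<Oplus>b\<in>B. a x b \<odot> s b))"
  proof (rule M.finsum_cong'[OF refl])
    show "(\<lambda>x. of_int (c x) \<odot> (\<Oplus>b\<in>B. a x b \<odot> s b)) \<in> J \<rightarrow> carrier M"
      using B a by (auto intro!: lin_comb_closed)
    fix x assume x: "x \<in> J"
    then show "of_int (c x * F) \<odot> x = of_int (c x) \<odot> (\<Oplus>b\<in>B. a x b \<odot> s b)"
      using act_mult[of "of_int (c x)" "of_int F" x] J xa by auto
  qed
  also have "\<dots> = (\<Oplus>b\<in>B. (\<Sum>x\<in>J. of_int (c x) * a x b) \<odot> s b)"
    using B J a by (intro lin_comb_collect) auto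
  also have "\<dots> = \<zero>" using B c by (intro lin_comb_zero) auto
  finally show ?thesis .
qed

definition int_gens :: "nat \<Rightarrow> (nat \<Rightarrow> 'm) \<Rightarrow> 'm set \<Rightarrow> bool" where
  "int_gens n e S \<longleftrightarrow> e \<in> {..<n} \<rightarrow> S \<and>
     (\<forall>x\<in>S. \<exists>z :: nat \<Rightarrow> int. x = (\<Oplus>t\<in>{..<n}. of_int (z t) \<odot> e t))"

lemma int_independent_card_le:
  assumes g: "int_gens n e (carrier M)" and J: "J \<subseteq> carrier M" "finite J" "int_independent M J"
  shows "card J \<le> n"
proof (rule ccontr)
  assume "\<not> card J \<le> n"
  then have less: "card {..<n} < card J" by simp
  have "\<forall>x\<in>carrier M. \<exists>z :: nat \<Rightarrow> int. x = (\<Oplus>t\<in>{..<n}. of_int (z t) \<odot> e t)"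
    using g by (simp add: int_gens_def)
  then obtain z :: "'m \<Rightarrow> nat \<Rightarrow> int"
    where z: "\<And>x. x \<in> carrier M \<Longrightarrow> x = (\<Oplus>t\<in>{..<n}. of_int (z x t) \<odot> e t)" by metis
  obtain c where c: "\<exists>x\<in>J. c x \<noteq> 0" "\<And>t. t \<in> {..<n} \<Longrightarrow> (\<Sum>x\<in>J. c x * z x t) = 0"
    using int_linear_relation[OF finite_lessThan J(2) less] by metis
  have "(\<Oplus>x\<in>J. of_int (c x * 1) \<odot> x) = \<zero>"
  proof (rule relation_of_span[where s = e and a = "\<lambda>x t. of_int (z x t)"])
    show "e \<in> {..<n} \<rightarrow> carrier M" using g by (simp add: int_gens_def)
    show "of_int 1 \<odot> x = (\<Oplus>t\<in>{..<n}. of_int (z x t) \<odot> e t)" if "x \<in> J" for x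
      using z[of x] that J(1) by auto
    show "(\<Sum>x\<in>J. of_int (c x) * of_int (z x t)) = (0 :: 'k)" if "t \<in> {..<n}" for t
      using c(2)[OF that] by (metis (mono_tags, lifting) of_int_0 of_int_mult of_int_sum sum.cong)
  qed (use J in auto)
  then show False using J c(1) int_independent_iff[OF J(1)] by auto
qed

context
  fixes C B :: "'m set"
  assumes C: "submodule C max_order M" and B: "basis_of max_order (M\<lparr>carrier := C\<rparr>) B"
begin

interpretation C: module max_order "M\<lparr>carrier := C\<rparr>"
  by (rule submodule.submodule_is_module[OF C module_axioms])

lemma basis_in_submodule: "B \<subseteq> C"
  using C.basis_subset[OF B] by simp

lemma basis_in_carrier: "B \<subseteq> carrier M"
  using basis_in_submodule submoduleE(1)[OF C] by blast

lemma lin_comb_in_submodule: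
  assumes "F \<subseteq> B" "\<And>b. b \<in> F \<Longrightarrow> algebraic_int (c b)"
  shows "(\<Oplus>\<^bsub>M\<lparr>carrier := C\<rparr>\<^esub>b\<in>F. c b \<odot>\<^bsub>M\<lparr>carrier := C\<rparr>\<^esub> b) = (\<Oplus>b\<in>F. c b \<odot> b)"
proof -
  have "(\<lambda>b. c b \<odot> b) \<in> F \<rightarrow> C"
  proof
    fix b assume "b \<in> F"
    then show "c b \<odot> b \<in> C"
      using assms basis_in_submodule by (intro submoduleE(4)[OF C]) auto
  qed
  from finsum_submodule[OF C this] show ?thesis by simp
qed

lemma submodule_basis_independent:
  assumes "finite F" "F \<subseteq> B" "\<And>b. b \<in> F \<Longrightarrow> algebraic_int (c b)" "(\<Oplus>b\<in>F. c b \<odot> b) = \<zero>" "b \<in> F"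
  shows "c b = 0"
  using C.basis_independent[OF B assms(1,2), of c b] lin_comb_in_submodule[OF assms(2), of c] assms(3-5)
  by auto

lemma submodule_basis_span:
  assumes "finite B" "x \<in> C"
  obtains c where "\<forall>b\<in>B. algebraic_int (c b)" "x = (\<Oplus>b\<in>B. c b \<odot> b)"
proof -
  obtain c where c: "c \<in> B \<rightarrow> carrier max_order"
    "x = (\<Oplus>\<^bsub>M\<lparr>carrier := C\<rparr>\<^esub>b\<in>B. c b \<odot>\<^bsub>M\<lparr>carrier := C\<rparr>\<^esub> b)"
    using C.basis_span[OF B assms(1), of x] assms(2) by auto
  then show thesis using that[of c] lin_comb_in_submodule[of B c] by auto
qed

text \<open>A basis over the maximal order is independent over the integers.\<close>

lemma finite_submodule_basis:
  assumes g: "int_gens n e (carrier M)"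
  shows "finite B"
proof -
  have "card F \<le> n" if F: "finite F" "F \<subseteq> B" for F
  proof (rule int_independent_card_le[OF g])
    show FM: "F \<subseteq> carrier M" using F basis_in_carrier by blast
    show "int_independent M F"
      unfolding int_independent_iff[OF FM]
    proof (intro allI impI ballI)
      fix c :: "'m \<Rightarrow> int" and b assume "(\<Oplus>x\<in>F. of_int (c x) \<odot> x) = \<zero>" "b \<in> F"
      then have "of_int (c b) = (0 :: 'k)"
        by (intro submodule_basis_independent[OF F, of "\<lambda>b. of_int (c b)"]) auto
      then show "c b = 0" by simp
    qed
  qed (rule F)
  then show ?thesis by (meson finite_if_finite_subsets_card_bdd)
qed

text \<open>If \<open>W\<close> is a maximal independent subset of the maximal order, the products \<open>w b\<close> with \<open>w \<in> W\<close>
  and \<open>b \<in> B\<close> are independent. Conversely, every element of \<open>M\<close> is taken into \<open>C\<close> by some nonzero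
  integer, and then by a further one into the subgroup generated by these products.\<close>

lemma torsion_free_rank_eq:
  assumes fin: "finite B" and idx: "a_index M (carrier M) C > 0"
  shows "torsion_free_rank M = card B * torsion_free_rank (max_order :: 'k ring)"
proof -
  obtain W :: "'k set" where W: "finite W" and Wa: "\<forall>w\<in>W. algebraic_int w"
    and card_W: "card W = torsion_free_rank (max_order :: 'k ring)" "card W > 0"
    and indep: "\<forall>c :: 'k \<Rightarrow> int. (\<Sum>w\<in>W. of_int (c w) * w) = 0 \<longrightarrow> (\<forall>w\<in>W. c w = 0)"
    and span: "\<forall>a :: 'k. algebraic_int a \<longrightarrow> (\<exists>D z. D \<noteq> 0 \<and> of_int D * a = (\<Sum>w\<in>W. of_int (z w) * w))"
    using max_order_rational_basis[where 'k = 'k] .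
  note BM = basis_in_carrier
  define p where "p = (\<lambda>(w :: 'k, b). w \<odot> b)"
  \<comment> \<open>The coefficient vector of \<open>w b\<close> with respect to \<open>B\<close>.\<close>
  define \<delta> where "\<delta> = (\<lambda>(w :: 'k, b :: 'm) b'. if b' = b then w else 0)"
  have \<delta>: "p wb = (\<Oplus>b'\<in>B. \<delta> wb b' \<odot> b')" if wb: "wb \<in> W \<times> B" for wb
  proof -
    obtain w b where [simp]: "wb = (w, b)" and wb': "w \<in> W" "b \<in> B" using wb by auto
    have "(\<Oplus>b'\<in>B. \<delta> wb b' \<odot> b') = (\<Oplus>b'\<in>B. if b = b' then w \<odot> b' else \<zero>)"
      using wb' Wa BM by (intro M.finsum_cong') (auto simp: \<delta>_def)
    also have "\<dots> = w \<odot> b"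
      using wb' Wa BM by (intro M.add.finprod_singleton[OF wb'(2) fin]) auto
    finally show ?thesis by (simp add: p_def)
  qed
  have \<delta>_alg: "algebraic_int (\<delta> wb b')" if "wb \<in> W \<times> B" for wb b'
    using that Wa by (auto simp: \<delta>_def)
  have pM: "p wb \<in> carrier M" if "wb \<in> W \<times> B" for wb
    using that Wa BM by (auto simp: p_def)
  have p_ind: "\<forall>wb\<in>W \<times> B. c wb = 0"
    if c: "(\<Oplus>wb\<in>W \<times> B. of_int (c wb) \<odot> p wb) = \<zero>" for c :: "'k \<times> 'm \<Rightarrow> int"
  proof -
    have "(\<Oplus>wb\<in>W \<times> B. of_int (c wb) \<odot> p wb) =
        (\<Oplus>wb\<in>W \<times> B. of_int (c wb) \<odot> (\<Oplus>b'\<in>B. \<delta> wb b' \<odot> b'))"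
      using pM \<delta> by (intro M.finsum_cong') (auto simp del: split_paired_All)
    also have "\<dots> = (\<Oplus>b'\<in>B. (\<Sum>wb\<in>W \<times> B. of_int (c wb) * \<delta> wb b') \<odot> b')"
      using fin W BM \<delta>_alg by (intro lin_comb_collect) auto
    finally have z: "(\<Oplus>b'\<in>B. (\<Sum>wb\<in>W \<times> B. of_int (c wb) * \<delta> wb b') \<odot> b') = \<zero>" using c by simp
    have zero: "(\<Sum>wb\<in>W \<times> B. of_int (c wb) * \<delta> wb b') = 0" if "b' \<in> B" for b'
      using \<delta>_alg that
      by (intro submodule_basis_independent[OF fin subset_refl _ z] algebraic_int_sum)
        (auto intro!: algebraic_int_plus_times)
    have "c (w, b) = 0" if "w \<in> W" "b \<in> B" for w b
    proof -
      have "(\<Sum>wb\<in>W \<times> B. of_int (c wb) * \<delta> wb b) = (\<Sum>w\<in>W. \<Sum>b'\<in>B. of_int (c (w, b')) * \<delta> (w, b') b)"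
        by (simp add: sum.cartesian_product)
      also have "\<dots> = (\<Sum>w\<in>W. \<Sum>b'\<in>B. if b = b' then of_int (c (w, b')) * w else 0)"
        by (intro sum.cong refl) (auto simp: \<delta>_def)
      also have "\<dots> = (\<Sum>w\<in>W. of_int (c (w, b)) * w)" using fin that by simp
      finally have "(\<Sum>w\<in>W. of_int (c (w, b)) * w) = 0" using zero[OF that(2)] by simp
      then show ?thesis using indep[rule_format, of "\<lambda>w. c (w, b)" w] that(1) by blast
    qed
    then show ?thesis by auto
  qed
  have inj: "inj_on p (W \<times> B)"
  proof (rule inj_onI, rule ccontr)
    fix u v assume u: "u \<in> W \<times> B" and v: "v \<in> W \<times> B" and eq: "p u = p v" and ne: "u \<noteq> v"
    define c :: "'k \<times> 'm \<Rightarrow> int" where "c x = (if x = u then 1 else if x = v then - 1 else 0)" for x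
    have finWB: "finite (W \<times> B)" using W fin by simp
    have "(\<Oplus>x\<in>W \<times> B. of_int (c x) \<odot> p x) = (\<Oplus>x\<in>{u, v}. of_int (c x) \<odot> p x)"
      using u v pM finWB by (intro M.add.finprod_mono_neutral_cong_right) (auto simp: c_def)
    also have "\<dots> = p u \<oplus> (- 1) \<odot> p v"
      using u v ne pM[OF u] pM[OF v] act_closed[of "- 1" "p v"] by (simp add: c_def)
    also have "\<dots> = \<zero>" using pM[OF v] eq by (simp add: act_minus_one M.r_neg)
    finally have "c u = 0" using p_ind[of c] u by blast
    then show False by (simp add: c_def)
  qed
  define J0 where "J0 = p ` (W \<times> B)"
  have J0: "J0 \<subseteq> carrier M" "finite J0" "card J0 = card B * card W"
    using pM W fin card_image[OF inj] by (auto simp: J0_def card_cartesian_product)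
  have ind0: "int_independent M J0"
    unfolding int_independent_iff[OF J0(1)]
  proof (intro allI impI)
    fix c :: "'m \<Rightarrow> int" assume "(\<Oplus>x\<in>J0. of_int (c x) \<odot> x) = \<zero>"
    moreover have "(\<Oplus>x\<in>J0. of_int (c x) \<odot> x) = (\<Oplus>wb\<in>W \<times> B. of_int (c (p wb)) \<odot> p wb)"
      unfolding J0_def using pM inj by (intro M.finsum_reindex) auto
    ultimately show "\<forall>x\<in>J0. c x = 0" using p_ind[of "\<lambda>wb. c (p wb)"] by (auto simp: J0_def)
  qed
  have upper: "card J \<le> card B * card W" if J: "J \<subseteq> carrier M" "finite J" "int_independent M J" for J
  proof (rule ccontr)
    assume "\<not> card J \<le> card B * card W"
    then have less: "card (B \<times> W) < card J" by (simp add: card_cartesian_product)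
    define F :: nat where "F = fact (a_index M (carrier M) C)"
    have F: "F > 0" by (simp add: F_def)
    have carr: "additive_subgroup (carrier M) M" and Csub: "additive_subgroup C M"
      using carrier_is_submodule C by (auto simp: submodule_def additive_subgroup_def)
    have FC: "of_nat F \<odot> x \<in> C" if "x \<in> carrier M" for x
      using M.fact_index_multiple[OF carr Csub idx that] nat_pow_eq_act[OF that] by (simp add: F_def)
    have "\<forall>x\<in>J. \<exists>a. (\<forall>b\<in>B. algebraic_int (a b)) \<and> of_nat F \<odot> x = (\<Oplus>b\<in>B. a b \<odot> b)"
    proof
      fix x assume "x \<in> J"
      then have "of_nat F \<odot> x \<in> C" using FC J(1) by blast
      then obtain a where "\<forall>b\<in>B. algebraic_int (a b)" "of_nat F \<odot> x = (\<Oplus>b\<in>B. a b \<odot> b)"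
        by (rule submodule_basis_span[OF fin])
      then show "\<exists>a. (\<forall>b\<in>B. algebraic_int (a b)) \<and> of_nat F \<odot> x = (\<Oplus>b\<in>B. a b \<odot> b)"
        by (intro exI[of _ a] conjI)
    qed
    from bchoice[OF this] obtain a where
      a': "\<forall>x\<in>J. (\<forall>b\<in>B. algebraic_int (a x b)) \<and> of_nat F \<odot> x = (\<Oplus>b\<in>B. a x b \<odot> b)"
      by (elim exE)
    then have a: "algebraic_int (a x b)" if "x \<in> J" "b \<in> B" for x b using that by blast
    have xa: "of_nat F \<odot> x = (\<Oplus>b\<in>B. a x b \<odot> b)" if "x \<in> J" for x using a' that by blast
    have "finite ((\<lambda>(x, b). a x b) ` (J \<times> B))" using J(2) fin by simp
    moreover have "\<forall>u\<in>(\<lambda>(x, b). a x b) ` (J \<times> B).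
        \<exists>D z. D \<noteq> 0 \<and> of_int D * u = (\<Sum>w\<in>W. of_int (z w) * w)" using a span by auto
    ultimately obtain D where D: "D \<noteq> 0"
      "\<forall>u\<in>(\<lambda>(x, b). a x b) ` (J \<times> B). \<exists>z. of_int D * u = (\<Sum>w\<in>W. of_int (z w) * w)"
      by (rule max_order_common_denominator)
    have "\<forall>x\<in>J. \<forall>b\<in>B. \<exists>z. of_int D * a x b = (\<Sum>w\<in>W. of_int (z w) * w)" using D(2) by force
    then obtain z where z: "\<And>x b. x \<in> J \<Longrightarrow> b \<in> B \<Longrightarrow> of_int D * a x b = (\<Sum>w\<in>W. of_int (z x b w) * w)"
      by metis
    obtain c where c: "\<exists>x\<in>J. c x \<noteq> 0" "\<And>bw. bw \<in> B \<times> W \<Longrightarrow> (\<Sum>x\<in>J. c x * (case bw of (b, w) \<Rightarrow> z x b w)) = 0"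
      using int_linear_relation[OF _ J(2) less, of "\<lambda>x (b, w). z x b w"] W fin by blast
    have czero: "(\<Sum>x\<in>J. of_int (c x) * a x b) = 0" if b: "b \<in> B" for b
    proof -
      have "of_int D * (\<Sum>x\<in>J. of_int (c x) * a x b) = (\<Sum>x\<in>J. of_int (c x) * (of_int D * a x b))"
        by (simp add: sum_distrib_left mult.left_commute)
      also have "\<dots> = (\<Sum>x\<in>J. \<Sum>w\<in>W. of_int (c x * z x b w) * w)"
        using z b by (intro sum.cong) (simp_all add: sum_distrib_left mult.assoc)
      also have "\<dots> = (\<Sum>w\<in>W. \<Sum>x\<in>J. of_int (c x * z x b w) * w)" by (rule sum.swap)
      also have "\<dots> = (\<Sum>w\<in>W. of_int (\<Sum>x\<in>J. c x * z x b w) * w)"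
        by (simp add: sum_distrib_right)
      also have "\<dots> = 0"
      proof (rule sum.neutral, rule ballI)
        fix w assume "w \<in> W"
        then have "(\<Sum>x\<in>J. c x * z x b w) = 0" using c(2)[of "(b, w)"] b by simp
        then show "of_int (\<Sum>x\<in>J. c x * z x b w) * w = 0" by simp
      qed
      finally show ?thesis using D(1) by simp
    qed
    have "(\<Oplus>x\<in>J. of_int (c x * int F) \<odot> x) = \<zero>"
      using fin BM J a xa czero by (intro relation_of_span[where s = "\<lambda>b. b" and a = a]) auto
    then have "\<forall>x\<in>J. c x * int F = 0"
      using J(3) unfolding int_independent_iff[OF J(1)] by (elim allE impE)
    then show False using c(1) F by auto
  qed
  show ?thesis
    using torsion_free_rank_eqI[OF J0(1,2) ind0] upper J0(3) card_W(1) by simp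
qed

end

end

context max_order_module
begin

section \<open>Subgroups of finitely generated free abelian groups\<close>

lemma int_act_mem:
  assumes S: "additive_subgroup S M" and x: "x \<in> S"
  shows "of_int k \<odot> x \<in> S"
proof -
  have xc: "x \<in> carrier M" by (rule additive_subgroup.a_Hcarr[OF S x])
  have nat: "of_nat n \<odot> x \<in> S" for n
    using M.add_pow_mem[OF S x, of n] nat_pow_eq_act[OF xc] by simp
  show ?thesis
  proof (cases "k \<ge> 0")
    case True then show ?thesis using nat[of "nat k"] by simp
  next
    case False
    have "of_int k \<odot> x = (- 1) \<odot> (of_nat (nat (- k)) \<odot> x)"
      using False act_mult[of "- 1" "of_int (- k)" x] xc by (simp del: algebraic_int_minus_iff) auto
    also have "\<dots> = \<ominus> (of_nat (nat (- k)) \<odot> x)"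
      using additive_subgroup.a_Hcarr[OF S nat] by (rule act_minus_one)
    also have "\<dots> \<in> S" by (rule additive_subgroup.a_inv_closed[OF S nat])
    finally show ?thesis .
  qed
qed

lemma int_comb_mem:
  fixes n :: nat
  assumes S: "additive_subgroup S M" and e: "e \<in> {..<n} \<rightarrow> S"
  shows "(\<Oplus>t\<in>{..<n}. of_int (z t) \<odot> e t) \<in> S"
  using e
proof (induction n)
  case 0 then show ?case using additive_subgroup.zero_closed[OF S] by simp
next
  case (Suc n)
  have c: "e t \<in> carrier M" if "t \<le> n" for t
    using Suc.prems that additive_subgroup.a_Hcarr[OF S] by (auto simp: Pi_iff)
  have "(\<Oplus>t\<in>{..<Suc n}. of_int (z t) \<odot> e t) = of_int (z n) \<odot> e n \<oplus> (\<Oplus>t\<in>{..<n}. of_int (z t) \<odot> e t)"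
    unfolding lessThan_Suc using c by (intro M.finsum_insert) auto
  moreover have "e \<in> {..<n} \<rightarrow> S" "e n \<in> S" using Suc.prems by (auto simp: Pi_iff)
  ultimately show ?case
    using Suc.IH int_act_mem[OF S] additive_subgroup.a_closed[OF S] by simp
qed

definition int_basis :: "nat \<Rightarrow> (nat \<Rightarrow> 'm) \<Rightarrow> 'm set \<Rightarrow> bool" where
  "int_basis n e S \<longleftrightarrow> int_gens n e S \<and>
     (\<forall>z :: nat \<Rightarrow> int. (\<Oplus>t\<in>{..<n}. of_int (z t) \<odot> e t) = \<zero> \<longrightarrow> (\<forall>t<n. z t = 0))"

lemma int_comb_Suc:
  assumes "e \<in> {..<Suc n} \<rightarrow> carrier M"
  shows "(\<Oplus>t\<in>{..<Suc n}. of_int (z t) \<odot> e t) = of_int (z n) \<odot> e n \<oplus> (\<Oplus>t\<in>{..<n}. of_int (z t) \<odot> e t)"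
  unfolding lessThan_Suc using assms by (intro M.finsum_insert) (auto simp: Pi_iff)

text \<open>Induction on the number of coordinates. The last coordinates of the elements of \<open>S\<close> form a
  subgroup \<open>d\<int>\<close> of the integers; if \<open>d > 0\<close>, an element \<open>v\<close> with last coordinate \<open>d\<close> extends a basis
  of the kernel of that coordinate.\<close>

lemma int_basis_subgroup:
  fixes c :: "'m \<Rightarrow> nat \<Rightarrow> int"
  assumes "additive_subgroup S M"
    and "\<And>x t. x \<in> S \<Longrightarrow> n \<le> t \<Longrightarrow> c x t = 0"
    and "\<And>x z t. x \<in> S \<Longrightarrow> z \<in> S \<Longrightarrow> c (x \<oplus> z) t = c x t + c z t"
    and "\<And>x. x \<in> S \<Longrightarrow> (\<And>t. c x t = 0) \<Longrightarrow> x = \<zero>"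
  shows "\<exists>m e. int_basis m e S"
  using assms
proof (induction n arbitrary: S)
  case 0
  then have "S = {\<zero>}" using additive_subgroup.zero_closed by fastforce
  then have "int_basis 0 (\<lambda>_. \<zero>) S" by (simp add: int_basis_def int_gens_def)
  then show ?case by blast
next
  case (Suc n)
  note S = Suc.prems(1) and top = Suc.prems(2) and add = Suc.prems(3) and inj = Suc.prems(4)
  have Sc: "x \<in> carrier M" if "x \<in> S" for x by (rule additive_subgroup.a_Hcarr[OF S that])
  have zS: "\<zero> \<in> S" by (rule additive_subgroup.zero_closed[OF S])
  have c0: "c \<zero> t = 0" for t using add[OF zS zS, of t] by simp
  have cdiff: "c (x \<ominus> z) t = c x t - c z t" if "x \<in> S" "z \<in> S" for x z t
    using add[OF M.additive_subgroup_minus[OF S that] that(2), of t] that Sc by (simp add: M.diff_add_cancel)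
  have cnat: "c (of_nat k \<odot> x) t = int k * c x t" if x: "x \<in> S" for x t and k :: nat
  proof (induction k)
    case 0 then show ?case using Sc[OF x] c0 by simp
  next
    case (Suc k)
    have "of_nat (Suc k) \<odot> x = of_nat k \<odot> x \<oplus> x"
      using act_add_left[of "of_int (int k)" 1 x] Sc[OF x] by (simp add: add.commute)
    then show ?case using Suc add[OF int_act_mem[OF S x, of "int k"] x] by (simp add: algebra_simps)
  qed
  have cint: "c (of_int k \<odot> x) t = k * c x t" if x: "x \<in> S" for x t k
  proof (cases "k \<ge> 0")
    case True then show ?thesis using cnat[OF x, of "nat k"] by simp
  next
    case False
    have "of_int k \<odot> x \<oplus> of_nat (nat (- k)) \<odot> x = \<zero>"
      using False act_add_left[of "of_int k" "of_int (- k)" x] Sc[OF x] by simp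
    then have "c (of_int k \<odot> x) t + c ((- of_int k) \<odot> x) t = 0"
      using add[OF int_act_mem[OF S x, of k] int_act_mem[OF S x, of "- k"], of t] False c0 by simp
    moreover have "c ((- of_int k) \<odot> x) t = - k * c x t"
      using cnat[OF x, of "nat (- k)" t] False by simp
    ultimately show ?thesis by simp
  qed
  define S0 where "S0 = {x \<in> S. c x n = 0}"
  have S0: "additive_subgroup S0 M"
  proof (rule M.additive_subgroupI')
    show "S0 \<subseteq> carrier M" using Sc by (auto simp: S0_def)
    show "\<zero> \<in> S0" using zS c0 by (simp add: S0_def)
    show "a \<ominus> b \<in> S0" if "a \<in> S0" "b \<in> S0" for a b
      using that M.additive_subgroup_minus[OF S] cdiff by (auto simp: S0_def)
  qed
  have "\<exists>m e. int_basis m e S0"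
  proof (rule Suc.IH[OF S0])
    show "c x t = 0" if "x \<in> S0" "n \<le> t" for x t
      using that top[of x t] by (cases "t = n") (auto simp: S0_def)
    show "c (x \<oplus> z) t = c x t + c z t" if "x \<in> S0" "z \<in> S0" for x z t
      using that add by (simp add: S0_def)
    show "x = \<zero>" if "x \<in> S0" "\<And>t. c x t = 0" for x
      using that inj[of x] by (simp add: S0_def)
  qed
  then obtain m e where e: "int_basis m e S0" by blast
  have eS: "e \<in> {..<m} \<rightarrow> S0" and span0: "\<forall>x\<in>S0. \<exists>z :: nat \<Rightarrow> int. x = (\<Oplus>t\<in>{..<m}. of_int (z t) \<odot> e t)"
    and ind0: "\<forall>z :: nat \<Rightarrow> int. (\<Oplus>t\<in>{..<m}. of_int (z t) \<odot> e t) = \<zero> \<longrightarrow> (\<forall>t<m. z t = 0)"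
    using e by (auto simp: int_basis_def int_gens_def)
  show ?case
  proof (cases "\<forall>x\<in>S. c x n = 0")
    case True
    then have "S0 = S" by (auto simp: S0_def)
    then show ?thesis using e by blast
  next
    case False
    then obtain u where u: "u \<in> S" "c u n \<noteq> 0" by blast
    have "of_int (sgn (c u n)) \<odot> u \<in> S" by (rule int_act_mem[OF S u(1)])
    moreover have "c (of_int (sgn (c u n)) \<odot> u) n > 0"
      using u cint[OF u(1), of "sgn (c u n)" n] by (simp add: sgn_if)
    ultimately have ex: "\<exists>k. \<exists>v\<in>S. c v n > 0 \<and> nat (c v n) = k" by blast
    define k where "k = (LEAST k. \<exists>v\<in>S. c v n > 0 \<and> nat (c v n) = k)"
    obtain v where v: "v \<in> S" "c v n > 0" "nat (c v n) = k"
      using LeastI_ex[OF ex] unfolding k_def by blast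
    have least: "c v n \<le> c x n" if "x \<in> S" "c x n > 0" for x
    proof -
      have "k \<le> nat (c x n)" unfolding k_def by (rule Least_le) (use that in blast)
      then show ?thesis using v that by linarith
    qed
    define e' where "e' = e(m := v)"
    have e'S: "e' \<in> {..<Suc m} \<rightarrow> S" using eS v by (auto simp: e'_def S0_def Pi_iff less_Suc_eq)
    have e'c: "e' \<in> {..<Suc m} \<rightarrow> carrier M" using e'S Sc by blast
    have comb: "(\<Oplus>t\<in>{..<Suc m}. of_int (z t) \<odot> e' t) = of_int (z m) \<odot> v \<oplus> (\<Oplus>t\<in>{..<m}. of_int (z t) \<odot> e t)"
      for z :: "nat \<Rightarrow> int"
    proof -
      have "(\<Oplus>t\<in>{..<m}. of_int (z t) \<odot> e' t) = (\<Oplus>t\<in>{..<m}. of_int (z t) \<odot> e t)"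
        using eS Sc by (intro M.finsum_cong') (auto simp: e'_def S0_def Pi_iff)
      then show ?thesis unfolding int_comb_Suc[OF e'c] by (simp add: e'_def)
    qed
    have "\<exists>z :: nat \<Rightarrow> int. x = (\<Oplus>t\<in>{..<Suc m}. of_int (z t) \<odot> e' t)" if x: "x \<in> S" for x
    proof -
      define q where "q = c x n div c v n"
      define x' where "x' = x \<ominus> of_int q \<odot> v"
      have qv: "of_int q \<odot> v \<in> S" by (rule int_act_mem[OF S v(1)])
      have x'S: "x' \<in> S" unfolding x'_def by (rule M.additive_subgroup_minus[OF S x qv])
      have "c x' n = c x n - q * c v n" by (simp add: x'_def cdiff[OF x qv] cint[OF v(1)])
      also have "\<dots> = c x n mod c v n" by (simp add: q_def minus_div_mult_eq_mod)
      finally have "0 \<le> c x' n" "c x' n < c v n" using v(2) by simp_all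
      then have "c x' n = 0" using least[OF x'S] by linarith
      then have "x' \<in> S0" using x'S by (simp add: S0_def)
      then obtain z :: "nat \<Rightarrow> int" where z: "x' = (\<Oplus>t\<in>{..<m}. of_int (z t) \<odot> e t)"
        using span0 by blast
      have "(\<Oplus>t\<in>{..<m}. of_int ((z(m := q)) t) \<odot> e t) = x'"
        unfolding z using eS Sc by (intro M.finsum_cong') (auto simp: S0_def Pi_iff)
      then have "(\<Oplus>t\<in>{..<Suc m}. of_int ((z(m := q)) t) \<odot> e' t) = of_int q \<odot> v \<oplus> x'"
        using comb[of "z(m := q)"] by simp
      also have "\<dots> = x"
        using Sc[OF x] Sc[OF qv] M.diff_add_cancel[of x "of_int q \<odot> v"] by (simp add: x'_def M.a_comm)
      finally show ?thesis by (intro exI[of _ "z(m := q)"]) (rule sym)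
    qed
    moreover have "\<forall>t<Suc m. z t = 0" if z: "(\<Oplus>t\<in>{..<Suc m}. of_int (z t) \<odot> e' t) = \<zero>" for z :: "nat \<Rightarrow> int"
    proof -
      let ?w = "\<Oplus>t\<in>{..<m}. of_int (z t) \<odot> e t"
      have w: "?w \<in> S0" by (rule int_comb_mem[OF S0 eS])
      have zv: "of_int (z m) \<odot> v \<in> S" by (rule int_act_mem[OF S v(1)])
      have "c (of_int (z m) \<odot> v \<oplus> ?w) n = z m * c v n"
        using add[OF zv, of ?w n] w cint[OF v(1)] by (simp add: S0_def)
      then have zm: "z m = 0" using z c0 v(2) by (simp add: comb)
      then have "?w = \<zero>" using z Sc[OF v(1)] w Sc by (simp add: comb S0_def)
      then show ?thesis using ind0 zm by (auto simp: less_Suc_eq)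
    qed
    ultimately have "int_basis (Suc m) e' S" using e'S unfolding int_basis_def int_gens_def by blast
    then show ?thesis by blast
  qed
qed

text \<open>Every coset of \<open>n S\<close> in \<open>S\<close> contains a combination of the generators with coefficients
  between \<open>0\<close> and \<open>n - 1\<close>.\<close>

lemma index_multiple_pos:
  assumes S: "additive_subgroup S M" and e: "int_gens m e S" and n: "n > 0"
  shows "a_index M S ((\<lambda>x. add_pow M (n::nat) x) ` S) > 0"
proof -
  let ?N = "(\<lambda>x. add_pow M n x) ` S"
  have N: "additive_subgroup ?N M" by (rule M.add_pow_subgroup[OF S])
  have Sc: "x \<in> carrier M" if "x \<in> S" for x by (rule additive_subgroup.a_Hcarr[OF S that])
  have eS: "e \<in> {..<m} \<rightarrow> S" and span: "\<forall>x\<in>S. \<exists>z :: nat \<Rightarrow> int. x = (\<Oplus>t\<in>{..<m}. of_int (z t) \<odot> e t)"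
    using e by (auto simp: int_gens_def)
  have ec: "e \<in> {..<m} \<rightarrow> carrier M" using eS Sc by blast
  define g where "g z = ?N +> (\<Oplus>t\<in>{..<m}. of_int (z t) \<odot> e t)" for z :: "nat \<Rightarrow> int"
  have "(\<lambda>x. ?N +> x) ` S \<subseteq> g ` PiE {..<m} (\<lambda>_. {0..<int n})"
  proof clarify
    fix x assume x: "x \<in> S"
    then obtain z :: "nat \<Rightarrow> int" where z: "x = (\<Oplus>t\<in>{..<m}. of_int (z t) \<odot> e t)" using span by blast
    define r where "r = (\<lambda>t\<in>{..<m}. z t mod int n)"
    define w where "w = (\<Oplus>t\<in>{..<m}. of_int (z t div int n) \<odot> e t)"
    have w: "w \<in> S" unfolding w_def by (rule int_comb_mem[OF S eS])
    have rS: "(\<Oplus>t\<in>{..<m}. of_int (r t) \<odot> e t) \<in> S" by (rule int_comb_mem[OF S eS])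
    have "of_int (int n) \<odot> w = (\<Oplus>t\<in>{..<m}. (of_int (int n) * of_int (z t div int n)) \<odot> e t)"
      unfolding w_def using ec by (intro lin_comb_scale) auto
    then have "(\<Oplus>t\<in>{..<m}. of_int (r t) \<odot> e t) \<oplus> of_int (int n) \<odot> w =
        (\<Oplus>t\<in>{..<m}. (of_int (r t) + of_int (int n) * of_int (z t div int n)) \<odot> e t)"
      using ec by (simp add: lin_comb_add algebraic_int_plus_times del: of_int_of_nat_eq)
    also have "\<dots> = x"
    proof -
      have "of_int (r t) + of_int (int n) * of_int (z t div int n) = (of_int (z t) :: 'k)" if "t < m" for t
      proof -
        have "r t + int n * (z t div int n) = z t" using that by (simp add: r_def)
        then show ?thesis by (metis of_int_add of_int_mult)
      qed
      then show ?thesis unfolding z using ec by (intro M.finsum_cong') (auto simp: Pi_iff)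
    qed
    finally have "x = (\<Oplus>t\<in>{..<m}. of_int (r t) \<odot> e t) \<oplus> of_int (int n) \<odot> w" by (rule sym)
    then have "x \<ominus> (\<Oplus>t\<in>{..<m}. of_int (r t) \<odot> e t) = of_int (int n) \<odot> w"
      using Sc[OF rS] Sc[OF w] by (simp add: M.add_diff_cancel_left')
    also have "\<dots> = add_pow M n w" using nat_pow_eq_act[OF Sc[OF w]] by simp
    finally have "?N +> x = g r"
      unfolding g_def using M.coset_eq_iff[OF N Sc[OF x] Sc[OF rS]] w by simp
    moreover have "r \<in> PiE {..<m} (\<lambda>_. {0..<int n})" using n by (auto simp: r_def)
    ultimately show "?N +> x \<in> g ` PiE {..<m} (\<lambda>_. {0..<int n})" by blast
  qed
  moreover have "finite (g ` PiE {..<m} (\<lambda>_. {0..<int n}))" by (intro finite_imageI finite_PiE) auto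
  ultimately have "finite ((\<lambda>x. ?N +> x) ` S)" by (rule finite_subset)
  then show ?thesis using additive_subgroup.zero_closed[OF S] by (auto simp: a_index_def card_gt_0_iff)
qed

lemma int_basis_iso:
  assumes S: "additive_subgroup S M" and e: "int_basis m e S"
  shows "add_monoid (M\<lparr>carrier := S\<rparr>) \<cong> product_group {..<m} (\<lambda>_. integer_group)"
proof -
  have Sc: "x \<in> carrier M" if "x \<in> S" for x by (rule additive_subgroup.a_Hcarr[OF S that])
  have eS: "e \<in> {..<m} \<rightarrow> S" and span: "\<forall>x\<in>S. \<exists>z :: nat \<Rightarrow> int. x = (\<Oplus>t\<in>{..<m}. of_int (z t) \<odot> e t)"
    and ind: "\<forall>z :: nat \<Rightarrow> int. (\<Oplus>t\<in>{..<m}. of_int (z t) \<odot> e t) = \<zero> \<longrightarrow> (\<forall>t<m. z t = 0)"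
    using e by (auto simp: int_basis_def int_gens_def)
  have ec: "e \<in> {..<m} \<rightarrow> carrier M" using eS Sc by blast
  let ?P = "product_group {..<m} (\<lambda>_. integer_group)"
  define g where "g z = (\<Oplus>t\<in>{..<m}. of_int (z t) \<odot> e t)" for z :: "nat \<Rightarrow> int"
  have cong: "g z = g z'" if "\<And>t. t < m \<Longrightarrow> z t = z' t" for z z'
    unfolding g_def using ec that by (intro M.finsum_cong') (auto simp: Pi_iff)
  have gadd: "g (\<lambda>t. z t + z' t) = g z \<oplus> g z'" for z z'
    unfolding g_def using ec by (simp add: lin_comb_add)
  have gS: "g z \<in> S" for z unfolding g_def by (rule int_comb_mem[OF S eS])
  have "g \<in> iso ?P (add_monoid (M\<lparr>carrier := S\<rparr>))"
  proof (rule isoI)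
    show "g \<in> hom ?P (add_monoid (M\<lparr>carrier := S\<rparr>))"
    proof (rule homI)
      show "g z \<in> carrier (add_monoid (M\<lparr>carrier := S\<rparr>))" for z using gS by simp
      show "g (z \<otimes>\<^bsub>?P\<^esub> z') = g z \<otimes>\<^bsub>add_monoid (M\<lparr>carrier := S\<rparr>)\<^esub> g z'" for z z'
        using cong[of "z \<otimes>\<^bsub>?P\<^esub> z'" "\<lambda>t. z t + z' t"] gadd[of z z'] by simp
    qed
    show "bij_betw g (carrier ?P) (carrier (add_monoid (M\<lparr>carrier := S\<rparr>)))"
    proof (rule bij_betw_imageI)
      show "inj_on g (carrier ?P)"
      proof (rule inj_onI)
        fix z z' assume z: "z \<in> carrier ?P" and z': "z' \<in> carrier ?P" and eq: "g z = g z'"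
        have "g (\<lambda>t. z t - z' t) \<oplus> g z' = g z"
          using gadd[of "\<lambda>t. z t - z' t" z'] by simp
        then have "g (\<lambda>t. z t - z' t) = \<zero>"
          using eq Sc[OF gS] M.add.r_cancel_one' by metis
        then have "\<forall>t<m. z t - z' t = 0" using ind[rule_format, of "\<lambda>t. z t - z' t"] unfolding g_def by blast
        then show "z = z'" using z z' by (intro PiE_ext[of z "{..<m}" _ z']) auto
      qed
      show "g ` carrier ?P = carrier (add_monoid (M\<lparr>carrier := S\<rparr>))"
      proof
        show "g ` carrier ?P \<subseteq> carrier (add_monoid (M\<lparr>carrier := S\<rparr>))" using gS by auto
        show "carrier (add_monoid (M\<lparr>carrier := S\<rparr>)) \<subseteq> g ` carrier ?P"
        proof
          fix x assume "x \<in> carrier (add_monoid (M\<lparr>carrier := S\<rparr>))"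
          then obtain z :: "nat \<Rightarrow> int" where "x = g z" using span unfolding g_def by auto
          also have "g z = g (restrict z {..<m})" by (rule cong) simp
          finally show "x \<in> g ` carrier ?P" by (auto intro!: imageI)
        qed
      qed
    qed
  qed
  moreover have "group ?P" by simp
  ultimately show ?thesis by (meson group.iso_sym is_isoI)
qed

text \<open>Coordinates are continued by \<open>0\<close>, so that the induction above can vary their number.\<close>

lemma int_coordinates:
  assumes "add_monoid M \<cong> product_group {..<n} (\<lambda>_. integer_group)"
  obtains c :: "'m \<Rightarrow> nat \<Rightarrow> int" where
    "\<forall>x\<in>carrier M. \<forall>t\<ge>n. c x t = 0"
    "\<forall>x\<in>carrier M. \<forall>z\<in>carrier M. \<forall>t. c (x \<oplus> z) t = c x t + c z t"
    "\<forall>x\<in>carrier M. (\<forall>t. c x t = 0) \<longrightarrow> x = \<zero>"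
proof -
  let ?P = "product_group {..<n} (\<lambda>_. integer_group)"
  obtain f where f: "f \<in> iso (add_monoid M) ?P" using assms by (auto simp: is_iso_def)
  then have hom: "f \<in> hom (add_monoid M) ?P" and inj: "inj_on f (carrier M)"
    by (auto simp: iso_def bij_betw_def)
  define c where "c x t = (if t < n then f x t else 0)" for x t
  have f_add: "f (x \<oplus> z) t = f x t + f z t" if "x \<in> carrier M" "z \<in> carrier M" "t < n" for x z t
    using hom_mult[OF hom, of x z] that by simp
  have fP: "f x \<in> carrier ?P" if "x \<in> carrier M" for x using hom_in_carrier[OF hom, of x] that by simp
  have "x = \<zero>" if x: "x \<in> carrier M" and c0: "\<forall>t. c x t = 0" for x
  proof -
    have "f \<zero> t = 0" if "t < n" for t using f_add[of \<zero> \<zero> t] that by simp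
    moreover have "f x t = 0" if "t < n" for t using c0 that by (auto simp: c_def split: if_splits)
    ultimately have "f x = f \<zero>"
      using fP[OF x] fP[OF M.zero_closed] by (intro PiE_ext[of _ "{..<n}" _ "f \<zero>"]) auto
    then show ?thesis using inj x by (auto dest: inj_onD)
  qed
  then show thesis using f_add by (intro that[of c]) (auto simp: c_def)
qed

end

section \<open>Modules over the truncated polynomial ring as modules over the maximal order\<close>

lemma domain_max_order: "domain (max_order :: 'k::number_field ring)"
  by (intro domainI cring_max_order) auto

lemma ideal_y_ideal: "ideal (y_ideal l :: (nat \<Rightarrow> 'k::number_field) set) (UP max_order)"
proof -
  interpret O: cring "max_order :: 'k ring" by (rule cring_max_order)
  interpret UP_cring "max_order :: 'k ring" "UP max_order" by unfold_locales
  show ?thesis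
    unfolding y_ideal_def using monom_closed[of 1 l] by (intro P.cgenideal_ideal) simp
qed

context
  fixes l :: nat
begin

interpretation O: cring "max_order :: 'k::number_field ring" by (rule cring_max_order)

interpretation UP_cring "max_order :: 'k::number_field ring" "UP max_order" by unfold_locales

interpretation I: ideal "y_ideal l :: (nat \<Rightarrow> 'k::number_field) set" "UP max_order" by (rule ideal_y_ideal)

abbreviation (input) P_proj :: "(nat \<Rightarrow> 'k::number_field) \<Rightarrow> (nat \<Rightarrow> 'k) set" where
  "P_proj p \<equiv> y_ideal l +>\<^bsub>UP max_order\<^esub> p"

lemma P_proj_hom: "(\<lambda>p :: nat \<Rightarrow> 'k::number_field. P_proj p) \<in> Ring.ring_hom (UP max_order) (P_ring l)"
  unfolding P_ring_def by (rule I.rcos_ring_hom)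

lemma P_const_closed: "algebraic_int a \<Longrightarrow> P_const l (a :: 'k::number_field) \<in> carrier (P_ring l)"
  unfolding P_const_def by (rule ring_hom_closed[OF P_proj_hom[where 'k = 'k]]) simp

lemma P_const_add:
  "algebraic_int a \<Longrightarrow> algebraic_int b \<Longrightarrow> P_const l (a + b :: 'k::number_field) = P_const l a \<oplus>\<^bsub>P_ring l\<^esub> P_const l b"
  unfolding P_const_def
  using ring_hom_add[OF P_proj_hom[where 'k = 'k]] monom_closed[of a 0] monom_closed[of b 0] monom_add[of a b 0] by simp

lemma P_const_mult:
  "algebraic_int a \<Longrightarrow> algebraic_int b \<Longrightarrow> P_const l (a * b :: 'k::number_field) = P_const l a \<otimes>\<^bsub>P_ring l\<^esub> P_const l b"
  unfolding P_const_def
  using ring_hom_mult[OF P_proj_hom[where 'k = 'k]] monom_closed[of a 0] monom_closed[of b 0] monom_mult[of a b 0 0] by simp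

lemma monom_one_eq: "up_ring.monom (UP max_order) (1 :: 'k::number_field) 0 = \<one>\<^bsub>UP max_order\<^esub>"
  by (rule monom_one[unfolded max_order_simps])

lemma P_const_one: "P_const l (1 :: 'k::number_field) = \<one>\<^bsub>P_ring l\<^esub>"
  unfolding P_const_def using ring_hom_one[OF P_proj_hom[where 'k = 'k]] by (simp add: monom_one_eq)

lemma P_y_pow: "P_y l [^]\<^bsub>P_ring l\<^esub> i = P_proj (up_ring.monom (UP max_order) (1 :: 'k::number_field) i)"
proof (induction i)
  case 0
  then show ?case using ring_hom_one[OF P_proj_hom[where 'k = 'k]] by (simp add: nat_pow_def monom_one_eq)
next
  case (Suc i)
  interpret R: ring "P_ring l :: (nat \<Rightarrow> 'k) set ring" unfolding P_ring_def by (rule I.quotient_is_ring)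
  have "P_y l [^]\<^bsub>P_ring l\<^esub> Suc i = P_proj (up_ring.monom (UP max_order) (1 :: 'k) i) \<otimes>\<^bsub>P_ring l\<^esub> P_y l"
    using Suc by simp
  also have "\<dots> = P_proj (up_ring.monom (UP max_order) (1 :: 'k) i \<otimes>\<^bsub>UP max_order\<^esub> up_ring.monom (UP max_order) 1 1)"
    unfolding P_y_def using ring_hom_mult[OF P_proj_hom[where 'k = 'k]] monom_closed[of 1 i] monom_closed[of 1 1] by simp
  also have "up_ring.monom (UP max_order) (1 :: 'k) i \<otimes>\<^bsub>UP max_order\<^esub> up_ring.monom (UP max_order) 1 1 = up_ring.monom (UP max_order) 1 (Suc i)"
    by (rule monom_one_Suc[unfolded max_order_simps, symmetric])
  finally show ?case .
qed

lemma P_y_nilpotent: "P_y l [^]\<^bsub>P_ring l\<^esub> l = (\<zero>\<^bsub>P_ring l\<^esub> :: (nat \<Rightarrow> 'k::number_field) set)"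
proof -
  have c: "up_ring.monom (UP max_order) (1 :: 'k) l \<in> carrier (UP max_order)" using monom_closed[of 1 l] by simp
  then have "up_ring.monom (UP max_order) (1 :: 'k) l \<in> y_ideal l"
    unfolding y_ideal_def by (rule P.cgenideal_self)
  then have "P_proj (up_ring.monom (UP max_order) (1 :: 'k) l) = y_ideal l"
    by (rule I.a_rcos_const)
  then show ?thesis unfolding P_y_pow by (simp add: P_ring_def FactRing_def)
qed

text \<open>Polynomials in \<open>y\<close> represent all elements, so a subgroup is a submodule as soon as it is stable
  under constants and under \<open>y\<close>.\<close>

lemma P_ring_elem:
  assumes "p \<in> carrier (P_ring l :: (nat \<Rightarrow> 'k::number_field) set ring)"
  obtains n c where "\<And>i. algebraic_int (c i)"
    "p = (\<Oplus>\<^bsub>P_ring l\<^esub>i\<in>{..n::nat}. P_const l (c i :: 'k::number_field) \<otimes>\<^bsub>P_ring l\<^esub> P_y l [^]\<^bsub>P_ring l\<^esub> i)"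
proof -
  obtain f where f: "f \<in> carrier (UP max_order)" "p = P_proj f"
    using assms unfolding P_ring_def FactRing_def A_RCOSETS_def' by auto
  define c where "c = up_ring.coeff (UP max_order) f"
  have c: "algebraic_int (c i)" for i using coeff_closed[OF f(1), of i] by (simp add: c_def)
  let ?n = "deg max_order f"
  interpret R: ring "P_ring l :: (nat \<Rightarrow> 'k) set ring" unfolding P_ring_def by (rule I.quotient_is_ring)
  interpret h: ring_hom_ring "UP max_order" "P_ring l" "\<lambda>p. P_proj p"
    unfolding P_ring_def by (rule I.rcos_ring_hom_ring)
  have mc: "up_ring.monom (UP max_order) (c i) j \<in> carrier (UP max_order)" for i j using monom_closed[of "c i" j] c by simp
  have "p = P_proj (\<Oplus>\<^bsub>UP max_order\<^esub>i\<in>{..?n}. up_ring.monom (UP max_order) (c i) i)"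
    using up_repr[OF f(1)] f(2) by (simp add: c_def)
  also have "\<dots> = (\<Oplus>\<^bsub>P_ring l\<^esub>i\<in>{..?n}. P_proj (up_ring.monom (UP max_order) (c i) i))"
    using h.hom_finsum[of "\<lambda>i. up_ring.monom (UP max_order) (c i) i" "{..?n}"] mc by (simp add: comp_def)
  also have "\<dots> = (\<Oplus>\<^bsub>P_ring l\<^esub>i\<in>{..?n}. P_const l (c i) \<otimes>\<^bsub>P_ring l\<^esub> P_y l [^]\<^bsub>P_ring l\<^esub> i)"
  proof (rule R.finsum_cong'[OF refl])
    show "(\<lambda>i. P_const l (c i) \<otimes>\<^bsub>P_ring l\<^esub> P_y l [^]\<^bsub>P_ring l\<^esub> i) \<in> {..?n} \<rightarrow> carrier (P_ring l)"
      using P_const_closed[OF c] P_y_closed[where 'k = 'k, of l] by auto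
    fix i
    have "up_ring.monom (UP max_order) (c i) i = up_ring.monom (UP max_order) (c i) 0 \<otimes>\<^bsub>UP max_order\<^esub> up_ring.monom (UP max_order) 1 i"
      using monom_mult[of "c i" 1 0 i] c by simp
    then show "P_proj (up_ring.monom (UP max_order) (c i) i) = P_const l (c i) \<otimes>\<^bsub>P_ring l\<^esub> P_y l [^]\<^bsub>P_ring l\<^esub> i"
      unfolding P_y_pow P_const_def using ring_hom_mult[OF P_proj_hom[where 'k = 'k] mc[of i 0]] monom_closed[of 1 i] by simp
  qed
  finally show thesis using that[of c ?n] c by blast
qed

end

text \<open>Restriction of scalars along the constants.\<close>

definition O_module :: "nat \<Rightarrow> ('k::number_field, 'm) P_module \<Rightarrow> ('k, 'm) module" where
  "O_module l M = \<lparr>carrier = carrier M, mult = mult M, one = one M, ring.zero = ring.zero M,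
     add = add M, smult = (\<lambda>a m. P_const l a \<odot>\<^bsub>M\<^esub> m)\<rparr>"

lemma O_module_simps [simp]:
  "carrier (O_module l M) = carrier M" "\<zero>\<^bsub>O_module l M\<^esub> = \<zero>\<^bsub>M\<^esub>"
  "x \<oplus>\<^bsub>O_module l M\<^esub> z = x \<oplus>\<^bsub>M\<^esub> z" "a \<odot>\<^bsub>O_module l M\<^esub> x = P_const l a \<odot>\<^bsub>M\<^esub> x"
  by (simp_all add: O_module_def)

lemma O_module_update_simps [simp]:
  "\<zero>\<^bsub>(O_module l M)\<lparr>carrier := A\<rparr>\<^esub> = \<zero>\<^bsub>M\<^esub>"
  "x \<oplus>\<^bsub>(O_module l M)\<lparr>carrier := A\<rparr>\<^esub> z = x \<oplus>\<^bsub>M\<^esub> z"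
  by (simp_all add: O_module_def)

lemma O_module_coset: "H +>\<^bsub>O_module l M\<^esub> x = H +>\<^bsub>M\<^esub> x"
  by (simp add: a_r_coset_def')

lemma O_module_set_add: "H <+>\<^bsub>O_module l M\<^esub> G = H <+>\<^bsub>M\<^esub> G"
  by (simp add: set_add_def')

lemma O_module_subgroup:
  "subgroup S (add_monoid (O_module l M)) \<longleftrightarrow> subgroup S (add_monoid M)"
  by (simp add: subgroup_def m_inv_def)

lemma O_module_iso:
  "add_monoid ((O_module l M)\<lparr>carrier := S\<rparr>) \<cong> H \<longleftrightarrow> add_monoid (M\<lparr>carrier := S\<rparr>) \<cong> H"
  by (simp add: is_iso_def iso_def hom_def)

locale P_module = module "P_ring l :: (nat \<Rightarrow> 'k::number_field) set ring" M
  for l :: nat and M :: "('k::number_field, 'm) P_module"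
begin

abbreviation N :: "('k, 'm) module" where "N \<equiv> O_module l M"

abbreviation act_y :: "'m \<Rightarrow> 'm" where "act_y \<equiv> \<lambda>m. P_y l \<odot>\<^bsub>M\<^esub> m"

lemma Py: "(P_y l :: (nat \<Rightarrow> 'k) set) \<in> carrier (P_ring l)" by (rule P_y_closed)

lemma act_y_pow: "x \<in> carrier M \<Longrightarrow> (act_y ^^ i) x = (P_y l [^]\<^bsub>P_ring l\<^esub> i) \<odot>\<^bsub>M\<^esub> x"
proof (induction i)
  case 0 then show ?case by simp
next
  case (Suc i)
  have p: "(P_y l :: (nat \<Rightarrow> 'k) set) [^]\<^bsub>P_ring l\<^esub> i \<in> carrier (P_ring l)" by (rule R.nat_pow_closed[OF Py])
  have "(P_y l [^]\<^bsub>P_ring l\<^esub> Suc i) \<odot>\<^bsub>M\<^esub> x = (P_y l \<otimes>\<^bsub>P_ring l\<^esub> P_y l [^]\<^bsub>P_ring l\<^esub> i) \<odot>\<^bsub>M\<^esub> x"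
    using R.m_comm[OF Py p] by simp
  also have "\<dots> = act_y ((P_y l [^]\<^bsub>P_ring l\<^esub> i) \<odot>\<^bsub>M\<^esub> x)"
    by (rule smult_assoc1[OF Py p Suc.prems])
  finally show ?case using Suc by simp
qed

lemma O_module_is_module: "module max_order N"
proof (rule moduleI)
  show "cring (max_order :: 'k ring)" by (rule cring_max_order)
  show "abelian_group N"
    by (rule abelian_groupI) (auto simp: M.a_assoc M.a_comm M.a_lcomm intro: M.l_neg bexI[of _ "\<ominus>\<^bsub>M\<^esub> _"])
  fix a b :: 'k and x z assume *: "a \<in> carrier max_order" "x \<in> carrier N"
  show "a \<odot>\<^bsub>N\<^esub> x \<in> carrier N" using * P_const_closed[of a l] by simp
  show "a \<odot>\<^bsub>N\<^esub> (x \<oplus>\<^bsub>N\<^esub> z) = a \<odot>\<^bsub>N\<^esub> x \<oplus>\<^bsub>N\<^esub> a \<odot>\<^bsub>N\<^esub> z" if "z \<in> carrier N"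
    using * that P_const_closed[of a l] by (simp add: smult_r_distr)
  show "(a \<oplus>\<^bsub>max_order\<^esub> b) \<odot>\<^bsub>N\<^esub> x = a \<odot>\<^bsub>N\<^esub> x \<oplus>\<^bsub>N\<^esub> b \<odot>\<^bsub>N\<^esub> x"
    "a \<otimes>\<^bsub>max_order\<^esub> b \<odot>\<^bsub>N\<^esub> x = a \<odot>\<^bsub>N\<^esub> (b \<odot>\<^bsub>N\<^esub> x)" if "b \<in> carrier max_order"
    using * that P_const_closed[of a l] P_const_closed[of b l]
    by (simp_all add: P_const_add P_const_mult smult_l_distr smult_assoc1)
next
  fix x assume "x \<in> carrier N"
  then show "\<one>\<^bsub>max_order\<^esub> \<odot>\<^bsub>N\<^esub> x = x" by (simp add: P_const_one)
qed

lemma nilpotent_module_N: "nilpotent_module max_order N act_y l"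
proof -
  interpret N: module max_order N by (rule O_module_is_module)
  show ?thesis
  proof (intro nilpotent_module.intro nilpotent_endo.intro nilpotent_endo_axioms.intro nilpotent_module_axioms.intro)
    show "module max_order N" "abelian_group N" by (rule N.module_axioms, rule N.M.abelian_group_axioms)
    show "act_y x \<in> carrier N" if "x \<in> carrier N" for x using that Py by simp
    show "act_y (x \<oplus>\<^bsub>N\<^esub> z) = act_y x \<oplus>\<^bsub>N\<^esub> act_y z" if "x \<in> carrier N" "z \<in> carrier N" for x z
      using that Py by (simp add: smult_r_distr)
    show "(act_y ^^ l) x = \<zero>\<^bsub>N\<^esub>" if "x \<in> carrier N" for x
      using that act_y_pow[of x l] P_y_nilpotent[where 'k = 'k, of l] by simp
    show "act_y (a \<odot>\<^bsub>N\<^esub> x) = a \<odot>\<^bsub>N\<^esub> act_y x" if "a \<in> carrier max_order" "x \<in> carrier N" for a x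
      using that P_const_closed[of a l] Py smult_assoc1[of "P_const l a" "P_y l" x]
        smult_assoc1[of "P_y l" "P_const l a" x] R.m_comm[of "P_const l a" "P_y l"] by simp
  qed
qed

sublocale N: nilpotent_module max_order N act_y l
  by (rule nilpotent_module_N)

lemma K_eq: "K_sub l M i = N.K i"
  using act_y_pow by (auto simp: K_sub_def N.K_def)

lemma K_sub_submodule_eq: "S \<subseteq> carrier M \<Longrightarrow> K_sub l (M\<lparr>carrier := S\<rparr>) i = S \<inter> N.K i"
  unfolding K_eq[symmetric] by (auto simp: K_sub_def)

lemma L_eq: "L_sub l M i = N.L i"
proof -
  have "carrier M \<inter> N.K j = N.K j" for j using N.K_carrier[of j] by auto
  then show ?thesis unfolding L_sub_def N.LS_def K_eq O_module_set_add by simp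
qed

lemma L_sub_submodule_eq: "S \<subseteq> carrier M \<Longrightarrow> L_sub l (M\<lparr>carrier := S\<rparr>) i = N.LS S i"
  unfolding L_sub_def N.LS_def O_module_set_add by (simp add: K_sub_submodule_eq set_add_def')

lemma quot_module_eq:
  assumes "A \<subseteq> carrier M"
  shows "quot_module (P_const l) (M\<lparr>carrier := A\<rparr>) H = quot_module (\<lambda>r. r) (N\<lparr>carrier := A\<rparr>) H"
proof -
  have "a_r_coset (M\<lparr>carrier := A\<rparr>) = a_r_coset (N\<lparr>carrier := A\<rparr>)"
    by (intro ext) (simp add: a_r_coset_def')
  moreover have "set_add (M\<lparr>carrier := A\<rparr>) = set_add (N\<lparr>carrier := A\<rparr>)"
    by (intro ext) (simp add: set_add_def')
  ultimately show ?thesis by (simp add: quot_module_def A_RCOSETS_def O_module_def RCOSETS_def a_r_coset_def)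
qed

lemma Q_mod_eq: "Q_mod l M i = N.QM i"
  unfolding Q_mod_def K_eq L_eq by (rule quot_module_eq) (use N.K_carrier[of i] in simp)

lemma Q_mod_submodule_eq:
  assumes "S \<subseteq> carrier M"
  shows "Q_mod l (M\<lparr>carrier := S\<rparr>) i = quot_module (\<lambda>r. r) (N\<lparr>carrier := S \<inter> N.K i\<rparr>) (N.LS S i)"
  using quot_module_eq[of "S \<inter> N.K i" "N.LS S i"] assms
  by (simp add: Q_mod_def K_sub_submodule_eq L_sub_submodule_eq inf.coboundedI1)

lemma submodule_iff: "submodule S (P_ring l) M \<longleftrightarrow> submodule S max_order N \<and> act_y ` S \<subseteq> S"
proof
  assume S: "submodule S (P_ring l) M"
  then show "submodule S max_order N \<and> act_y ` S \<subseteq> S"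
    using submoduleE(4)[OF S] Py P_const_closed[where 'k = 'k, of _ l]
    unfolding submodule_def submodule_axioms_def O_module_subgroup by auto
next
  assume *: "submodule S max_order N \<and> act_y ` S \<subseteq> S"
  then have S: "additive_subgroup S M" and O: "\<And>a x. algebraic_int a \<Longrightarrow> x \<in> S \<Longrightarrow> P_const l a \<odot>\<^bsub>M\<^esub> x \<in> S"
    unfolding submodule_def submodule_axioms_def O_module_subgroup additive_subgroup_def by auto
  have "p \<odot>\<^bsub>M\<^esub> x \<in> S" if p: "p \<in> carrier (P_ring l)" and x: "x \<in> S" for p x
  proof -
    have xc: "x \<in> carrier M" by (rule additive_subgroup.a_Hcarr[OF S x])
    have y: "(P_y l [^]\<^bsub>P_ring l\<^esub> i) \<odot>\<^bsub>M\<^esub> x \<in> S" for i :: nat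
    proof -
      have "(act_y ^^ i) x \<in> S" using * x by (induction i) auto
      then show ?thesis using act_y_pow[OF xc] by simp
    qed
    have t: "(P_const l a \<otimes>\<^bsub>P_ring l\<^esub> P_y l [^]\<^bsub>P_ring l\<^esub> i) \<odot>\<^bsub>M\<^esub> x \<in> S" if "algebraic_int a" for a :: 'k and i :: nat
      using smult_assoc1[OF P_const_closed[OF that] R.nat_pow_closed[OF Py] xc] O[OF that y] by simp
    obtain n c where c: "\<And>i. algebraic_int (c i :: 'k)"
      "p = (\<Oplus>\<^bsub>P_ring l\<^esub>i\<in>{..n::nat}. P_const l (c i) \<otimes>\<^bsub>P_ring l\<^esub> P_y l [^]\<^bsub>P_ring l\<^esub> i)"
      using P_ring_elem[OF p] by blast
    have tc: "P_const l (c i) \<otimes>\<^bsub>P_ring l\<^esub> P_y l [^]\<^bsub>P_ring l\<^esub> i \<in> carrier (P_ring l)" for i :: nat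
      using P_const_closed[OF c(1)] Py by blast
    have "(\<Oplus>\<^bsub>P_ring l\<^esub>i\<in>I. P_const l (c i) \<otimes>\<^bsub>P_ring l\<^esub> P_y l [^]\<^bsub>P_ring l\<^esub> i) \<odot>\<^bsub>M\<^esub> x \<in> S"
      if "finite I" for I :: "nat set"
      using that
    proof (induction I)
      case empty then show ?case using xc additive_subgroup.zero_closed[OF S] by simp
    next
      case (insert i I)
      have "(\<Oplus>\<^bsub>P_ring l\<^esub>i\<in>I. P_const l (c i) \<otimes>\<^bsub>P_ring l\<^esub> P_y l [^]\<^bsub>P_ring l\<^esub> i) \<in> carrier (P_ring l)"
        using tc by (intro R.finsum_closed) auto
      then show ?case
        using insert tc xc t[OF c(1)] additive_subgroup.a_closed[OF S] by (simp add: smult_l_distr)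
    qed
    then show ?thesis unfolding c(2) by simp
  qed
  then show "submodule S (P_ring l) M"
    using S unfolding submodule_def submodule_axioms_def additive_subgroup_def by blast
qed

end

section \<open>Associated submodules are the adapted ones\<close>

context P_module
begin

lemma max_order_module_N: "max_order_module N"
  by (simp add: max_order_module_def O_module_is_module)

interpretation O: max_order_module N by (rule max_order_module_N)

lemma finite_index_iff: "finite (a_rcosets\<^bsub>M\<^esub> S) \<longleftrightarrow> a_index N (carrier N) S > 0"
proof -
  have "a_rcosets\<^bsub>M\<^esub> S = (\<lambda>a. S +>\<^bsub>N\<^esub> a) ` carrier N"
    by (auto simp: A_RCOSETS_def' a_r_coset_def')
  moreover have "carrier N \<noteq> {}" using M.zero_closed by auto
  ultimately show ?thesis by (simp add: a_index_def card_gt_0_iff)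
qed

lemma sub_quotient_S:
  assumes S: "submodule S max_order N" "act_y ` S \<subseteq> S" and i: "i \<in> {1..l}"
  shows "sub_quotient max_order N (S \<inter> N.K i) (N.LS S i)"
proof (intro sub_quotient.intro sub_quotient_axioms.intro O_module_is_module N.Int_K_submodule N.LS_submodule S)
  have sub: "additive_subgroup S N" by (rule N.submodule_subgroup[OF S(1)])
  show "N.LS S i \<subseteq> S \<inter> N.K i"
    using N.LS_subset[OF sub S(2)] N.LS_subset_K[OF sub, of i] i by auto
qed

lemma Q_map_coset_N:
  assumes S: "submodule S (P_ring l) M" and a: "a \<in> S \<inter> N.K i"
  shows "Q_map l M i (N.LS S i +>\<^bsub>N\<^esub> a) = N.L i +>\<^bsub>N\<^esub> a"
proof -
  have SM: "S \<subseteq> carrier M" by (rule submoduleE(1)[OF S])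
  have "Q_map l M i (L_sub l (M\<lparr>carrier := S\<rparr>) i +>\<^bsub>M\<lparr>carrier := S\<rparr>\<^esub> a) = L_sub l M i +>\<^bsub>M\<^esub> a"
    by (rule Q_map_coset[OF module_axioms S]) (use a in \<open>simp add: K_sub_submodule_eq[OF SM]\<close>)
  moreover have "N.LS S i +>\<^bsub>M\<lparr>carrier := S\<rparr>\<^esub> a = N.LS S i +>\<^bsub>N\<^esub> a"
    by (simp add: a_r_coset_def')
  ultimately show ?thesis by (simp add: L_sub_submodule_eq[OF SM] L_eq O_module_coset)
qed

lemma Q_map_image:
  assumes S: "submodule S (P_ring l) M" and i: "i \<in> {1..l}"
  shows "Q_map l M i ` carrier (Q_mod l (M\<lparr>carrier := S\<rparr>) i) = (\<lambda>a. N.L i +>\<^bsub>N\<^esub> a) ` (S \<inter> N.K i)"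
proof -
  have S': "submodule S max_order N" "act_y ` S \<subseteq> S" using S submodule_iff by auto
  have SM: "S \<subseteq> carrier M" by (rule submoduleE(1)[OF S])
  interpret q: sub_quotient max_order N "S \<inter> N.K i" "N.LS S i" by (rule sub_quotient_S[OF S' i])
  show ?thesis
    unfolding Q_mod_submodule_eq[OF SM] q.carrier_Q image_image
    using Q_map_coset_N[OF S] by (intro image_cong) auto
qed

lemma image_eq_iff:
  assumes S: "submodule S (P_ring l) M" and i: "i \<in> {1..l}" and R: "submodule (Rq) max_order (N.QM i)"
  shows "Rq = Q_map l M i ` carrier (Q_mod l (M\<lparr>carrier := S\<rparr>) i) \<longleftrightarrow>
    (S \<inter> N.K i) <+>\<^bsub>N\<^esub> N.L i = \<Union>Rq"
proof -
  interpret q: sub_quotient max_order N "N.K i" "N.L i" by (rule N.sub_quotient_L[OF i])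
  interpret Q: module max_order "N.QM i" by (rule q.Q_module)
  have RQ: "Rq \<subseteq> carrier (N.QM i)" by (rule Q.submoduleE(1)[OF R])
  have union: "\<Union>((\<lambda>a. N.L i +>\<^bsub>N\<^esub> a) ` (S \<inter> N.K i)) = (S \<inter> N.K i) <+>\<^bsub>N\<^esub> N.L i"
  proof -
    have "S \<inter> N.K i \<subseteq> carrier M" using N.K_carrier[of i] by auto
    moreover have "N.L i \<subseteq> carrier M" using additive_subgroup.a_subset[OF N.L_subgroup[of i]] by simp
    ultimately show ?thesis
      by (auto simp: a_r_coset_def' set_add_def' O_module_coset O_module_set_add subset_iff) (metis M.a_comm Int_iff)+
  qed
  show ?thesis
    unfolding Q_map_image[OF S i]
  proof
    assume "Rq = (\<lambda>a. N.L i +>\<^bsub>N\<^esub> a) ` (S \<inter> N.K i)"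
    then show "(S \<inter> N.K i) <+>\<^bsub>N\<^esub> N.L i = \<Union>Rq" using union by simp
  next
    assume eq: "(S \<inter> N.K i) <+>\<^bsub>N\<^esub> N.L i = \<Union>Rq"
    have "N.L i +>\<^bsub>N\<^esub> a \<in> Rq" if "a \<in> S \<inter> N.K i" for a
    proof -
      have "a \<in> N.L i +>\<^bsub>N\<^esub> a" using q.coset_self that by blast
      then have "a \<in> \<Union>Rq" unfolding eq[symmetric] union[symmetric] using that by blast
      then show ?thesis using q.coset_in_iff[OF RQ] that by blast
    qed
    moreover have "C \<in> (\<lambda>a. N.L i +>\<^bsub>N\<^esub> a) ` (S \<inter> N.K i)" if C: "C \<in> Rq" for C
    proof -
      obtain a where a: "a \<in> N.K i" "C = N.L i +>\<^bsub>N\<^esub> a" using C RQ by (blast elim: q.carrier_QE)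
      have "a \<in> \<Union>Rq" using q.coset_self[OF a(1)] a(2) C by blast
      then obtain s where s: "s \<in> S \<inter> N.K i" "a \<in> N.L i +>\<^bsub>N\<^esub> s" unfolding eq[symmetric] union[symmetric] by blast
      have c: "a \<in> carrier N" "s \<in> carrier N" using a s N.K_carrier by blast+
      have "a \<ominus>\<^bsub>N\<^esub> s \<in> N.L i" using s(2) N.M.a_rcos_iff[OF N.L_subgroup c(2)] by blast
      then have "C = N.L i +>\<^bsub>N\<^esub> s" using N.M.coset_eq_iff[OF N.L_subgroup c] a(2) by blast
      then show ?thesis using s(1) by blast
    qed
    ultimately show "Rq = (\<lambda>a. N.L i +>\<^bsub>N\<^esub> a) ` (S \<inter> N.K i)" by blast
  qed
qed

text \<open>The kernel of \<open>Q\<^sub>i(S) \<rightarrow> Q\<^sub>i(M)\<close> is torsion, because \<open>S\<close> has finite index; as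
  \<open>Q\<^sub>i(S)\<close> is free over a domain of characteristic zero, it vanishes.\<close>

lemma kernel_trivial:
  assumes S: "submodule S max_order N" "act_y ` S \<subseteq> S" and fin: "a_index N (carrier N) S > 0"
    and i: "i \<in> {1..l}"
    and free: "free_module max_order (quot_module (\<lambda>r. r) (N\<lparr>carrier := S \<inter> N.K i\<rparr>) (N.LS S i))"
  shows "S \<inter> N.K i \<inter> N.L i \<subseteq> N.LS S i"
proof
  fix x assume x: "x \<in> S \<inter> N.K i \<inter> N.L i"
  interpret q: sub_quotient max_order N "S \<inter> N.K i" "N.LS S i" by (rule sub_quotient_S[OF S i])
  interpret Q: module max_order q.Q by (rule q.Q_module)
  have Ssub: "additive_subgroup S N" by (rule N.submodule_subgroup[OF S(1)])
  define F :: nat where "F = fact (a_index N (carrier N) S)"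
  have F: "of_nat F \<noteq> (0 :: 'k)" "algebraic_int (of_nat F :: 'k)"
    using algebraic_int_of_int[of "int F", where 'a = 'k] by (auto simp: F_def)
  have FS: "of_nat F \<odot>\<^bsub>N\<^esub> a \<in> S" if "a \<in> carrier N" for a
    using N.M.fact_index_multiple[OF N.carrier_subgroup Ssub fin that] O.nat_pow_eq_act[OF that] by (simp only: F_def)
  have "x \<in> N.L i" using x by blast
  then obtain a b where a: "a \<in> N.K (i + 1)" and b: "b \<in> N.K (i - 1)" and xab: "x = act_y a \<oplus>\<^bsub>N\<^esub> b"
    unfolding N.LS_iff by blast
  have c: "a \<in> carrier N" "b \<in> carrier N" using a b N.K_carrier by blast+
  have "of_nat F \<odot>\<^bsub>N\<^esub> x = of_nat F \<odot>\<^bsub>N\<^esub> act_y a \<oplus>\<^bsub>N\<^esub> of_nat F \<odot>\<^bsub>N\<^esub> b"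
    unfolding xab by (rule O.act_add_right[OF F(2) N.y_closed[OF c(1)] c(2)])
  also have "of_nat F \<odot>\<^bsub>N\<^esub> act_y a = act_y (of_nat F \<odot>\<^bsub>N\<^esub> a)"
    by (rule N.y_smult[symmetric]) (use F c in auto)
  finally have Fx: "of_nat F \<odot>\<^bsub>N\<^esub> x = act_y (of_nat F \<odot>\<^bsub>N\<^esub> a) \<oplus>\<^bsub>N\<^esub> of_nat F \<odot>\<^bsub>N\<^esub> b" .
  have FO: "(of_nat F :: 'k) \<in> carrier max_order" using F(2) by simp
  have "of_nat F \<odot>\<^bsub>N\<^esub> a \<in> S \<inter> N.K (i + 1)" "of_nat F \<odot>\<^bsub>N\<^esub> b \<in> S \<inter> N.K (i - 1)"
    using FS c N.submoduleE(4)[OF N.K_submodule FO] a b by blast+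
  then have FL: "of_nat F \<odot>\<^bsub>N\<^esub> x \<in> N.LS S i" unfolding N.LS_iff using Fx by blast
  have xc: "x \<in> carrier N" using x N.K_carrier by blast
  have Fxc: "of_nat F \<odot>\<^bsub>N\<^esub> x \<in> carrier N" by (rule O.act_closed[OF F(2) xc])
  obtain B where B: "basis_of max_order q.Q B" using free unfolding free_module_iff_basis by blast
  have "of_nat F \<odot>\<^bsub>q.Q\<^esub> (N.LS S i +>\<^bsub>N\<^esub> x) = \<zero>\<^bsub>q.Q\<^esub>"
    unfolding q.coset_smult[OF FO xc] q.zero_Q by (rule iffD2[OF q.coset_eq_H_iff[OF Fxc] FL])
  moreover have "N.LS S i +>\<^bsub>N\<^esub> x \<in> carrier q.Q" unfolding q.carrier_Q using x by blast
  ultimately have "N.LS S i +>\<^bsub>N\<^esub> x = \<zero>\<^bsub>q.Q\<^esub>"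
    using F(1) Q.basis_torsion_free[OF domain_max_order B FO, of "N.LS S i +>\<^bsub>N\<^esub> x"] by (simp only: max_order_simps not_False_eq_True)
  then show "x \<in> N.LS S i" unfolding q.zero_Q by (rule iffD1[OF q.coset_eq_H_iff[OF xc]])
qed

text \<open>Here \<open>Q\<^sub>i(S)\<close> is isomorphic to \<open>R\<^sub>i\<close>.\<close>

lemma Q_free:
  assumes S: "submodule S (P_ring l) M" and i: "i \<in> {1..l}"
    and R: "submodule (Rq) max_order (N.QM i)" and free: "free_module max_order ((N.QM i)\<lparr>carrier := Rq\<rparr>)"
    and ker: "S \<inter> N.K i \<inter> N.L i \<subseteq> N.LS S i" and im: "(S \<inter> N.K i) <+>\<^bsub>N\<^esub> N.L i = \<Union>Rq"
  shows "free_module max_order (quot_module (\<lambda>r. r) (N\<lparr>carrier := S \<inter> N.K i\<rparr>) (N.LS S i))"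
proof -
  have S': "submodule S max_order N" "act_y ` S \<subseteq> S" using S submodule_iff by auto
  have SM: "S \<subseteq> carrier M" by (rule submoduleE(1)[OF S])
  interpret q: sub_quotient max_order N "S \<inter> N.K i" "N.LS S i" by (rule sub_quotient_S[OF S' i])
  interpret Q: module max_order q.Q by (rule q.Q_module)
  interpret p: sub_quotient max_order N "N.K i" "N.L i" by (rule N.sub_quotient_L[OF i])
  let ?f = "Q_map l M i"
  have f: "?f (N.LS S i +>\<^bsub>N\<^esub> a) = N.L i +>\<^bsub>N\<^esub> a" if "a \<in> S \<inter> N.K i" for a
    by (rule Q_map_coset_N[OF S that])
  have c: "a \<in> carrier N" if "a \<in> S \<inter> N.K i" for a using that N.K_carrier by blast
  show ?thesis
  proof (rule Q.free_module_pullback[where f = ?f and N = "(N.QM i)\<lparr>carrier := Rq\<rparr>"])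
    show "module max_order ((N.QM i)\<lparr>carrier := Rq\<rparr>)"
      by (rule submodule.submodule_is_module[OF R p.Q_module])
    show "bij_betw ?f (carrier q.Q) (carrier ((N.QM i)\<lparr>carrier := Rq\<rparr>))"
    proof (rule bij_betw_imageI)
      show "?f ` carrier q.Q = carrier ((N.QM i)\<lparr>carrier := Rq\<rparr>)"
        using image_eq_iff[OF S i R] im by (simp add: Q_mod_submodule_eq[OF SM])
      show "inj_on ?f (carrier q.Q)"
      proof (rule inj_onI)
        fix C D assume "C \<in> carrier q.Q" "D \<in> carrier q.Q" and eq: "?f C = ?f D"
        then obtain a b where ab: "a \<in> S \<inter> N.K i" "b \<in> S \<inter> N.K i" "C = N.LS S i +>\<^bsub>N\<^esub> a" "D = N.LS S i +>\<^bsub>N\<^esub> b"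
          unfolding q.carrier_Q by blast
        have "a \<ominus>\<^bsub>N\<^esub> b \<in> N.L i"
          using eq f[OF ab(1)] f[OF ab(2)] N.M.coset_eq_iff[OF N.L_subgroup c[OF ab(1)] c[OF ab(2)]] ab(3,4) by simp
        moreover have "a \<ominus>\<^bsub>N\<^esub> b \<in> S \<inter> N.K i" by (rule N.M.additive_subgroup_minus[OF q.A_subgroup ab(1,2)])
        ultimately have "a \<ominus>\<^bsub>N\<^esub> b \<in> N.LS S i" using ker by blast
        then show "C = D" using N.M.coset_eq_iff[OF q.H_subgroup c[OF ab(1)] c[OF ab(2)]] ab(3,4) by simp
      qed
    qed
    fix C assume "C \<in> carrier q.Q"
    then obtain a where a: "a \<in> S \<inter> N.K i" "C = N.LS S i +>\<^bsub>N\<^esub> a" unfolding q.carrier_Q by blast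
    show "?f (C \<oplus>\<^bsub>q.Q\<^esub> D) = ?f C \<oplus>\<^bsub>(N.QM i)\<lparr>carrier := Rq\<rparr>\<^esub> ?f D" if D: "D \<in> carrier q.Q" for D
    proof -
      obtain b where b: "b \<in> S \<inter> N.K i" "D = N.LS S i +>\<^bsub>N\<^esub> b" using D unfolding q.carrier_Q by blast
      have ab: "a \<oplus>\<^bsub>N\<^esub> b \<in> S \<inter> N.K i" by (rule additive_subgroup.a_closed[OF q.A_subgroup a(1) b(1)])
      have "?f (C \<oplus>\<^bsub>q.Q\<^esub> D) = N.L i +>\<^bsub>N\<^esub> (a \<oplus>\<^bsub>N\<^esub> b)"
        unfolding a(2) b(2) q.coset_add[OF c[OF a(1)] c[OF b(1)]] by (rule f[OF ab])
      also have "\<dots> = ?f C \<oplus>\<^bsub>N.QM i\<^esub> ?f D"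
        unfolding a(2) b(2) f[OF a(1)] f[OF b(1)] by (rule p.coset_add[OF c[OF a(1)] c[OF b(1)], symmetric])
      finally show ?thesis by simp
    qed
    show "?f (r \<odot>\<^bsub>q.Q\<^esub> C) = r \<odot>\<^bsub>(N.QM i)\<lparr>carrier := Rq\<rparr>\<^esub> ?f C" if r: "r \<in> carrier max_order" for r
    proof -
      have ra: "r \<odot>\<^bsub>N\<^esub> a \<in> S \<inter> N.K i" by (rule N.submoduleE(4)[OF q.A r a(1)])
      have "?f (r \<odot>\<^bsub>q.Q\<^esub> C) = N.L i +>\<^bsub>N\<^esub> (r \<odot>\<^bsub>N\<^esub> a)"
        unfolding a(2) q.coset_smult[OF r c[OF a(1)]] by (rule f[OF ra])
      also have "\<dots> = r \<odot>\<^bsub>N.QM i\<^esub> ?f C"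
        unfolding a(2) f[OF a(1)] by (rule p.coset_smult[OF r c[OF a(1)], symmetric])
      finally show ?thesis by simp
    qed
  qed (rule free)
qed

lemma int_basis_of_subgroup:
  assumes int: "integral_module M" and S: "additive_subgroup S N"
  shows "\<exists>m e. O.int_basis m e S"
proof -
  obtain n :: nat where "add_monoid M \<cong> product_group {..<n} (\<lambda>_. integer_group)"
    using int by (auto simp: integral_module_def)
  then have "add_monoid N \<cong> product_group {..<n} (\<lambda>_. integer_group)"
    using O_module_iso[where l = l and M = M and S = "carrier M" and H = "product_group {..<n} (\<lambda>_. integer_group)"]
    by (simp add: O_module_def)
  then obtain c :: "'m \<Rightarrow> nat \<Rightarrow> int" where c: "\<forall>x\<in>carrier N. \<forall>t\<ge>n. c x t = 0"
    "\<forall>x\<in>carrier N. \<forall>z\<in>carrier N. \<forall>t. c (x \<oplus>\<^bsub>N\<^esub> z) t = c x t + c z t"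
    "\<forall>x\<in>carrier N. (\<forall>t. c x t = 0) \<longrightarrow> x = \<zero>\<^bsub>N\<^esub>"
    by (rule O.int_coordinates)
  have Sc: "x \<in> carrier N" if "x \<in> S" for x by (rule additive_subgroup.a_Hcarr[OF S that])
  show ?thesis
  proof (rule O.int_basis_subgroup[OF S, where n = n and c = c])
    show "c x t = 0" if "x \<in> S" "n \<le> t" for x t using c(1) Sc that by blast
    show "c (x \<oplus>\<^bsub>N\<^esub> z) t = c x t + c z t" if "x \<in> S" "z \<in> S" for x z t using c(2) Sc that by blast
    show "x = \<zero>\<^bsub>N\<^esub>" if "x \<in> S" "\<And>t. c x t = 0" for x using c(3) Sc that by blast
  qed
qed

lemma associated_iff:
  assumes int: "integral_module M"
    and R: "\<And>i. i \<in> {1..l} \<Longrightarrow> submodule (R i) max_order (N.QM i)"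
    and free: "\<And>i. i \<in> {1..l} \<Longrightarrow> free_module max_order ((N.QM i)\<lparr>carrier := R i\<rparr>)"
    and pos: "\<And>i. i \<in> {1..l} \<Longrightarrow> a_index N (N.K i) (\<Union>(R i)) > 0"
  shows "associated l M R S \<longleftrightarrow> S \<in> N.adapted_submodules R"
proof
  assume as: "associated l M R S"
  then have S: "submodule S (P_ring l) M" and fin: "finite (a_rcosets\<^bsub>M\<^esub> S)"
    and std: "standard_module l (M\<lparr>carrier := S\<rparr>)"
    and im: "\<forall>i\<in>{1..l}. R i = Q_map l M i ` carrier (Q_mod l (M\<lparr>carrier := S\<rparr>) i)"
    by (auto simp: associated_def standard_submodule_def)
  have S': "submodule S max_order N" "act_y ` S \<subseteq> S" using S submodule_iff by auto
  have SM: "S \<subseteq> carrier M" by (rule submoduleE(1)[OF S])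
  have "S \<inter> N.K i \<inter> N.L i \<subseteq> N.LS S i" if i: "i \<in> {1..l}" for i
    using std i fin unfolding standard_module_def finite_index_iff
    by (intro kernel_trivial[OF S' _ i]) (auto simp: Q_mod_submodule_eq[OF SM])
  moreover have "(S \<inter> N.K i) <+>\<^bsub>N\<^esub> N.L i = \<Union>(R i)" if i: "i \<in> {1..l}" for i
    using im i image_eq_iff[OF S i R[OF i]] by blast
  ultimately show "S \<in> N.adapted_submodules R"
    using S' N.submodule_subgroup[OF S'(1)] by (simp add: N.adapted_submodules_def N.adapted_def)
next
  assume "S \<in> N.adapted_submodules R"
  then have S': "submodule S max_order N" and ad: "N.adapted (\<lambda>i. \<Union>(R i)) S"
    by (auto simp: N.adapted_submodules_def)
  have yS: "act_y ` S \<subseteq> S" and ker: "\<And>i. i \<in> {1..l} \<Longrightarrow> S \<inter> N.K i \<inter> N.L i \<subseteq> N.LS S i"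
    and im: "\<And>i. i \<in> {1..l} \<Longrightarrow> (S \<inter> N.K i) <+>\<^bsub>N\<^esub> N.L i = \<Union>(R i)"
    using ad by (auto simp: N.adapted_def)
  have S: "submodule S (P_ring l) M" using S' yS submodule_iff by blast
  have SM: "S \<subseteq> carrier M" by (rule submoduleE(1)[OF S])
  have "free_module max_order (Q_mod l (M\<lparr>carrier := S\<rparr>) i)" if i: "i \<in> {1..l}" for i
    unfolding Q_mod_submodule_eq[OF SM] by (rule Q_free[OF S i R[OF i] free[OF i] ker[OF i] im[OF i]])
  moreover have "integral_module (M\<lparr>carrier := S\<rparr>)"
  proof -
    have Ssub: "additive_subgroup S N" by (rule N.submodule_subgroup[OF S'])
    obtain m e where "O.int_basis m e S" using int_basis_of_subgroup[OF int Ssub] by blast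
    from O.int_basis_iso[OF Ssub this] show ?thesis
      unfolding integral_module_def O_module_iso by blast
  qed
  moreover have "finite (a_rcosets\<^bsub>M\<^esub> S)"
  proof -
    have "a_index N (N.K l) (S \<inter> N.K l) > 0"
      unfolding N.index_Int_K[OF ad order_refl] using pos by (intro prod_pos) auto
    moreover have "S \<inter> carrier M = S" using SM by blast
    ultimately show ?thesis unfolding finite_index_iff by (simp add: N.K_top)
  qed
  moreover have "R i = Q_map l M i ` carrier (Q_mod l (M\<lparr>carrier := S\<rparr>) i)" if i: "i \<in> {1..l}" for i
    using im[OF i] image_eq_iff[OF S i R[OF i]] by blast
  ultimately show "associated l M R S"
    using S by (simp add: associated_def standard_submodule_def standard_module_def)
qed

text \<open>\<open>Q\<^sub>i\<close> is generated by the cosets of the generators of \<open>K\<^sub>i\<close>, so its independent subsets are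
  bounded and the basis is finite.\<close>

lemma rank_Q:
  assumes int: "integral_module M" and i: "i \<in> {1..l}"
    and R: "submodule C max_order (N.QM i)" and B: "basis_of max_order ((N.QM i)\<lparr>carrier := C\<rparr>) B"
    and pos: "a_index N (N.K i) (\<Union>C) > 0"
  shows "finite B" and "torsion_free_rank (N.QM i) = card B * torsion_free_rank (max_order :: 'k ring)"
proof -
  interpret q: sub_quotient max_order N "N.K i" "N.L i" by (rule N.sub_quotient_L[OF i])
  interpret Q: max_order_module "N.QM i" unfolding max_order_module_def by (rule q.Q_module)
  obtain m e where e: "O.int_basis m e (N.K i)" using int_basis_of_subgroup[OF int N.K_subgroup] by blast
  then have eK: "e \<in> {..<m} \<rightarrow> N.K i"
    and span: "\<forall>x\<in>N.K i. \<exists>z :: nat \<Rightarrow> int. x = (\<Oplus>\<^bsub>N\<^esub>t\<in>{..<m}. of_int (z t) \<odot>\<^bsub>N\<^esub> e t)"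
    by (auto simp: O.int_basis_def O.int_gens_def)
  let ?e = "\<lambda>t. N.L i +>\<^bsub>N\<^esub> e t"
  have g: "Q.int_gens m ?e (carrier (N.QM i))"
    unfolding Q.int_gens_def
  proof (intro conjI ballI)
    show eQ: "?e \<in> {..<m} \<rightarrow> carrier (N.QM i)" unfolding q.carrier_Q using eK by blast
    fix X' assume "X' \<in> carrier (N.QM i)"
    then obtain x where x: "x \<in> N.K i" "X' = N.L i +>\<^bsub>N\<^esub> x" unfolding q.carrier_Q by blast
    obtain z :: "nat \<Rightarrow> int" where z: "x = (\<Oplus>\<^bsub>N\<^esub>t\<in>{..<m}. of_int (z t) \<odot>\<^bsub>N\<^esub> e t)" using span x(1) by blast
    have "X' = (\<Oplus>\<^bsub>N.QM i\<^esub>t\<in>{..<m}. N.L i +>\<^bsub>N\<^esub> (of_int (z t) \<odot>\<^bsub>N\<^esub> e t))"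
      unfolding x(2) z
    proof (rule q.coset_finsum)
      show "(\<lambda>t. of_int (z t) \<odot>\<^bsub>N\<^esub> e t) \<in> {..<m} \<rightarrow> N.K i"
        using eK by (intro Pi_I N.submoduleE(4)[OF N.K_submodule]) auto
    qed
    also have "\<dots> = (\<Oplus>\<^bsub>N.QM i\<^esub>t\<in>{..<m}. of_int (z t) \<odot>\<^bsub>N.QM i\<^esub> ?e t)"
    proof (rule Q.M.finsum_cong'[OF refl])
      show "(\<lambda>t. of_int (z t) \<odot>\<^bsub>N.QM i\<^esub> ?e t) \<in> {..<m} \<rightarrow> carrier (N.QM i)"
        using eQ by (intro Pi_I Q.act_closed) auto
      fix t assume "t \<in> {..<m}"
      then have "e t \<in> carrier N" using eK N.K_carrier by blast
      then show "N.L i +>\<^bsub>N\<^esub> (of_int (z t) \<odot>\<^bsub>N\<^esub> e t) = of_int (z t) \<odot>\<^bsub>N.QM i\<^esub> ?e t"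
        by (intro q.coset_smult[symmetric]) auto
    qed
    finally show "\<exists>z :: nat \<Rightarrow> int. X' = (\<Oplus>\<^bsub>N.QM i\<^esub>t\<in>{..<m}. of_int (z t) \<odot>\<^bsub>N.QM i\<^esub> ?e t)" by blast
  qed
  show fin: "finite B" by (rule Q.finite_submodule_basis[OF R B g])
  show "torsion_free_rank (N.QM i) = card B * torsion_free_rank (max_order :: 'k ring)"
    by (rule Q.torsion_free_rank_eq[OF R B fin]) (use pos q.index_quotient(1)[OF R] in simp)
qed

end

section \<open>The count\<close>

text \<open>The exponent \<open>r\<^sub>i\<close> belongs to \<open>h\<^sub>k \<cdots> h\<^sub>l\<close> for all \<open>k \<le> i\<close>. Collecting for fixed \<open>k\<close> the exponents \<open>r\<^sub>i\<close>
  with \<open>i \<ge> k\<close> exchanges the two products.\<close>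

lemma count_formula:
  fixes h e b :: "nat \<Rightarrow> nat" and r :: "nat \<Rightarrow> real"
  assumes h: "\<And>i. i \<in> {1..l} \<Longrightarrow> h i > 0"
    and e: "\<And>i. i \<in> {1..l} \<Longrightarrow> h i * e i = (\<Prod>k=1..i. \<Prod>j=k..l. h j)"
    and r: "\<And>i. i \<in> {1..l} \<Longrightarrow> r i = real (b i)"
  shows "real (\<Prod>i=1..l. e i ^ b i) =
    (\<Prod>i=1..l. (\<Prod>j=i..l. real (h j)) powr (\<Sum>j=i..l. r j) / real (h i) powr r i)"
proof -
  define g where "g i = (\<Prod>j=i..l. real (h j))" for i
  have gpos: "g i > 0" if "i \<in> {1..l}" for i unfolding g_def using h that by (intro prod_pos) auto
  have "real (e i) = (\<Prod>k=1..i. g k) / real (h i)" if i: "i \<in> {1..l}" for i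
  proof -
    have "real (h i) * real (e i) = (\<Prod>k=1..i. g k)"
      unfolding g_def using arg_cong[OF e[OF i], of real] by simp
    then show ?thesis using h[OF i] by (simp add: field_simps)
  qed
  then have "real (\<Prod>i=1..l. e i ^ b i) = (\<Prod>i=1..l. (\<Prod>k=1..i. g k ^ b i) / real (h i) ^ b i)"
    unfolding of_nat_prod of_nat_power by (intro prod.cong refl) (simp add: power_divide prod_power_distrib)
  also have "\<dots> = (\<Prod>i=1..l. \<Prod>k=1..i. g k ^ b i) / (\<Prod>i=1..l. real (h i) ^ b i)"
    by (rule prod_dividef)
  also have "(\<Prod>i=1..l. \<Prod>k=1..i. g k ^ b i) = (\<Prod>k=1..l. \<Prod>i=k..l. g k ^ b i)"
  proof -
    have "(\<Prod>i=1..l. \<Prod>k=1..i. g k ^ b i) = (\<Prod>i=1..l. \<Prod>k | k \<in> {1..l} \<and> k \<le> i. g k ^ b i)"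
      by (intro prod.cong) auto
    also have "\<dots> = (\<Prod>k=1..l. \<Prod>i | i \<in> {1..l} \<and> k \<le> i. g k ^ b i)"
      by (rule prod.swap_restrict) auto
    also have "\<dots> = (\<Prod>k=1..l. \<Prod>i=k..l. g k ^ b i)"
      by (intro prod.cong) auto
    finally show ?thesis .
  qed
  also have "\<dots> / (\<Prod>i=1..l. real (h i) ^ b i) = (\<Prod>i=1..l. (\<Prod>j=i..l. g i ^ b j) / real (h i) ^ b i)"
    by (rule prod_dividef[symmetric])
  also have "\<dots> = (\<Prod>i=1..l. g i powr (\<Sum>j=i..l. r j) / real (h i) powr r i)"
  proof (intro prod.cong refl)
    fix i assume i: "i \<in> {1..l}"
    have "(\<Sum>j=i..l. r j) = real (\<Sum>j=i..l. b j)" using r i by (simp add: of_nat_sum)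
    then have "g i powr (\<Sum>j=i..l. r j) = (\<Prod>j=i..l. g i ^ b j)"
      using gpos[OF i] by (simp add: powr_realpow power_sum del: of_nat_sum)
    moreover have "real (h i) powr r i = real (h i) ^ b i"
      using r[OF i] h[OF i] by (simp add: powr_realpow)
    ultimately show "(\<Prod>j=i..l. g i ^ b j) / real (h i) ^ b i = g i powr (\<Sum>j=i..l. r j) / real (h i) powr r i"
      by simp
  qed
  finally show ?thesis unfolding g_def .
qed

theorem theorem3p20:
  fixes M :: "((nat \<Rightarrow> 'k::number_field) set, 'm) module"
    and l :: nat and r :: "nat \<Rightarrow> real" and h :: "nat \<Rightarrow> nat"
    and R :: "nat \<Rightarrow> 'm set set"
  assumes "l > 0"
    and "module (P_ring l) M"
    and "integral_module M"
    and "\<forall>i\<in>{1..l}. r i = module_type l M i"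
    and "\<forall>i\<in>{1..l}. submodule (R i) max_order (Q_mod l M i)"
    and "\<forall>i\<in>{1..l}. free_module max_order ((Q_mod l M i)\<lparr>carrier := R i\<rparr>)"
    and "\<forall>i\<in>{1..l}. finite (a_rcosets\<^bsub>Q_mod l M i\<^esub> (R i)) \<and>
                     h i = card (a_rcosets\<^bsub>Q_mod l M i\<^esub> (R i))"
  shows "finite {S. associated l M R S} \<and>
    real (card {S. associated l M R S}) =
      (\<Prod>i=1..l. (\<Prod>j=i..l. real (h j)) powr (\<Sum>j=i..l. r j) / real (h i) powr r i)"
proof -
  interpret P_module l M by (rule P_module.intro) (rule assms(2))
  interpret O: max_order_module N by (rule max_order_module_N)
  note int = assms(3)
  have R: "submodule (R i) max_order (N.QM i)" and free: "free_module max_order ((N.QM i)\<lparr>carrier := R i\<rparr>)"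
    if "i \<in> {1..l}" for i
    using assms(5,6) that unfolding Q_mod_eq by blast+
  have h: "a_index N (N.K i) (\<Union>(R i)) = h i" and hpos: "h i > 0" if i: "i \<in> {1..l}" for i
  proof -
    interpret q: sub_quotient max_order N "N.K i" "N.L i" by (rule N.sub_quotient_L[OF i])
    interpret Q: module max_order "N.QM i" by (rule q.Q_module)
    have fin: "finite (a_rcosets\<^bsub>N.QM i\<^esub> (R i))" and hc: "h i = card (a_rcosets\<^bsub>N.QM i\<^esub> (R i))"
      using assms(7) i unfolding Q_mod_eq by blast+
    have "a_index (N.QM i) (carrier (N.QM i)) (R i) = h i"
      unfolding hc a_index_def Q.M.a_rcosets_carrier ..
    then show "a_index N (N.K i) (\<Union>(R i)) = h i" using q.index_quotient(1)[OF R[OF i]] by (rule trans[OF sym, rotated])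
    have "carrier (N.QM i) \<noteq> {}" using Q.M.zero_closed by blast
    then show "h i > 0" using fin unfolding hc Q.M.a_rcosets_carrier by (simp add: card_gt_0_iff)
  qed
  have pos: "a_index N (N.K i) (\<Union>(R i)) > 0" if "i \<in> {1..l}" for i using h hpos that by simp
  obtain B where B: "\<And>i. i \<in> {1..l} \<Longrightarrow> basis_of max_order ((N.QM i)\<lparr>carrier := R i\<rparr>) (B i)"
    using free unfolding free_module_iff_basis by metis
  have finB: "finite (B i)" if "i \<in> {1..l}" for i by (rule rank_Q(1)[OF int that R[OF that] B[OF that] pos[OF that]])
  have rank_pos: "torsion_free_rank (max_order :: 'k ring) > 0"
    using max_order_rational_basis[where 'k = 'k] by metis
  have r: "r i = real (card (B i))" if i: "i \<in> {1..l}" for i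
    using assms(4) i rank_Q(2)[OF int i R[OF i] B[OF i] pos[OF i]] rank_pos
    unfolding module_type_def Q_mod_eq by simp
  define e where "e i = (\<Prod>k=1..i. \<Prod>j=k..l. h j) div h i" for i
  have e: "h i * e i = (\<Prod>k=1..i. \<Prod>j=k..l. h j)" if i: "i \<in> {1..l}" for i
  proof -
    have "h i dvd (\<Prod>j=i..l. h j)" using i by (intro dvd_prodI) auto
    also have "\<dots> dvd (\<Prod>k=1..i. \<Prod>j=k..l. h j)" using i by (intro dvd_prodI[where f = "\<lambda>k. \<Prod>j=k..l. h j"]) auto
    finally show ?thesis by (simp add: e_def)
  qed
  have e': "a_index N (N.K i) (\<Union>(R i)) * e i = (\<Prod>k=1..i. \<Prod>j=k..l. a_index N (N.K j) (\<Union>(R j)))"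
    if i: "i \<in> {1..l}" for i
    using e[OF i] i by (simp add: h)
  have fg: "a_index N (N.L i) ((\<lambda>x. add_pow N n x) ` N.L i) > 0" if "n > 0" for i and n :: nat
  proof -
    obtain m d where "O.int_basis m d (N.L i)" using int_basis_of_subgroup[OF int N.L_subgroup] by blast
    then show ?thesis using that by (intro O.index_multiple_pos[OF N.L_subgroup]) (auto simp: O.int_basis_def)
  qed
  have eq: "{S. associated l M R S} = N.adapted_submodules R"
    using associated_iff[OF int R free pos] by blast
  have "finite (N.adapted_submodules R)" "card (N.adapted_submodules R) = (\<Prod>i=1..l. e i ^ card (B i))"
    by (rule N.card_adapted_submodules[OF R B finB pos fg e']; assumption)+
  then show ?thesis
    unfolding eq using count_formula[OF hpos e r] by simp
qed

end
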